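(* Let $K$, $\kappa$, $u_0$ and $\mathbf{F}_R$ be as in the context, and let $u$ be a global variational solution to the $TV^\alpha_R$-deblurring flow. Then: (i) $u\in C^{0,1/2}([0,T];L^2(\Omega))$ for every $T>0$; (ii) $\int_0^T\int_\Omega|\partial_tu|^2\,dx\,dt\le\mathbf{F}_R(u_0)$ for every $T>0$; (iii) $\frac{1}{t_2-t_1}\int_{t_1}^{t_2}\mathbf{F}_R(u(t))\,dt\le\mathbf{F}_R(u_0)$ for all $0\le t_1<t_2<\infty$.
   Context: Let $N\ge 1$, let $\Omega\subset\mathbb{R}^N$ be a bounded open set, $\alpha\in(0,1)$, and for $T\in(0,\infty)$ write $\Omega_T=\Omega\times(0,T)$. For $\beta\in(0,N)$ the Riesz potential is $I_\beta f(x)=2^{-\beta}\pi^{-N/2}\frac{\Gamma((N-\beta)/2)}{\Gamma(\beta/2)}\int_{\mathbb{R}^N}\frac{f(y)}{|x-y|^{N-\beta}}\,dy$ (applied componentwise to vector fields). For $\Psi\in C^1_c(\mathbb{R}^N;\mathbb{R}^N)$ the Riesz fractional divergence is $\nabla^\alpha_R\cdot\Psi=\operatorname{div}(I_{1-\alpha}\Psi)$. For $f\in L^1(\Omega)$, with $\tilde f$ its extension by zero to $\mathbb{R}^N$, set $TV^\alpha_R(f)=\sup\{\int_{\mathbb{R}^N}\tilde f\,\nabla^\alpha_R\cdot\Psi\,dx:\Psi\in C^1_c(\mathbb{R}^N;\mathbb{R}^N),\ \|\Psi\|_\infty\le 1\}$. Let $BV^\alpha_R(\Omega)=\{f\in L^1(\mathbb{R}^N):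 f=0\text{ a.e. on }\mathbb{R}^N\setminus\Omega,\ TV^\alpha_R(f)<\infty\}$ with norm $\|f\|_{L^1}+TV^\alpha_R(f)$. The space $L^1_w(0,T;BV^\alpha_R(\Omega))$ consists of maps $v:[0,T]\to BV^\alpha_R(\Omega)$ such that $v\in L^1(\Omega_T)$, for every $\Psi\in C^1_c(\mathbb{R}^N;\mathbb{R}^N)$ the map $t\mapsto\int_\Omega v(t)\,\nabla^\alpha_R\cdot\Psi\,dx$ is measurable on $[0,T]$, and $\int_0^T TV^\alpha_R(v(t))\,dt<\infty$. Time derivatives $\partial_t$ are weak derivatives. Let $K:L^1(\Omega)\to L^2(\Omega)$ be a bounded, linear, injective operator with $K[1]=1$ ($1$ the constant function). Let $\kappa\ge 1$ and $u_0\in L^2(\Omega)\cap BV^\alpha_R(\Omega)$. Define $\mathbf{F}_R(u)=TV^\alpha_R(u)+\frac{\kappa}{2}\int_\Omega|K[u]-u_0|^2\,dx$. A function $u:\Omega_T\to\mathbb{R}$ is a variational solution in $\Omega_T$ of the $TV^\alpha_R$-deblurring flow if $u\in L^1_w(0,T;BV^\alpha_R(\Omega))\cap C^0([0,T];L^2(\Omega))$ and $\int_0^T\mathbf{F}_R(u(t))\,dt\le\int_0^T\int_\Omega\partial_tv\,(v-u)\,dx\,dt+\int_0^T\mathbf{F}_R(v(t))\,dt-\frac12\|(v-u)(T)\|^2_{L^2(\Omega)}+\frac12\|v(0)-u_0\|^2_{L^2(\Omega)}$ for every $v\in L^1_w(0,T;BV^\alpha_R(\Omega))$ with $\partial_tv\in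 L^2(\Omega_T)$ and $v(0)\in L^2(\Omega)$. It is a global variational solution if it is a variational solution in $\Omega_T$ for every $T>0$. *)

theory Defs
  imports "HOL-Analysis.Analysis"
begin

definition C1c :: "('a::euclidean_space \<Rightarrow> 'b::real_normed_vector) \<Rightarrow> bool" where
  "C1c f \<longleftrightarrow>
     (\<exists>D. (\<forall>x. (f has_derivative blinfun_apply (D x)) (at x)) \<and> continuous_on UNIV D)
     \<and> compact (closure {x. f x \<noteq> 0})"

definition divergence :: "('a::euclidean_space \<Rightarrow> 'a) \<Rightarrow> 'a \<Rightarrow> real" where
  "divergence G x = (\<Sum>i\<in>Basis. frechet_derivative G (at x) i \<bullet> i)"

definition riesz_const :: "nat \<Rightarrow> real \<Rightarrow> real" where
  "riesz_const N \<beta> = 2 powr (-\<beta>) * pi powr (- real N / 2)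
      * Gamma ((real N - \<beta>) / 2) / Gamma (\<beta> / 2)"

text \<open>Riesz potential of a vector field (componentwise = vector-valued Bochner integral).\<close>
definition riesz_pot :: "real \<Rightarrow> ('a::euclidean_space \<Rightarrow> 'a) \<Rightarrow> 'a \<Rightarrow> 'a" where
  "riesz_pot \<beta> \<Psi> x = riesz_const DIM('a) \<beta> *\<^sub>R
     (\<integral>y. (1 / norm (x - y) powr (real DIM('a) - \<beta>)) *\<^sub>R \<Psi> y \<partial>lborel)"

definition frac_div :: "real \<Rightarrow> ('a::euclidean_space \<Rightarrow> 'a) \<Rightarrow> 'a \<Rightarrow> real" where
  "frac_div \<alpha> \<Psi> x = divergence (riesz_pot (1 - \<alpha>) \<Psi>) x"

definition TVR :: "'a::euclidean_space set \<Rightarrow> real \<Rightarrow> ('a \<Rightarrow> real) \<Rightarrow> ennreal" where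
  "TVR \<Omega> \<alpha> f = (SUP \<Psi>\<in>{\<Psi>::'a\<Rightarrow>'a. C1c \<Psi> \<and> (\<forall>x. norm (\<Psi> x) \<le> 1)}.
      ennreal (\<integral>x. indicator \<Omega> x * f x * frac_div \<alpha> \<Psi> x \<partial>lebesgue))"

definition BVR :: "'a::euclidean_space set \<Rightarrow> real \<Rightarrow> ('a \<Rightarrow> real) set" where
  "BVR \<Omega> \<alpha> = {f. integrable lebesgue f \<and> (AE x in lebesgue. x \<notin> \<Omega> \<longrightarrow> f x = 0)
                  \<and> TVR \<Omega> \<alpha> f < \<infinity>}"

definition L2 :: "'a::euclidean_space set \<Rightarrow> ('a \<Rightarrow> real) \<Rightarrow> bool" where
  "L2 \<Omega> f \<longleftrightarrow> set_borel_measurable lebesgue \<Omega> f \<and> set_integrable lebesgue \<Omega> (\<lambda>x. (f x)\<^sup>2)"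

definition L2sq :: "'a::euclidean_space set \<Rightarrow> ('a \<Rightarrow> real) \<Rightarrow> real" where
  "L2sq \<Omega> f = (LINT x:\<Omega>|lebesgue. (f x)\<^sup>2)"

definition L1 :: "'a::euclidean_space set \<Rightarrow> ('a \<Rightarrow> real) \<Rightarrow> bool" where
  "L1 \<Omega> f \<longleftrightarrow> set_integrable lebesgue \<Omega> f"

definition deblur_operator :: "'a::euclidean_space set \<Rightarrow> (('a \<Rightarrow> real) \<Rightarrow> ('a \<Rightarrow> real)) \<Rightarrow> bool" where
  "deblur_operator \<Omega> K \<longleftrightarrow>
     (\<forall>f. L1 \<Omega> f \<longrightarrow> L2 \<Omega> (K f))
   \<and> (\<forall>f g. L1 \<Omega> f \<longrightarrow> L1 \<Omega> g \<longrightarrow> (AE x in lebesgue. x \<in> \<Omega> \<longrightarrow> f x = g x)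
        \<longrightarrow> (AE x in lebesgue. x \<in> \<Omega> \<longrightarrow> K f x = K g x))
   \<and> (\<forall>f g a b. L1 \<Omega> f \<longrightarrow> L1 \<Omega> g \<longrightarrow>
        (AE x in lebesgue. x \<in> \<Omega> \<longrightarrow> K (\<lambda>y. a * f y + b * g y) x = a * K f x + b * K g x))
   \<and> (\<exists>C. \<forall>f. L1 \<Omega> f \<longrightarrow> sqrt (L2sq \<Omega> (K f)) \<le> C * (LINT x:\<Omega>|lebesgue. \<bar>f x\<bar>))
   \<and> (\<forall>f. L1 \<Omega> f \<longrightarrow> (AE x in lebesgue. x \<in> \<Omega> \<longrightarrow> K f x = 0)
        \<longrightarrow> (AE x in lebesgue. x \<in> \<Omega> \<longrightarrow> f x = 0))
   \<and> (AE x in lebesgue. x \<in> \<Omega> \<longrightarrow> K (\<lambda>_. 1) x = 1)"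

definition FR :: "'a::euclidean_space set \<Rightarrow> real \<Rightarrow> real \<Rightarrow> (('a \<Rightarrow> real) \<Rightarrow> ('a \<Rightarrow> real))
                   \<Rightarrow> ('a \<Rightarrow> real) \<Rightarrow> ('a \<Rightarrow> real) \<Rightarrow> ennreal" where
  "FR \<Omega> \<alpha> \<kappa> K u0 f = TVR \<Omega> \<alpha> f + ennreal (\<kappa> / 2 * L2sq \<Omega> (\<lambda>x. K f x - u0 x))"

definition L1w :: "'a::euclidean_space set \<Rightarrow> real \<Rightarrow> real \<Rightarrow> (real \<Rightarrow> 'a \<Rightarrow> real) \<Rightarrow> bool" where
  "L1w \<Omega> \<alpha> T v \<longleftrightarrow>
     (\<forall>t\<in>{0..T}. v t \<in> BVR \<Omega> \<alpha>)
   \<and> set_integrable lebesgue (\<Omega> \<times> {0<..<T}) (\<lambda>z. v (snd z) (fst z))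
   \<and> (\<forall>\<Psi>::'a \<Rightarrow> 'a. C1c \<Psi> \<longrightarrow>
        (\<lambda>t. LINT x:\<Omega>|lebesgue. v t x * frac_div \<alpha> \<Psi> x) \<in> borel_measurable (restrict_space lborel {0..T}))
   \<and> (\<integral>\<^sup>+ t\<in>{0..T}. TVR \<Omega> \<alpha> (v t) \<partial>lborel) < \<infinity>"

definition C0L2 :: "'a::euclidean_space set \<Rightarrow> real \<Rightarrow> (real \<Rightarrow> 'a \<Rightarrow> real) \<Rightarrow> bool" where
  "C0L2 \<Omega> T v \<longleftrightarrow> (\<forall>t\<in>{0..T}. L2 \<Omega> (v t))
     \<and> (\<forall>t\<in>{0..T}. ((\<lambda>s. L2sq \<Omega> (\<lambda>x. v s x - v t x)) \<longlongrightarrow> 0) (at t within {0..T}))"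

definition C0halfL2 :: "'a::euclidean_space set \<Rightarrow> real \<Rightarrow> (real \<Rightarrow> 'a \<Rightarrow> real) \<Rightarrow> bool" where
  "C0halfL2 \<Omega> T v \<longleftrightarrow> (\<forall>t\<in>{0..T}. L2 \<Omega> (v t))
     \<and> (\<exists>C. \<forall>s\<in>{0..T}. \<forall>t\<in>{0..T}.
            sqrt (L2sq \<Omega> (\<lambda>x. v t x - v s x)) \<le> C * \<bar>t - s\<bar> powr (1/2))"

definition weak_dt_L2 :: "'a::euclidean_space set \<Rightarrow> real \<Rightarrow> (real \<Rightarrow> 'a \<Rightarrow> real)
                          \<Rightarrow> (real \<Rightarrow> 'a \<Rightarrow> real) \<Rightarrow> bool" where
  "weak_dt_L2 \<Omega> T v w \<longleftrightarrow>
     set_borel_measurable lebesgue (\<Omega> \<times> {0<..<T}) (\<lambda>z. w (snd z) (fst z))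
   \<and> set_integrable lebesgue (\<Omega> \<times> {0<..<T}) (\<lambda>z. (w (snd z) (fst z))\<^sup>2)
   \<and> (\<forall>\<phi>::'a \<times> real \<Rightarrow> real. C1c \<phi> \<and> closure {z. \<phi> z \<noteq> 0} \<subseteq> \<Omega> \<times> {0<..<T} \<longrightarrow>
        (LINT z:\<Omega> \<times> {0<..<T}|lebesgue. v (snd z) (fst z) * frechet_derivative \<phi> (at z) (0, 1))
        = - (LINT z:\<Omega> \<times> {0<..<T}|lebesgue. w (snd z) (fst z) * \<phi> z))"

definition var_sol :: "'a::euclidean_space set \<Rightarrow> real \<Rightarrow> real \<Rightarrow> (('a \<Rightarrow> real) \<Rightarrow> ('a \<Rightarrow> real))
                        \<Rightarrow> ('a \<Rightarrow> real) \<Rightarrow> real \<Rightarrow> (real \<Rightarrow> 'a \<Rightarrow> real) \<Rightarrow> bool" where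
  "var_sol \<Omega> \<alpha> \<kappa> K u0 T u \<longleftrightarrow>
     L1w \<Omega> \<alpha> T u \<and> C0L2 \<Omega> T u \<and>
     (\<forall>v w. L1w \<Omega> \<alpha> T v \<and> C0L2 \<Omega> T v \<and> weak_dt_L2 \<Omega> T v w \<longrightarrow>
        enn2ereal (\<integral>\<^sup>+ t\<in>{0..T}. FR \<Omega> \<alpha> \<kappa> K u0 (u t) \<partial>lborel)
        \<le> ereal (LINT z:\<Omega> \<times> {0<..<T}|lebesgue.
                    w (snd z) (fst z) * (v (snd z) (fst z) - u (snd z) (fst z)))
          + enn2ereal (\<integral>\<^sup>+ t\<in>{0..T}. FR \<Omega> \<alpha> \<kappa> K u0 (v t) \<partial>lborel)
          - ereal (1/2 * L2sq \<Omega> (\<lambda>x. v T x - u T x))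
          + ereal (1/2 * L2sq \<Omega> (\<lambda>x. v 0 x - u0 x)))"

definition global_var_sol :: "'a::euclidean_space set \<Rightarrow> real \<Rightarrow> real \<Rightarrow> (('a \<Rightarrow> real) \<Rightarrow> ('a \<Rightarrow> real))
                        \<Rightarrow> ('a \<Rightarrow> real) \<Rightarrow> (real \<Rightarrow> 'a \<Rightarrow> real) \<Rightarrow> bool" where
  "global_var_sol \<Omega> \<alpha> \<kappa> K u0 u \<longleftrightarrow> (\<forall>T>0. var_sol \<Omega> \<alpha> \<kappa> K u0 T u)"

end

theory Submission
  imports Defs
begin

text \<open>
  The comparison map is the time mollification of the solution itself: the solution \<open>v\<close> of
  \<open>h * \<partial>\<^sub>t v + v = u\<close> with \<open>v 0 = u0\<close>. Then \<open>\<partial>\<^sub>t v * (v - u) = - h * (\<partial>\<^sub>t v)\<^sup>2\<close>, and \<open>v t\<close> is a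
  weighted average of \<open>u0\<close> and of \<open>u s\<close>, \<open>s \<le> t\<close>, so that convexity bounds the functional along \<open>v\<close>
  by the same average of its values.
  In the variational inequality its integral along \<open>u\<close> cancels, which leaves
  \<open>\<integral>\<integral> (\<partial>\<^sub>t v)\<^sup>2 + F (v T) + \<parallel>v T - u T\<parallel>\<^sup>2 / (2 * h) \<le> F u0\<close>.
  As \<open>h\<close> tends to 0, \<open>v T\<close> tends to \<open>u T\<close>, lower semicontinuity gives \<open>F (u T) \<le> F u0\<close>, and the bound on
  \<open>\<partial>\<^sub>t v\<close> gives the Hoelder estimate. Since \<open>(u - v) / h\<close> is the Yosida approximation of
  \<open>\<partial>\<^sub>t\<close> applied to \<open>u\<close>, its norm increases as \<open>h\<close> decreases; this makes the functions \<open>\<partial>\<^sub>t v\<close>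
  converge strongly in L2, to the weak derivative of \<open>u\<close>.
\<close>

section \<open>Convergence and differentiation in L2\<close>

text \<open>The solution is not an admissible competitor itself, since nothing is known about its
  time derivative. The mollification is the regularisation that starts exactly from
  \<open>u0\<close>, which kills the initial term, and that turns \<open>v - u\<close> into a
  multiple of \<open>\<partial>\<^sub>t v\<close>, which produces a term of definite sign.
  Integrating \<open>h * B' + B = \<tau>\<close> over \<open>{0..T}\<close> shows why one may divide
  by \<open>h\<close>: the integral of the functional along \<open>v\<close> exceeds that along
  \<open>u\<close> by at most \<open>h * (F u0 - F (v T))\<close>. The limit needs the variation to
  be lower semicontinuous in L2. It is a supremum of pairings with fractional divergences, so each
  of these must be bounded on \<Omega>. This is the reason for the study of Riesz potentials, where
  differentiation is moved from the singular kernel to the smooth field. The fundamental theorem of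
  calculus is applied to real functions of time only, namely to inner products and squared norms
  along curves in L2, so no integral with values in a function space occurs.\<close>

definition sqint :: "'b measure \<Rightarrow> ('b \<Rightarrow> real) \<Rightarrow> bool" where
  "sqint M f \<longleftrightarrow> f \<in> borel_measurable M \<and> integrable M (\<lambda>x. (f x)\<^sup>2)"

text \<open>The square of the norm, not the norm: it is polynomial in inner products, hence
  differentiable along curves, and parallelogram estimates can take the place of the triangle
  inequality.\<close>

definition sqn :: "'b measure \<Rightarrow> ('b \<Rightarrow> real) \<Rightarrow> real" where
  "sqn M f = (\<integral>x. (f x)\<^sup>2 \<partial>M)"

lemma sqint_measurable [measurable_dest]: "sqint M f \<Longrightarrow> f \<in> borel_measurable M"
  by (simp add: sqint_def)

lemma sqint_integrable_sq: "sqint M f \<Longrightarrow> integrable M (\<lambda>x. (f x)\<^sup>2)"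
  by (simp add: sqint_def)

lemma abs_mult_le_squares:
  fixes a b :: real
  shows "\<bar>a * b\<bar> \<le> a\<^sup>2 + b\<^sup>2"
  using sum_squares_bound[of "\<bar>a\<bar>" "\<bar>b\<bar>"] abs_ge_zero[of "a * b"]
  unfolding abs_mult power2_abs by linarith

lemma sqint_integrable_mult:
  assumes "sqint M f" "sqint M g"
  shows "integrable M (\<lambda>x. f x * g x)"
proof (rule Bochner_Integration.integrable_bound)
  show "integrable M (\<lambda>x. (f x)\<^sup>2 + (g x)\<^sup>2)"
    using assms by (simp add: sqint_def)
  show "(\<lambda>x. f x * g x) \<in> borel_measurable M"
    using assms by (auto simp: sqint_def)
  show "AE x in M. norm (f x * g x) \<le> norm ((f x)\<^sup>2 + (g x)\<^sup>2)"
    using abs_mult_le_squares by (intro AE_I2) simp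
qed

lemma sqint_cmult: "sqint M f \<Longrightarrow> sqint M (\<lambda>x. c * f x)"
  by (auto simp: sqint_def power_mult_distrib)

lemma sqint_add: assumes "sqint M f" "sqint M g" shows "sqint M (\<lambda>x. f x + g x)"
  using assms sqint_integrable_mult[OF assms]
  by (auto simp: sqint_def power2_sum mult.assoc)

lemma sqint_diff: assumes "sqint M f" "sqint M g" shows "sqint M (\<lambda>x. f x - g x)"
  using assms sqint_integrable_mult[OF assms]
  by (auto simp: sqint_def power2_diff mult.assoc)

lemma sqint_zero: "sqint M (\<lambda>_. 0)"
  by (simp add: sqint_def)

lemma sqint_bounded_mult:
  assumes "sqint M f" "g \<in> borel_measurable M" "\<And>x. x \<in> space M \<Longrightarrow> \<bar>g x\<bar> \<le> C"
  shows "sqint M (\<lambda>x. f x * g x)"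
  unfolding sqint_def
proof
  show "(\<lambda>x. f x * g x) \<in> borel_measurable M" using assms by (auto simp: sqint_def)
  show "integrable M (\<lambda>x. (f x * g x)\<^sup>2)"
  proof (rule Bochner_Integration.integrable_bound)
    show "integrable M (\<lambda>x. C\<^sup>2 * (f x)\<^sup>2)" using assms by (simp add: sqint_def)
    show "(\<lambda>x. (f x * g x)\<^sup>2) \<in> borel_measurable M" using assms by (auto simp: sqint_def)
    show "AE x in M. norm ((f x * g x)\<^sup>2) \<le> norm (C\<^sup>2 * (f x)\<^sup>2)"
    proof (rule AE_I2)
      fix x assume "x \<in> space M"
      then have "(g x)\<^sup>2 \<le> C\<^sup>2" using assms(3)[of x] by (simp add: abs_le_square_iff[symmetric])
      then show "norm ((f x * g x)\<^sup>2) \<le> norm (C\<^sup>2 * (f x)\<^sup>2)"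
        by (simp add: power_mult_distrib mult.commute[of "(f x)\<^sup>2"] mult_right_mono)
    qed
  qed
qed

lemma sqint_cong_AE:
  assumes "sqint M f" "g \<in> borel_measurable M" "AE x in M. f x = g x"
  shows "sqint M g"
  unfolding sqint_def
proof
  have "integrable M (\<lambda>x. (f x)\<^sup>2)" using assms by (simp add: sqint_def)
  then show "integrable M (\<lambda>x. (g x)\<^sup>2)"
    by (rule Bochner_Integration.integrable_cong_AE_imp) (use assms in auto)
qed (use assms in auto)

lemma sqn_cong_AE:
  assumes "f \<in> borel_measurable M" "g \<in> borel_measurable M" "AE x in M. f x = g x"
  shows "sqn M f = sqn M g"
  unfolding sqn_def by (rule integral_cong_AE) (use assms in auto)

lemma sqn_nonneg [simp]: "0 \<le> sqn M f"
  by (simp add: sqn_def)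

lemma sqn_cmult: "sqn M (\<lambda>x. c * f x) = c\<^sup>2 * sqn M f"
  by (simp add: sqn_def power_mult_distrib)

lemma sqn_minus_commute: "sqn M (\<lambda>x. f x - g x) = sqn M (\<lambda>x. g x - f x)"
  by (simp add: sqn_def power2_commute)

text \<open>A quadratic polynomial in the free scalar \<open>c\<close>: \<open>c = -1\<close> gives
  distances, \<open>c = 1\<close> the parallelogram estimate, and optimising \<open>c\<close> gives
  Cauchy-Schwarz.\<close>

lemma sqn_add_scaled:
  assumes "sqint M f" "sqint M g"
  shows "sqn M (\<lambda>x. f x + c * g x) = sqn M f + 2 * c * (\<integral>x. f x * g x \<partial>M) + c\<^sup>2 * sqn M g"
proof -
  have "sqn M (\<lambda>x. f x + c * g x) = (\<integral>x. (f x)\<^sup>2 + (2 * c) * (f x * g x) + c\<^sup>2 * (g x)\<^sup>2 \<partial>M)"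
    unfolding sqn_def by (intro Bochner_Integration.integral_cong) (auto simp: power2_eq_square algebra_simps)
  also have "\<dots> = sqn M f + 2 * c * (\<integral>x. f x * g x \<partial>M) + c\<^sup>2 * sqn M g"
    using assms sqint_integrable_mult[OF assms]
    by (simp add: sqn_def sqint_def)
  finally show ?thesis .
qed

lemma sqn_diff:
  assumes "sqint M f" "sqint M g"
  shows "sqn M (\<lambda>x. f x - g x) = sqn M f - 2 * (\<integral>x. f x * g x \<partial>M) + sqn M g"
  using sqn_add_scaled[OF assms, of "-1"] by simp

lemma Cauchy_Schwarz_sqn:
  assumes "sqint M f" "sqint M g"
  shows "(\<integral>x. f x * g x \<partial>M)\<^sup>2 \<le> sqn M f * sqn M g"
proof -
  define A B C where "A = sqn M f" and "B = (\<integral>x. f x * g x \<partial>M)" and "C = sqn M g"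
  have *: "0 \<le> A + 2 * c * B + c\<^sup>2 * C" for c
    unfolding A_def B_def C_def sqn_add_scaled[OF assms, symmetric] by simp
  have "0 \<le> A" "0 \<le> C" by (auto simp: A_def C_def)
  show ?thesis unfolding A_def[symmetric] B_def[symmetric] C_def[symmetric]
  proof (cases "C = 0")
    case True
    \<comment> \<open>For \<open>C = 0\<close> the polynomial is affine in \<open>c\<close>, and if
      \<open>B \<noteq> 0\<close> its value at the chosen \<open>c\<close> is -1.\<close>
    then have "B = 0"
      using *[of "-(A + 1) / (2 * B)"] by (cases "B = 0") (auto simp: field_simps)
    with True show "B\<^sup>2 \<le> A * C" by simp
  next
    case False
    then have "0 < C" using \<open>0 \<le> C\<close> by simp
    have "A + 2 * (-B / C) * B + (-B / C)\<^sup>2 * C = A - B\<^sup>2 / C"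
      using \<open>0 < C\<close> by (simp add: field_simps power2_eq_square)
    with *[of "-B / C"] have "B\<^sup>2 / C \<le> A" by simp
    with \<open>0 < C\<close> show "B\<^sup>2 \<le> A * C" by (simp add: field_simps)
  qed
qed

lemma abs_inner_le_sqn:
  assumes "sqint M f" "sqint M g"
  shows "\<bar>\<integral>x. f x * g x \<partial>M\<bar> \<le> sqrt (sqn M f) * sqrt (sqn M g)"
  using Cauchy_Schwarz_sqn[OF assms] by (metis real_sqrt_abs real_sqrt_le_iff real_sqrt_mult)

text \<open>By the parallelogram law the two sides differ by the squared norm of
  \<open>f - g\<close>. The factor 2 is harmless, since the estimate serves to show that distances
  vanish in a limit.\<close>

lemma sqn_add_le:
  assumes "sqint M f" "sqint M g"
  shows "sqn M (\<lambda>x. f x + g x) \<le> 2 * sqn M f + 2 * sqn M g"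
proof -
  have "0 \<le> sqn M (\<lambda>x. f x - g x)" by simp
  with sqn_diff[OF assms] sqn_add_scaled[OF assms, of 1] show ?thesis by simp
qed

text \<open>The filter is arbitrary because the notion serves both for times within an interval and
  for sequences. Membership in L2 is demanded explicitly: the Bochner integral of a non-integrable
  function is 0, so convergence of \<open>sqn\<close> alone would not control the functions.\<close>

definition L2lim :: "'b measure \<Rightarrow> 'c filter \<Rightarrow> ('c \<Rightarrow> 'b \<Rightarrow> real) \<Rightarrow> ('b \<Rightarrow> real) \<Rightarrow> bool" where
  "L2lim M F f l \<longleftrightarrow> sqint M l \<and> (\<forall>\<^sub>F s in F. sqint M (f s))
     \<and> ((\<lambda>s. sqn M (\<lambda>x. f s x - l x)) \<longlongrightarrow> 0) F"

lemma L2lim_const: "sqint M f \<Longrightarrow> L2lim M F (\<lambda>_. f) f"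
  by (simp add: L2lim_def sqn_def)

lemma L2lim_add:
  assumes "L2lim M F f l" "L2lim M F g m"
  shows "L2lim M F (\<lambda>s x. f s x + g s x) (\<lambda>x. l x + m x)"
  unfolding L2lim_def
proof (intro conjI)
  have ev: "\<forall>\<^sub>F s in F. sqint M (f s) \<and> sqint M (g s)"
    using assms by (auto simp: L2lim_def eventually_conj_iff)
  show "sqint M (\<lambda>x. l x + m x)" using assms by (auto simp: L2lim_def sqint_add)
  show "\<forall>\<^sub>F s in F. sqint M (\<lambda>x. f s x + g s x)"
    using ev by eventually_elim (auto intro: sqint_add)
  have "((\<lambda>s. 2 * sqn M (\<lambda>x. f s x - l x) + 2 * sqn M (\<lambda>x. g s x - m x)) \<longlongrightarrow> 2 * 0 + 2 * 0) F"
    using assms by (intro tendsto_intros) (auto simp: L2lim_def)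
  then have lim: "((\<lambda>s. 2 * sqn M (\<lambda>x. f s x - l x) + 2 * sqn M (\<lambda>x. g s x - m x)) \<longlongrightarrow> 0) F"
    by simp
  show "((\<lambda>s. sqn M (\<lambda>x. f s x + g s x - (l x + m x))) \<longlongrightarrow> 0) F"
  proof (rule tendsto_sandwich[OF _ _ tendsto_const lim])
    show "\<forall>\<^sub>F s in F. sqn M (\<lambda>x. f s x + g s x - (l x + m x))
          \<le> 2 * sqn M (\<lambda>x. f s x - l x) + 2 * sqn M (\<lambda>x. g s x - m x)"
      using ev
    proof eventually_elim
      case (elim s)
      then show ?case
        using sqn_add_le[of M "\<lambda>x. f s x - l x" "\<lambda>x. g s x - m x"] assms
        by (auto simp: L2lim_def sqint_diff algebra_simps)
    qed
  qed simp
qed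

lemma L2lim_scale:
  assumes "(c \<longlongrightarrow> d) F" "L2lim M F f l"
  shows "L2lim M F (\<lambda>s x. c s * f s x) (\<lambda>x. d * l x)"
  unfolding L2lim_def
proof (intro conjI)
  have ev: "\<forall>\<^sub>F s in F. sqint M (f s)" and l: "sqint M l"
    and lim: "((\<lambda>s. sqn M (\<lambda>x. f s x - l x)) \<longlongrightarrow> 0) F"
    using assms by (auto simp: L2lim_def)
  show "sqint M (\<lambda>x. d * l x)" using l by (rule sqint_cmult)
  show "\<forall>\<^sub>F s in F. sqint M (\<lambda>x. c s * f s x)"
    using ev by eventually_elim (auto intro: sqint_cmult)
  have "((\<lambda>s. 2 * ((c s)\<^sup>2 * sqn M (\<lambda>x. f s x - l x)) + 2 * ((c s - d)\<^sup>2 * sqn M l))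
        \<longlongrightarrow> 2 * (d\<^sup>2 * 0) + 2 * ((d - d)\<^sup>2 * sqn M l)) F"
    using assms lim by (intro tendsto_intros)
  then have lim': "((\<lambda>s. 2 * ((c s)\<^sup>2 * sqn M (\<lambda>x. f s x - l x)) + 2 * ((c s - d)\<^sup>2 * sqn M l)) \<longlongrightarrow> 0) F"
    by simp
  show "((\<lambda>s. sqn M (\<lambda>x. c s * f s x - d * l x)) \<longlongrightarrow> 0) F"
  proof (rule tendsto_sandwich[OF _ _ tendsto_const lim'])
    show "\<forall>\<^sub>F s in F. sqn M (\<lambda>x. c s * f s x - d * l x)
          \<le> 2 * ((c s)\<^sup>2 * sqn M (\<lambda>x. f s x - l x)) + 2 * ((c s - d)\<^sup>2 * sqn M l)"
      using ev
    proof eventually_elim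
      case (elim s)
      have "sqn M (\<lambda>x. c s * (f s x - l x) + (c s - d) * l x)
          \<le> 2 * sqn M (\<lambda>x. c s * (f s x - l x)) + 2 * sqn M (\<lambda>x. (c s - d) * l x)"
        by (intro sqn_add_le sqint_cmult sqint_diff elim l)
      then show ?case by (simp only: sqn_cmult) (simp add: algebra_simps)
    qed
  qed simp
qed

lemma L2lim_cong:
  assumes "L2lim M F f l" "\<forall>\<^sub>F s in F. f s = g s"
  shows "L2lim M F g l"
  unfolding L2lim_def
proof (intro conjI)
  show "sqint M l" using assms by (simp add: L2lim_def)
  have "\<forall>\<^sub>F s in F. sqint M (f s)" using assms by (simp add: L2lim_def)
  then show "\<forall>\<^sub>F s in F. sqint M (g s)" using assms(2) by eventually_elim simp
  have "((\<lambda>s. sqn M (\<lambda>x. f s x - l x)) \<longlongrightarrow> 0) F" using assms by (simp add: L2lim_def)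
  then show "((\<lambda>s. sqn M (\<lambda>x. g s x - l x)) \<longlongrightarrow> 0) F"
    by (rule Lim_transform_eventually) (use assms(2) in eventually_elim, simp)
qed

lemma L2lim_diff:
  assumes "L2lim M F f l" "L2lim M F g m"
  shows "L2lim M F (\<lambda>s x. f s x - g s x) (\<lambda>x. l x - m x)"
  using L2lim_add[OF assms(1) L2lim_scale[OF tendsto_const[of "-1"] assms(2)]] by simp

text \<open>The error splits bilinearly into the product of both increments and two terms linear in
  one increment, each controlled by Cauchy-Schwarz.\<close>

lemma L2lim_inner:
  assumes "L2lim M F f l" "L2lim M F g m"
  shows "((\<lambda>s. \<integral>x. f s x * g s x \<partial>M) \<longlongrightarrow> (\<integral>x. l x * m x \<partial>M)) F"
proof -
  have ev: "\<forall>\<^sub>F s in F. sqint M (f s) \<and> sqint M (g s)" and l: "sqint M l" and m: "sqint M m"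
    using assms by (auto simp: L2lim_def eventually_conj_iff)
  define a b where "a = (\<lambda>s. sqrt (sqn M (\<lambda>x. f s x - l x)))"
    and "b = (\<lambda>s. sqrt (sqn M (\<lambda>x. g s x - m x)))"
  have ab: "(a \<longlongrightarrow> sqrt 0) F" "(b \<longlongrightarrow> sqrt 0) F"
    unfolding a_def b_def using assms by (auto simp only: L2lim_def intro!: tendsto_real_sqrt)
  have "((\<lambda>s. a s * b s + a s * sqrt (sqn M m) + sqrt (sqn M l) * b s) \<longlongrightarrow>
      sqrt 0 * sqrt 0 + sqrt 0 * sqrt (sqn M m) + sqrt (sqn M l) * sqrt 0) F"
    by (intro tendsto_intros ab)
  then have lim: "((\<lambda>s. a s * b s + a s * sqrt (sqn M m) + sqrt (sqn M l) * b s) \<longlongrightarrow> 0) F" by simp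
  have "((\<lambda>s. (\<integral>x. f s x * g s x \<partial>M) - (\<integral>x. l x * m x \<partial>M)) \<longlongrightarrow> 0) F"
  proof (rule Lim_null_comparison[OF _ lim])
    show "\<forall>\<^sub>F s in F. norm ((\<integral>x. f s x * g s x \<partial>M) - (\<integral>x. l x * m x \<partial>M))
        \<le> a s * b s + a s * sqrt (sqn M m) + sqrt (sqn M l) * b s"
      using ev
    proof eventually_elim
      case (elim s)
      have f: "sqint M (\<lambda>x. f s x - l x)" and g: "sqint M (\<lambda>x. g s x - m x)"
        using elim l m by (auto intro: sqint_diff)
      have "(\<integral>x. f s x * g s x \<partial>M) - (\<integral>x. l x * m x \<partial>M)
         = (\<integral>x. f s x * g s x - l x * m x \<partial>M)"
        using elim l m by (intro Bochner_Integration.integral_diff[symmetric] sqint_integrable_mult) auto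
      also have "\<dots> = (\<integral>x. (f s x - l x) * (g s x - m x) + (f s x - l x) * m x + l x * (g s x - m x) \<partial>M)"
        by (intro Bochner_Integration.integral_cong) (auto simp: algebra_simps)
      also have "\<dots> = (\<integral>x. (f s x - l x) * (g s x - m x) \<partial>M) + (\<integral>x. (f s x - l x) * m x \<partial>M)
          + (\<integral>x. l x * (g s x - m x) \<partial>M)"
        using sqint_integrable_mult[OF f g] sqint_integrable_mult[OF f m] sqint_integrable_mult[OF l g]
        by simp
      finally show ?case
        using abs_inner_le_sqn[OF f g] abs_inner_le_sqn[OF f m] abs_inner_le_sqn[OF l g]
        by (simp add: a_def b_def)
    qed
  qed
  then show ?thesis by (rule Lim_null[THEN iffD2])
qed

lemma L2lim_sqn:
  assumes "L2lim M F f l"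
  shows "((\<lambda>s. sqn M (f s)) \<longlongrightarrow> sqn M l) F"
  using L2lim_inner[OF assms assms] by (simp add: sqn_def power2_eq_square)

text \<open>Strong differentiability, rather than differentiability of pairings with fixed
  functions, is required so that inner products of two moving curves can be differentiated.\<close>

definition has_L2_derivative ::
  "'b measure \<Rightarrow> (real \<Rightarrow> 'b \<Rightarrow> real) \<Rightarrow> ('b \<Rightarrow> real) \<Rightarrow> real \<Rightarrow> real set \<Rightarrow> bool" where
  "has_L2_derivative M v d t S \<longleftrightarrow> sqint M (v t)
     \<and> L2lim M (at t within S) (\<lambda>s x. (v s x - v t x) / (s - t)) d"

lemma has_L2_derivative_continuous:
  assumes "has_L2_derivative M v d t S"
  shows "L2lim M (at t within S) v (v t)"
proof -
  have "((\<lambda>s. s - t) \<longlongrightarrow> t - t) (at t within S)"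
    by (intro tendsto_intros)
  then have "L2lim M (at t within S) (\<lambda>s x. (s - t) * ((v s x - v t x) / (s - t)) + v t x)
      (\<lambda>x. 0 * d x + v t x)"
    using assms by (intro L2lim_add L2lim_scale L2lim_const) (auto simp: has_L2_derivative_def)
  then show ?thesis
    unfolding mult_zero_left add_0
    by (rule L2lim_cong) (auto simp: eventually_at_filter intro!: always_eventually)
qed

lemma has_L2_derivative_const: "sqint M f \<Longrightarrow> has_L2_derivative M (\<lambda>_. f) (\<lambda>_. 0) t S"
  by (auto simp: has_L2_derivative_def intro: L2lim_const sqint_zero)

lemma has_L2_derivative_add:
  assumes "has_L2_derivative M v d t S" "has_L2_derivative M w e t S"
  shows "has_L2_derivative M (\<lambda>s x. v s x + w s x) (\<lambda>x. d x + e x) t S"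
proof -
  have "L2lim M (at t within S) (\<lambda>s x. (v s x - v t x) / (s - t) + (w s x - w t x) / (s - t)) (\<lambda>x. d x + e x)"
    using assms by (intro L2lim_add) (auto simp: has_L2_derivative_def)
  then show ?thesis using assms
    by (auto simp: has_L2_derivative_def sqint_add add_divide_distrib[symmetric] algebra_simps)
qed

lemma has_L2_derivative_scale:
  assumes c: "(c has_real_derivative c') (at t within S)" and v: "has_L2_derivative M v d t S"
  shows "has_L2_derivative M (\<lambda>s x. c s * v s x) (\<lambda>x. c t * d x + c' * v t x) t S"
proof -
  have "(c \<longlongrightarrow> c t) (at t within S)"
    using DERIV_continuous[OF c] by (simp add: continuous_within)
  moreover have "((\<lambda>s. (c s - c t) / (s - t)) \<longlongrightarrow> c') (at t within S)"
    using c by (simp add: has_field_derivative_iff)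
  ultimately have "L2lim M (at t within S) (\<lambda>s x. c s * ((v s x - v t x) / (s - t)) + (c s - c t) / (s - t) * v t x)
     (\<lambda>x. c t * d x + c' * v t x)"
    using v by (intro L2lim_add L2lim_scale L2lim_const) (auto simp: has_L2_derivative_def)
  then have "L2lim M (at t within S) (\<lambda>s x. (c s * v s x - c t * v t x) / (s - t)) (\<lambda>x. c t * d x + c' * v t x)"
    by (rule L2lim_cong) (auto simp: diff_divide_distrib[symmetric] add_divide_distrib[symmetric] algebra_simps)
  then show ?thesis using v by (simp add: has_L2_derivative_def sqint_cmult)
qed

lemma has_L2_derivative_diff:
  assumes "has_L2_derivative M v d t S" "has_L2_derivative M w e t S"
  shows "has_L2_derivative M (\<lambda>s x. v s x - w s x) (\<lambda>x. d x - e x) t S"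
  using has_L2_derivative_add[OF assms(1)
      has_L2_derivative_scale[OF DERIV_const[of "-1"] assms(2)]] by simp

text \<open>The splitting of the increment is asymmetric: one quotient is paired with
  \<open>w s\<close>, the other with \<open>v t\<close>, so the continuity of \<open>w\<close>
  enters along with both derivatives.\<close>

lemma has_L2_derivative_inner:
  assumes v: "has_L2_derivative M v d t S" and w: "has_L2_derivative M w e t S"
  shows "((\<lambda>s. \<integral>x. v s x * w s x \<partial>M) has_real_derivative
     ((\<integral>x. d x * w t x \<partial>M) + (\<integral>x. v t x * e x \<partial>M))) (at t within S)"
proof -
  have vt: "sqint M (v t)" and wt: "sqint M (w t)"
    using v w by (auto simp: has_L2_derivative_def)
  have ev: "\<forall>\<^sub>F s in at t within S. s \<noteq> t" by (simp add: eventually_at_filter)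
  have "\<forall>\<^sub>F s in at t within S. sqint M (v s)" "\<forall>\<^sub>F s in at t within S. sqint M (w s)"
    using has_L2_derivative_continuous[OF v] has_L2_derivative_continuous[OF w]
    by (auto simp: L2lim_def)
  then have "\<forall>\<^sub>F s in at t within S.
      (\<integral>x. (v s x - v t x) / (s - t) * w s x \<partial>M) + (\<integral>x. v t x * ((w s x - w t x) / (s - t)) \<partial>M)
      = ((\<integral>x. v s x * w s x \<partial>M) - (\<integral>x. v t x * w t x \<partial>M)) / (s - t)"
    using ev
  proof eventually_elim
    case (elim s)
    have "integrable M (\<lambda>x. v s x * w s x)" "integrable M (\<lambda>x. v t x * w t x)"
      "integrable M (\<lambda>x. v t x * w s x)"
      using elim vt wt by (auto intro: sqint_integrable_mult)
    then show ?case using elim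
      by (simp add: left_diff_distrib right_diff_distrib diff_divide_distrib)
  qed
  moreover have "((\<lambda>s. (\<integral>x. (v s x - v t x) / (s - t) * w s x \<partial>M) + (\<integral>x. v t x * ((w s x - w t x) / (s - t)) \<partial>M))
      \<longlongrightarrow> (\<integral>x. d x * w t x \<partial>M) + (\<integral>x. v t x * e x \<partial>M)) (at t within S)"
    using v w has_L2_derivative_continuous[OF w]
    by (intro tendsto_add L2lim_inner L2lim_const) (auto simp: has_L2_derivative_def)
  ultimately show ?thesis
    unfolding has_field_derivative_iff by (rule Lim_transform_eventually[rotated])
qed

lemma has_L2_derivative_sqn:
  assumes "has_L2_derivative M v d t S"
  shows "((\<lambda>s. sqn M (v s)) has_real_derivative 2 * (\<integral>x. d x * v t x \<partial>M)) (at t within S)"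
  using has_L2_derivative_inner[OF assms assms] by (simp add: sqn_def power2_eq_square mult.commute)

section \<open>Completeness of L2 for sequences controlled by a bounded energy\<close>

lemma summable_abs_diff_imp_convergent:
  fixes g :: "nat \<Rightarrow> real"
  assumes "summable (\<lambda>k. \<bar>g (Suc k) - g k\<bar>)"
  shows "convergent g"
proof -
  have "summable (\<lambda>k. g (Suc k) - g k)"
    using assms by (rule summable_rabs_cancel)
  then have "convergent (\<lambda>n. \<Sum>k<n. g (Suc k) - g k)"
    by (simp add: summable_iff_convergent)
  then have "convergent (\<lambda>n. g n - g 0)"
    by (simp add: sum_lessThan_telescope)
  from convergent_add[OF this convergent_const[of "g 0"]] show ?thesis by simp
qed

lemma nn_integral_sq_eq_sqn:
  assumes "sqint M f"
  shows "(\<integral>\<^sup>+x. ennreal ((f x)\<^sup>2) \<partial>M) = ennreal (sqn M f)"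
  unfolding sqn_def using assms by (intro nn_integral_eq_integral) (auto simp: sqint_def)

lemma sqn_le_of_nn_integral_le:
  assumes f [measurable]: "f \<in> borel_measurable M"
    and le: "(\<integral>\<^sup>+x. ennreal ((f x)\<^sup>2) \<partial>M) \<le> ennreal c" and "0 \<le> c"
  shows "sqint M f" "sqn M f \<le> c"
proof -
  have "(\<integral>\<^sup>+x. ennreal (norm ((f x)\<^sup>2)) \<partial>M) < \<infinity>"
    using le by (simp add: order_le_less_trans[OF le])
  then show sq: "sqint M f"
    unfolding sqint_def by (intro conjI f integrableI_bounded) auto
  show "sqn M f \<le> c"
    using le \<open>0 \<le> c\<close> unfolding nn_integral_sq_eq_sqn[OF sq] by simp
qed

text \<open>A subsequence with increments of squared norm at most \<open>1 / 4 ^ k\<close> converges almost everywhere,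
  since \<open>\<bar>d\<bar> \<le> 1 / 2 ^ k + 2 ^ k * d\<^sup>2\<close>.\<close>

lemma L2lim_sequence_complete:
  fixes f :: "nat \<Rightarrow> 'b \<Rightarrow> real" and s :: "nat \<Rightarrow> real"
  assumes f: "\<And>n. sqint M (f n)"
    and cauchy: "\<And>m n. m \<le> n \<Longrightarrow> sqn M (\<lambda>x. f n x - f m x) \<le> s n - s m"
    and bound: "\<And>n. s n \<le> B"
  shows "\<exists>W. L2lim M sequentially f W"
proof -
  have [measurable]: "f n \<in> borel_measurable M" for n
    using f by (rule sqint_measurable)
  have "s m \<le> s n" if "m \<le> n" for m n
    using cauchy[OF that] sqn_nonneg[of M "\<lambda>x. f n x - f m x"] by linarith
  then have "incseq s" by (simp add: incseq_def)
  then obtain L where L: "s \<longlonglongrightarrow> L" "\<And>n. s n \<le> L"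
    using incseq_convergent[of s B] bound by blast
  have "\<exists>n\<ge>m. L - s n \<le> 1 / 4 ^ k" for k m :: nat
  proof -
    have "\<forall>\<^sub>F n in sequentially. L - 1 / 4 ^ k < s n"
      using L(1) by (rule order_tendstoD) simp
    then obtain n where "\<And>i. n \<le> i \<Longrightarrow> L - 1 / 4 ^ k < s i"
      by (auto simp: eventually_sequentially)
    from this[of "max n m"] show ?thesis by (intro exI[of _ "max n m"]) auto
  qed
  then have "\<forall>k m. \<exists>n. m \<le> n \<and> L - s n \<le> 1 / 4 ^ k" by blast
  then obtain N where "\<forall>k m. m \<le> N k m \<and> L - s (N k m) \<le> 1 / 4 ^ k" by metis
  then have N: "\<And>k m. m \<le> N k m" "\<And>k m. L - s (N k m) \<le> 1 / 4 ^ k" by auto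
  \<comment> \<open>The argument \<open>Suc (r k)\<close> makes the subsequence strictly increasing.
    The tolerance shrinks with the index, so that at most \<open>1 / 4 ^ k\<close> of the limit
    \<open>L\<close> is still missing at \<open>r k\<close>.\<close>
  define r where "r = rec_nat (N 0 0) (\<lambda>k m. N (Suc k) (Suc m))"
  have r_Suc: "r (Suc k) = N (Suc k) (Suc (r k))" for k by (simp add: r_def)
  have "r k < r (Suc k)" for k using N(1)[of "Suc (r k)" "Suc k"] by (simp add: r_Suc)
  then have r_mono: "strict_mono r" by (simp add: strict_mono_Suc_iff)
  have rL: "L - s (r k) \<le> 1 / 4 ^ k" for k
  proof (cases k)
    case 0
    with N(2)[of 0 0] show ?thesis by (simp add: r_def)
  next
    case (Suc j)
    with N(2)[of "Suc j" "Suc (r j)"] show ?thesis by (simp only: r_Suc)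
  qed
  define g where "g k = f (r k)" for k
  have [measurable]: "g k \<in> borel_measurable M" for k by (simp add: g_def)
  have g: "sqint M (g k)" for k by (simp add: g_def f)
  have g_incr: "sqn M (\<lambda>x. g (Suc k) x - g k x) \<le> 1 / 4 ^ k" for k
    using cauchy[of "r k" "r (Suc k)"] strict_mono_leD[OF r_mono, of k "Suc k"] rL[of k] L(2)[of "r (Suc k)"]
    by (simp add: g_def)
  have AE_conv: "AE x in M. convergent (\<lambda>k. g k x)"
  proof -
    let ?d = "\<lambda>k x. ennreal (2 ^ k * (g (Suc k) x - g k x)\<^sup>2)"
    have "(\<integral>\<^sup>+x. (\<Sum>k. ?d k x) \<partial>M)
        = (\<Sum>k. \<integral>\<^sup>+x. ?d k x \<partial>M)"
      by (rule nn_integral_suminf) measurable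
    also have "\<dots> \<le> (\<Sum>k. ennreal ((1 / 2) ^ k))"
    proof (intro suminf_le allI)
      fix k
      have "(\<integral>\<^sup>+x. ?d k x \<partial>M)
          = 2 ^ k * (\<integral>\<^sup>+x. ennreal ((g (Suc k) x - g k x)\<^sup>2) \<partial>M)"
        by (subst nn_integral_cmult[symmetric]) (auto simp: ennreal_mult ennreal_power[symmetric])
      also have "\<dots> = ennreal (2 ^ k * sqn M (\<lambda>x. g (Suc k) x - g k x))"
        using g by (subst nn_integral_sq_eq_sqn) (auto intro!: sqint_diff simp: ennreal_mult ennreal_power[symmetric])
      also have "\<dots> \<le> ennreal (2 ^ k * (1 / 4 ^ k))"
        by (intro ennreal_leI mult_left_mono g_incr) simp
      also have "(2::real) ^ k * (1 / 4 ^ k) = (1 / 2) ^ k"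
        using power_mult_distrib[of "2::real" 2 k] by (simp add: power_one_over)
      finally show "(\<integral>\<^sup>+x. ?d k x \<partial>M) \<le> ennreal ((1 / 2) ^ k)" .
    qed auto
    also have "\<dots> = ennreal (\<Sum>k. (1 / 2) ^ k)"
      by (rule suminf_ennreal2) (auto intro: summable_geometric)
    finally have "(\<integral>\<^sup>+x. (\<Sum>k. ?d k x) \<partial>M) \<noteq> \<infinity>"
      by (metis ennreal_less_top infinity_ennreal_def leD)
    then have "AE x in M. (\<Sum>k. ?d k x) \<noteq> \<infinity>"
      by (rule nn_integral_PInf_AE[rotated]) measurable
    then show ?thesis
    proof eventually_elim
      case (elim x)
      have "summable (\<lambda>k. 2 ^ k * (g (Suc k) x - g k x)\<^sup>2)"
        by (rule summable_suminf_not_top) (use elim in auto)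
      then have sum: "summable (\<lambda>k. (1 / 2) ^ k + 2 ^ k * (g (Suc k) x - g k x)\<^sup>2)"
        by (intro summable_add summable_geometric) auto
      have "\<bar>d\<bar> \<le> (1 / 2) ^ k + 2 ^ k * d\<^sup>2" for d :: real and k :: nat
      proof (cases "\<bar>d\<bar> \<le> (1 / 2) ^ k")
        case True
        then show ?thesis using zero_le_power2[of d] by (simp add: add_increasing2)
      next
        case False
        then have "1 \<le> 2 ^ k * \<bar>d\<bar>" by (simp add: power_divide field_simps)
        then have "1 * \<bar>d\<bar> \<le> 2 ^ k * \<bar>d\<bar> * \<bar>d\<bar>" by (intro mult_right_mono) auto
        then show ?thesis by (simp add: power2_eq_square mult.assoc add_increasing)
      qed
      then show ?case
        by (intro summable_abs_diff_imp_convergent summable_comparison_test'[OF sum]) simp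
    qed
  qed
  define W where "W x = lim (\<lambda>k. g k x)" for x
  have [measurable]: "W \<in> borel_measurable M" unfolding W_def by measurable
  \<comment> \<open>Fatou's lemma along the subsequence, with \<open>n\<close> fixed. The bound
    holds for every \<open>n\<close>, so the whole sequence converges, not merely the
    subsequence.\<close>
  have dist_W: "sqint M (\<lambda>x. f n x - W x)" "sqn M (\<lambda>x. f n x - W x) \<le> L - s n" for n
  proof -
    have "(\<integral>\<^sup>+x. ennreal ((f n x - W x)\<^sup>2) \<partial>M) = (\<integral>\<^sup>+x. liminf (\<lambda>k. ennreal ((f n x - g k x)\<^sup>2)) \<partial>M)"
    proof (rule nn_integral_cong_AE)
      show "AE x in M. ennreal ((f n x - W x)\<^sup>2) = liminf (\<lambda>k. ennreal ((f n x - g k x)\<^sup>2))"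
        using AE_conv
      proof eventually_elim
        case (elim x)
        then have "(\<lambda>k. g k x) \<longlonglongrightarrow> W x" by (simp add: W_def convergent_LIMSEQ_iff)
        then have "(\<lambda>k. ennreal ((f n x - g k x)\<^sup>2)) \<longlonglongrightarrow> ennreal ((f n x - W x)\<^sup>2)"
          by (intro tendsto_ennrealI tendsto_intros)
        then show ?case by (rule lim_imp_Liminf[OF trivial_limit_sequentially, symmetric])
      qed
    qed
    also have "\<dots> \<le> liminf (\<lambda>k. \<integral>\<^sup>+x. ennreal ((f n x - g k x)\<^sup>2) \<partial>M)"
      by (rule nn_integral_liminf) measurable
    also have "\<dots> \<le> ennreal (L - s n)"
    proof (rule Liminf_le)
      show "\<forall>\<^sub>F k in sequentially. (\<integral>\<^sup>+x. ennreal ((f n x - g k x)\<^sup>2) \<partial>M) \<le> ennreal (L - s n)"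
        unfolding eventually_sequentially
      proof (intro exI allI impI)
        fix k assume "n \<le> k"
        then have "n \<le> r k" using strict_mono_imp_increasing[OF r_mono, of k] by simp
        from cauchy[OF this] L(2)[of "r k"] show "(\<integral>\<^sup>+x. ennreal ((f n x - g k x)\<^sup>2) \<partial>M) \<le> ennreal (L - s n)"
          by (subst nn_integral_sq_eq_sqn) (auto intro!: sqint_diff f g ennreal_leI simp: sqn_minus_commute[of M "f n"] g_def)
      qed
    qed simp
    finally have *: "(\<integral>\<^sup>+x. ennreal ((f n x - W x)\<^sup>2) \<partial>M) \<le> ennreal (L - s n)" .
    have meas: "(\<lambda>x. f n x - W x) \<in> borel_measurable M" by measurable
    have "0 \<le> L - s n" using L(2)[of n] by simp
    from sqn_le_of_nn_integral_le[OF meas * this]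
    show "sqint M (\<lambda>x. f n x - W x)" "sqn M (\<lambda>x. f n x - W x) \<le> L - s n" .
  qed
  have "((\<lambda>n. L - s n) \<longlongrightarrow> L - L) sequentially" by (intro tendsto_intros L)
  then have lim0: "((\<lambda>n. L - s n) \<longlongrightarrow> 0) sequentially" by simp
  have "L2lim M sequentially f W"
    unfolding L2lim_def
  proof (intro conjI)
    show "sqint M W" using sqint_diff[OF f[of 0] dist_W(1)[of 0]] by simp
    show "((\<lambda>n. sqn M (\<lambda>x. f n x - W x)) \<longlongrightarrow> 0) sequentially"
      by (rule tendsto_sandwich[OF _ _ tendsto_const lim0]) (auto simp: dist_W)
  qed (simp add: f)
  then show ?thesis by blast
qed

section \<open>Riesz potentials of test fields\<close>

text \<open>The function is dominated by its values on dyadic shells, which sum to a geometric series.\<close>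

lemma norm_powr_set_integrable_cball:
  fixes R p :: real
  assumes p: "0 \<le> p" "p < DIM('a::euclidean_space)" and R: "0 < R"
  shows "set_integrable lborel (cball 0 R) (\<lambda>z::'a. 1 / norm z powr p)"
proof -
  define N where "N = DIM('a)"
  \<comment> \<open>\<open>c j\<close> bounds the kernel on the shell between the radii
    \<open>r (Suc j)\<close> and \<open>r j\<close>; whole balls replace shells in the sum, which
    costs only a constant factor.\<close>
  define r where "r j = R / 2 ^ j" for j :: nat
  define c where "c j = 1 / r (Suc j) powr p" for j
  define a where "a = 2 powr p"
  have r_pos: "0 < r j" for j using R by (simp add: r_def)
  have c_pos: "0 < c j" for j using r_pos[of "Suc j"] by (simp add: c_def)
  have pointwise: "ennreal (norm (indicator (cball 0 R) z *\<^sub>R (1 / norm z powr p)))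
      \<le> (\<Sum>j. ennreal (c j) * indicator (cball 0 (r j)) z)" for z :: 'a
  \<comment> \<open>At the origin \<open>1 / 0 powr p\<close> evaluates to 0, so the singular point
    itself contributes nothing.\<close>
  proof (cases "z = 0 \<or> R < norm z")
    case True
    then show ?thesis by (auto simp: indicator_def)
  next
    case False
    then have z: "0 < norm z" "norm z \<le> R" by auto
    have "(\<lambda>n. R * (1 / 2) ^ n) \<longlonglongrightarrow> R * 0"
      by (intro tendsto_mult tendsto_const LIMSEQ_realpow_zero) auto
    then have "\<forall>\<^sub>F n in sequentially. R * (1 / 2) ^ n < norm z"
      by (rule order_tendstoD) (use z in simp)
    then obtain m where "R * (1 / 2) ^ m < norm z" by (auto simp: eventually_sequentially)
    then have ex: "\<exists>n. r n < norm z" by (intro exI[of _ m]) (simp add: r_def power_divide)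
    define n where "n = (LEAST n. r n < norm z)"
    have n: "r n < norm z" unfolding n_def using ex by (rule LeastI_ex)
    have "n \<noteq> 0" using n z by (cases n) (auto simp: r_def)
    then obtain j where j: "n = Suc j" by (cases n) auto
    have "\<not> r j < norm z" using not_less_Least[of j "\<lambda>n. r n < norm z"] j by (simp add: n_def)
    then have "z \<in> cball 0 (r j)" by simp
    moreover have "1 / norm z powr p \<le> c j"
    proof -
      have "0 < r (Suc j)" "r (Suc j) \<le> norm z" using n j r_pos[of n] by auto
      moreover from this p have "r (Suc j) powr p \<le> norm z powr p" by (intro powr_mono2) auto
      ultimately show ?thesis unfolding c_def using z by (intro divide_left_mono mult_pos_pos) auto
    qed
    ultimately have "ennreal (norm (indicator (cball 0 R) z *\<^sub>R (1 / norm z powr p)))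
        \<le> ennreal (c j) * indicator (cball 0 (r j)) z"
      using z by (simp add: indicator_def ennreal_leI)
    also have "\<dots> \<le> (\<Sum>j. ennreal (c j) * indicator (cball 0 (r j)) z)"
    proof -
      have "g j \<le> suminf g" for g :: "nat \<Rightarrow> ennreal"
        using sum_le_suminf[OF summableI, of "{j}" g] by simp
      then show ?thesis .
    qed
    finally show ?thesis .
  qed
  have term_eq: "ennreal (c j) * emeasure lborel (cball (0::'a) (r j))
      = ennreal (unit_ball_vol N * R ^ N / R powr p * a * (a / 2 ^ N) ^ j)" for j
  proof -
    have "r (Suc j) powr p = R powr p / a ^ Suc j"
    proof -
      have e: "(2::real) ^ Suc j = 2 powr real (Suc j)"
        by (rule powr_realpow[symmetric]) simp
      have "(2 ^ Suc j) powr p = a ^ Suc j"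
        unfolding e a_def powr_powr by (simp add: powr_power mult.commute del: power_Suc)
      then show ?thesis unfolding r_def using R by (subst powr_divide) auto
    qed
    moreover have "r j ^ N = R ^ N / (2 ^ N) ^ j"
      by (simp add: r_def power_divide power_mult[symmetric] mult.commute)
    ultimately have "c j * (unit_ball_vol N * r j ^ N)
        = unit_ball_vol N * R ^ N / R powr p * a * (a / 2 ^ N) ^ j"
      by (simp add: c_def power_divide)
    moreover have "emeasure lborel (cball (0::'a) (r j)) = ennreal (unit_ball_vol N * r j ^ N)"
      unfolding N_def using r_pos[of j] by (intro emeasure_cball) simp
    ultimately show ?thesis
      using c_pos[of j] by (simp add: ennreal_mult'[symmetric])
  qed
  have a_pos: "0 < a" by (simp add: a_def)
  \<comment> \<open>Here the bound of \<open>p\<close> by the dimension enters: it makes the ratio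
    of the geometric series less than 1.\<close>
  have "a < 2 ^ N" unfolding a_def N_def using p by (simp add: powr_realpow[symmetric])
  then have summ: "summable (\<lambda>j. unit_ball_vol N * R ^ N / R powr p * a * (a / 2 ^ N) ^ j)"
    using a_pos by (intro summable_mult summable_geometric) simp
  have "(\<integral>\<^sup>+z. ennreal (norm (indicator (cball 0 R) z *\<^sub>R (1 / norm z powr p))) \<partial>(lborel :: 'a measure))
      \<le> (\<integral>\<^sup>+z. (\<Sum>j. ennreal (c j) * indicator (cball 0 (r j)) z) \<partial>(lborel :: 'a measure))"
    by (intro nn_integral_mono pointwise)
  also have "\<dots> = (\<Sum>j. ennreal (c j) * emeasure lborel (cball (0::'a) (r j)))"
    by (subst nn_integral_suminf)
      (auto intro!: borel_measurable_times_ennreal borel_measurable_indicator simp: nn_integral_cmult_indicator)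
  also have "\<dots> = ennreal (\<Sum>j. unit_ball_vol N * R ^ N / R powr p * a * (a / 2 ^ N) ^ j)"
    unfolding term_eq using R a_pos by (intro suminf_ennreal2 summ) auto
  finally have "(\<integral>\<^sup>+z. ennreal (norm (indicator (cball 0 R) z *\<^sub>R (1 / norm z powr p))) \<partial>(lborel :: 'a measure)) < \<infinity>"
    by (rule order_le_less_trans) simp
  moreover have "(\<lambda>z::'a. indicator (cball 0 R) z *\<^sub>R (1 / norm z powr p)) \<in> borel_measurable lborel"
    unfolding measurable_lborel1
    by (intro borel_measurable_scaleR borel_measurable_indicator borel_measurable_divide
        borel_measurable_const powr_real_measurable borel_measurable_norm) auto
  ultimately show ?thesis
    unfolding set_integrable_def by (intro integrableI_bounded)
qed

text \<open>The substitution moves the variable \<open>x\<close> from the singular kernel into the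
  test field, where it can be differentiated.\<close>

lemma integral_reflect_lborel:
  fixes f :: "'a::euclidean_space \<Rightarrow> 'b::euclidean_space"
  assumes [measurable]: "f \<in> borel_measurable borel"
  shows "(\<integral>y. f y \<partial>lborel) = (\<integral>z. f (x - z) \<partial>lborel)"
proof -
  have "(lborel :: 'a measure) = distr lborel borel (\<lambda>z. x - z)"
    using lborel_affine[of "-1" x] by (simp add: density_1)
  then have "(\<integral>y. f y \<partial>lborel) = (\<integral>y. f y \<partial>distr lborel borel (\<lambda>z. x - z))" by simp
  also have "\<dots> = (\<integral>z. f (x - z) \<partial>lborel)"
    by (rule integral_distr) measurable
  finally show ?thesis .
qed

section \<open>Convolution of a locally integrable kernel with a compactly supported field\<close>

lemma bounded_of_bounded_support:
  fixes h :: "'a::euclidean_space \<Rightarrow> 'b::real_normed_vector"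
  assumes cont: "continuous_on UNIV h" and supp: "\<And>y. R < norm y \<Longrightarrow> h y = 0"
  obtains B where "\<And>y. norm (h y) \<le> B"
proof -
  have "bounded (h ` cball 0 R)"
    by (intro compact_imp_bounded compact_continuous_image continuous_on_subset[OF cont]) auto
  then obtain B where B: "\<forall>y\<in>h ` cball 0 R. norm y \<le> B" unfolding bounded_iff by blast
  have "norm (h y) \<le> max B 0" for y
    using B supp[of y] by (cases "norm y \<le> R") (auto intro: max.coboundedI1)
  then show ?thesis using that by blast
qed

text \<open>Only local integrability is asked of the kernel: the Riesz kernel is not integrable at
  infinity, but the fields have compact support. Its singularity is met only when this assumption is
  checked.\<close>

locale locally_integrable_kernel =
  fixes k :: "'a::euclidean_space \<Rightarrow> real"
  assumes k_measurable [measurable]: "k \<in> borel_measurable borel"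
    and k_nonneg: "\<And>z. 0 \<le> k z"
    and k_integrable: "\<And>R. 0 < R \<Longrightarrow> set_integrable lborel (cball 0 R) k"
begin

text \<open>The dominating function is the same for all \<open>x\<close> in a ball, as dominated
  convergence requires: \<open>h (x - z) \<noteq> 0\<close> forces
  \<open>norm z \<le> C + R\<close>.\<close>

lemma norm_kernel_mult_le:
  fixes h :: "'a \<Rightarrow> 'b::euclidean_space"
  assumes bd: "\<And>y. norm (h y) \<le> B" and supp: "\<And>y. R < norm y \<Longrightarrow> h y = 0" and x: "norm x \<le> C"
  shows "norm (k z *\<^sub>R h (x - z)) \<le> indicator (cball 0 (C + R)) z *\<^sub>R k z * B"
proof -
  have "0 \<le> B" using bd[of 0] norm_ge_zero order_trans by blast
  show ?thesis
  proof (cases "R < norm (x - z)")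
    case True
    then show ?thesis using \<open>0 \<le> B\<close> k_nonneg[of z] by (simp add: supp)
  next
    case False
    then have "z \<in> cball 0 (C + R)" using norm_triangle_sub[of z x] x by (simp add: norm_minus_commute)
    then show ?thesis using bd[of "x - z"] k_nonneg[of z] \<open>0 \<le> B\<close>
      by (simp add: mult_left_mono)
  qed
qed

lemma integrable_convolution:
  fixes h :: "'a \<Rightarrow> 'b::euclidean_space"
  assumes cont: "continuous_on UNIV h" and supp: "\<And>y. R < norm y \<Longrightarrow> h y = 0" and "0 < R"
  shows "integrable lborel (\<lambda>z. k z *\<^sub>R h (x - z))"
proof -
  note [measurable] = borel_measurable_continuous_onI[OF cont]
  obtain B where B: "\<And>y. norm (h y) \<le> B" using bounded_of_bounded_support[OF cont supp] by blast
  let ?b = "\<lambda>z. indicator (cball 0 (norm x + R)) z *\<^sub>R k z * B"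
  have "0 < norm x + R" using \<open>0 < R\<close> by (simp add: add_nonneg_pos)
  from k_integrable[OF this] have "integrable lborel ?b" by (simp add: set_integrable_def)
  then show ?thesis
  proof (rule Bochner_Integration.integrable_bound)
    show "AE z in lborel. norm (k z *\<^sub>R h (x - z)) \<le> norm (?b z)"
      using norm_kernel_mult_le[OF B supp order_refl] unfolding real_norm_def
      by (intro AE_I2 order_trans[OF _ abs_ge_self])
  qed measurable
qed

lemma norm_convolution_le:
  fixes h :: "'a \<Rightarrow> 'b::euclidean_space"
  assumes int: "integrable lborel (\<lambda>z. k z *\<^sub>R h z)"
    and bd: "\<And>z. norm (h z) \<le> B" and supp: "\<And>z. R < norm z \<Longrightarrow> h z = 0" and "0 < R"
  shows "norm (\<integral>z. k z *\<^sub>R h z \<partial>lborel) \<le> B * (\<integral>z\<in>cball 0 R. k z \<partial>lborel)"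
proof -
  have "norm (\<integral>z. k z *\<^sub>R h z \<partial>lborel) \<le> (\<integral>z. B * (indicator (cball 0 R) z *\<^sub>R k z) \<partial>lborel)"
  proof (rule Bochner_Integration.integral_norm_bound_integral[OF int])
    show "integrable lborel (\<lambda>z. B * (indicator (cball 0 R) z *\<^sub>R k z))"
      using k_integrable[OF \<open>0 < R\<close>] by (simp add: set_integrable_def)
    have "0 \<le> B" using bd[of 0] norm_ge_zero order_trans by blast
    then show "norm (k z *\<^sub>R h z) \<le> B * (indicator (cball 0 R) z *\<^sub>R k z)" for z
      using bd[of z] supp[of z] k_nonneg[of z]
      by (cases "R < norm z") (simp_all add: mult.commute[of B] mult_left_mono)
  qed
  then show ?thesis by (simp add: set_lebesgue_integral_def)
qed

lemma isCont_convolution: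
  fixes h :: "'a \<Rightarrow> 'b::euclidean_space"
  assumes cont: "continuous_on UNIV h" and supp: "\<And>y. R < norm y \<Longrightarrow> h y = 0" and "0 < R"
  shows "isCont (\<lambda>x. \<integral>z. k z *\<^sub>R h (x - z) \<partial>lborel) x"
proof (rule continuous_at_sequentiallyI)
  fix u assume u: "u \<longlonglongrightarrow> x"
  note [measurable] = borel_measurable_continuous_onI[OF cont]
  obtain B where B: "\<And>y. norm (h y) \<le> B" using bounded_of_bounded_support[OF cont supp] by blast
  obtain C where C: "0 < C" "\<And>n. norm (u n) \<le> C"
    using convergent_imp_Bseq[of u] u unfolding convergent_def Bseq_def by blast
  show "(\<lambda>n. \<integral>z. k z *\<^sub>R h (u n - z) \<partial>lborel) \<longlonglongrightarrow> (\<integral>z. k z *\<^sub>R h (x - z) \<partial>lborel)"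
  proof (rule integral_dominated_convergence)
    show "integrable lborel (\<lambda>z. indicator (cball 0 (C + R)) z *\<^sub>R k z * B)"
      using k_integrable[of "C + R"] C(1) \<open>0 < R\<close> by (simp add: set_integrable_def)
    show "AE z in lborel. norm (k z *\<^sub>R h (u n - z)) \<le> indicator (cball 0 (C + R)) z *\<^sub>R k z * B" for n
      by (intro AE_I2 norm_kernel_mult_le B supp C(2))
    have "isCont h y" for y using cont by (simp add: continuous_on_eq_continuous_at)
    then show "AE z in lborel. (\<lambda>n. k z *\<^sub>R h (u n - z)) \<longlonglongrightarrow> k z *\<^sub>R h (x - z)"
      by (intro AE_I2 tendsto_intros isCont_tendsto_compose[of _ h] u)
  qed measurable
qed

text \<open>The first-order remainder of \<open>\<Psi>\<close> at \<open>x - z\<close> is small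
  uniformly in \<open>z\<close>, because \<open>D\<close> is uniformly continuous on compact sets,
  and it vanishes for large \<open>z\<close>. Integration against the kernel then costs only the
  mass of the kernel on a fixed ball.\<close>

lemma has_derivative_convolution:
  fixes \<Psi> :: "'a \<Rightarrow> 'b::euclidean_space" and D :: "'a \<Rightarrow> 'a \<Rightarrow>\<^sub>L 'b"
  assumes deriv: "\<And>x. (\<Psi> has_derivative blinfun_apply (D x)) (at x)"
    and cont: "continuous_on UNIV D"
    and supp: "\<And>y. R < norm y \<Longrightarrow> \<Psi> y = 0" and suppD: "\<And>y. R < norm y \<Longrightarrow> D y = 0" and "0 < R"
  shows "((\<lambda>x. \<integral>z. k z *\<^sub>R \<Psi> (x - z) \<partial>lborel) has_derivative
     (\<lambda>e. \<integral>z. k z *\<^sub>R D (x - z) e \<partial>lborel)) (at x)"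
proof -
  have cont_D: "continuous_on UNIV (\<lambda>y. D y e)" for e
    using cont by (intro continuous_intros)
  have int_D: "integrable lborel (\<lambda>z. k z *\<^sub>R D (y - z) e)" for y e
    using cont_D suppD \<open>0 < R\<close> by (intro integrable_convolution[where R = R]) auto
  have cont_\<Psi>: "continuous_on UNIV \<Psi>"
    using deriv by (intro continuous_at_imp_continuous_on ballI has_derivative_continuous)
  have int_\<Psi>: "integrable lborel (\<lambda>z. k z *\<^sub>R \<Psi> (y - z))" for y
    using cont_\<Psi> supp \<open>0 < R\<close> by (rule integrable_convolution)
  define L where "L e = (\<integral>z. k z *\<^sub>R D (x - z) e \<partial>lborel)" for e
  have "linear L"
  proof (rule linearI)
    fix a b
    show "L (a + b) = L a + L b"
      unfolding L_def blinfun.add_right scaleR_add_right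
      by (rule Bochner_Integration.integral_add[OF int_D int_D])
  next
    fix c a
    have "L (c *\<^sub>R a) = (\<integral>z. c *\<^sub>R (k z *\<^sub>R D (x - z) a) \<partial>lborel)"
      by (simp add: L_def blinfun.scaleR_right mult.commute)
    also have "\<dots> = c *\<^sub>R L a"
      unfolding L_def by (simp del: scaleR_scaleR)
    finally show "L (c *\<^sub>R a) = c *\<^sub>R L a" .
  qed
  then have bl: "bounded_linear L" by (simp add: linear_conv_bounded_linear)
  \<comment> \<open>With \<open>norm (y - x) < 1\<close>, both translates of the field vanish at
    \<open>z\<close> once \<open>norm z\<close> exceeds this radius.\<close>
  define R' where "R' = norm x + R + 1"
  have R': "0 < R'" using \<open>0 < R\<close> by (simp add: R'_def add_nonneg_pos)
  define I where "I = (\<integral>z\<in>cball 0 R'. k z \<partial>lborel)"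
  have I: "0 \<le> I" unfolding I_def set_lebesgue_integral_def
    by (intro Bochner_Integration.integral_nonneg) (auto simp: k_nonneg indicator_def)
  \<comment> \<open>The ball contains every point within distance 1 of some \<open>x - z\<close>
    with \<open>z\<close> in \<open>cball 0 R'\<close>, hence also the segments from
    \<open>x - z\<close> to \<open>y - z\<close>.\<close>
  have uc: "uniformly_continuous_on (cball 0 (norm x + R' + 1)) D"
    by (intro compact_uniformly_continuous continuous_on_subset[OF cont]) auto
  show ?thesis unfolding L_def[symmetric] has_derivative_at_alt
  proof (intro conjI bl allI impI)
    fix e :: real assume e: "0 < e"
    define e' where "e' = e / (I + 1)"
    have e': "0 < e'" using e I by (simp add: e'_def)
    have e'I: "e' * I \<le> e" using e I by (simp add: e'_def field_simps)
    from uc e' obtain d where d: "0 < d"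
      "\<And>y y'. y \<in> cball 0 (norm x + R' + 1) \<Longrightarrow> y' \<in> cball 0 (norm x + R' + 1) \<Longrightarrow> dist y' y < d \<Longrightarrow> dist (D y') (D y) < e'"
      unfolding uniformly_continuous_on_def by blast
    show "\<exists>d>0. \<forall>y. norm (y - x) < d \<longrightarrow>
        norm ((\<integral>z. k z *\<^sub>R \<Psi> (y - z) \<partial>lborel) - (\<integral>z. k z *\<^sub>R \<Psi> (x - z) \<partial>lborel) - L (y - x)) \<le> e * norm (y - x)"
    proof (intro exI[of _ "min d 1"] conjI allI impI)
      fix y assume y: "norm (y - x) < min d 1"
      have ny: "norm y \<le> norm x + 1" using norm_triangle_sub[of y x] y by simp
      define h where "h z = \<Psi> (y - z) - \<Psi> (x - z) - D (x - z) (y - x)" for z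
      have int_h: "integrable lborel (\<lambda>z. k z *\<^sub>R h z)"
        unfolding h_def scaleR_diff_right by (intro Bochner_Integration.integrable_diff int_D int_\<Psi>)
      have "(\<integral>z. k z *\<^sub>R \<Psi> (y - z) \<partial>lborel) - (\<integral>z. k z *\<^sub>R \<Psi> (x - z) \<partial>lborel) - L (y - x)
          = (\<integral>z. k z *\<^sub>R h z \<partial>lborel)"
        unfolding h_def L_def scaleR_diff_right
        by (simp add: Bochner_Integration.integral_diff Bochner_Integration.integrable_diff int_D int_\<Psi>)
      also have "norm \<dots> \<le> (e' * norm (y - x)) * I" unfolding I_def
      proof (rule norm_convolution_le[OF int_h _ _ R'])
        fix z
        have *: "h z = 0" if "R' < norm z" for z
        proof -
          have "R < norm (y - z)" "R < norm (x - z)"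
            using that ny norm_triangle_sub[of z y] norm_triangle_sub[of z x]
            by (auto simp: R'_def norm_minus_commute)
          then show ?thesis by (simp add: h_def supp suppD)
        qed
        show "R' < norm z \<Longrightarrow> h z = 0" by (rule *)
        show "norm (h z) \<le> e' * norm (y - x)"
        proof (cases "R' < norm z")
          case True then show ?thesis using * e' by simp
        next
          case False
          have "norm (\<Psi> (y - z) - \<Psi> (x - z) - D (x - z) ((y - z) - (x - z))) \<le> norm ((y - z) - (x - z)) * e'"
          proof (rule differentiable_bound_linearization[where S = "ball (x - z) (min d 1)" and f' = "\<lambda>s. blinfun_apply (D s)"])
            fix t :: real assume t: "t \<in> {0..1}"
            have "norm (t *\<^sub>R (y - x)) \<le> norm (y - x)" using t by (simp add: mult_left_le_one_le)
            then show "x - z + t *\<^sub>R (y - z - (x - z)) \<in> ball (x - z) (min d 1)"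
              using y by (simp add: dist_norm)
          next
            fix s assume s: "s \<in> ball (x - z) (min d 1)"
            show "(\<Psi> has_derivative blinfun_apply (D s)) (at s within ball (x - z) (min d 1))"
              using deriv by (rule has_derivative_at_withinI)
            have nz: "norm (x - z) \<le> norm x + R'" using norm_triangle_ineq4[of x z] False by simp
            moreover have "norm (s - (x - z)) < min d 1" using s by (simp add: dist_norm norm_minus_commute)
            ultimately have "norm s \<le> norm x + R' + 1" using norm_triangle_sub[of s "x - z"] by simp
            then have "dist (D s) (D (x - z)) < e'"
              using nz s R' by (intro d(2)) (auto simp: dist_commute)
            moreover have "blinfun_apply (D s) - blinfun_apply (D (x - z)) = blinfun_apply (D s - D (x - z))"
              by (simp add: fun_eq_iff blinfun.diff_left)
            ultimately show "onorm (blinfun_apply (D s) - blinfun_apply (D (x - z))) \<le> e'"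
              by (simp add: dist_norm norm_blinfun.rep_eq)
          qed (use d in simp)
          then show ?thesis by (simp add: h_def mult.commute)
        qed
      qed
      also have "\<dots> = (e' * I) * norm (y - x)" by simp
      also have "\<dots> \<le> e * norm (y - x)" using e'I by (rule mult_right_mono) simp
      finally show "norm ((\<integral>z. k z *\<^sub>R \<Psi> (y - z) \<partial>lborel) - (\<integral>z. k z *\<^sub>R \<Psi> (x - z) \<partial>lborel) - L (y - x)) \<le> e * norm (y - x)" .
    qed (use d in simp)
  qed
qed

end

text \<open>Outside the ball the field is locally constant 0, so its derivative vanishes there too;
  one radius therefore serves for \<open>\<Psi>\<close> and \<open>D\<close>.\<close>

lemma C1cE:
  fixes \<Psi> :: "'a::euclidean_space \<Rightarrow> 'b::euclidean_space"
  assumes "C1c \<Psi>"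
  obtains D R where "\<And>x. (\<Psi> has_derivative blinfun_apply (D x)) (at x)" "continuous_on UNIV D"
    "\<And>y. R < norm y \<Longrightarrow> \<Psi> y = 0" "\<And>y. R < norm y \<Longrightarrow> D y = 0" "0 < R"
proof -
  from assms obtain D where D: "\<And>x. (\<Psi> has_derivative blinfun_apply (D x)) (at x)" "continuous_on UNIV D"
    and "compact (closure {x. \<Psi> x \<noteq> 0})"
    unfolding C1c_def by blast
  then have "bounded {x. \<Psi> x \<noteq> 0}"
    using compact_imp_bounded bounded_closure closure_subset bounded_subset by metis
  then obtain R where R: "0 < R" "\<And>y. \<Psi> y \<noteq> 0 \<Longrightarrow> norm y \<le> R"
    unfolding bounded_pos by auto
  then have supp: "\<Psi> y = 0" if "R < norm y" for y using that by fastforce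
  have "D y = 0" if y: "R < norm y" for y
  proof -
    have "open {y::'a. R < norm y}"
      by (intro open_Collect_less continuous_intros)
    have "((\<lambda>_. 0::'b) has_derivative blinfun_apply 0) (at y)"
      by (simp add: zero_blinfun.rep_eq)
    then have "(\<Psi> has_derivative blinfun_apply 0) (at y)"
      using \<open>open {y. R < norm y}\<close>
      by (rule has_derivative_transform_within_open) (use y supp in auto)
    then show ?thesis using has_derivative_unique[OF D(1)] by (metis blinfun_apply_inject)
  qed
  then show ?thesis using that D supp R(1) by blast
qed

text \<open>After the substitution the Riesz potential is a convolution with a locally integrable
  kernel, so the divergence falls on the field and leaves convolutions with continuous, compactly
  supported functions. The exponent of the kernel is nonnegative because the dimension is at least
  1, and below the dimension because \<open>\<alpha> < 1\<close>.\<close>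

lemma isCont_frac_div:
  fixes \<Psi> :: "'a::euclidean_space \<Rightarrow> 'a"
  assumes "C1c \<Psi>" "0 < \<alpha>" "\<alpha> < 1"
  shows "isCont (frac_div \<alpha> \<Psi>) x"
proof -
  define p where "p = real DIM('a) - (1 - \<alpha>)"
  define k :: "'a \<Rightarrow> real" where "k z = 1 / norm z powr p" for z
  define C where "C = riesz_const DIM('a) (1 - \<alpha>)"
  have "1 \<le> real DIM('a)" using DIM_positive[where 'a='a] by linarith
  then have p: "0 \<le> p" "p < real DIM('a)" using assms unfolding p_def by linarith+
  interpret locally_integrable_kernel k
  proof
    show "k \<in> borel_measurable borel" unfolding k_def
      by (intro borel_measurable_divide borel_measurable_const powr_real_measurable borel_measurable_norm measurable_ident_sets refl)
    show "0 \<le> k z" for z by (simp add: k_def)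
    show "set_integrable lborel (cball 0 R) k" if "0 < R" for R
      unfolding k_def by (rule norm_powr_set_integrable_cball[OF p that])
  qed
  obtain D R where D: "\<And>x. (\<Psi> has_derivative blinfun_apply (D x)) (at x)" "continuous_on UNIV D"
    and supp: "\<And>y. R < norm y \<Longrightarrow> \<Psi> y = 0" "\<And>y. R < norm y \<Longrightarrow> D y = 0" "0 < R"
    using C1cE[OF assms(1)] by metis
  have cont_\<Psi>: "continuous_on UNIV \<Psi>"
    using D(1) by (intro continuous_at_imp_continuous_on ballI has_derivative_continuous)
  have "riesz_pot (1 - \<alpha>) \<Psi> = (\<lambda>x. C *\<^sub>R (\<integral>z. k z *\<^sub>R \<Psi> (x - z) \<partial>lborel))"
  proof
    fix x
    have "(\<lambda>y. k (x - y) *\<^sub>R \<Psi> y) \<in> borel_measurable borel"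
      using borel_measurable_continuous_onI[OF cont_\<Psi>] by measurable
    from integral_reflect_lborel[OF this, of x]
    show "riesz_pot (1 - \<alpha>) \<Psi> x = C *\<^sub>R (\<integral>z. k z *\<^sub>R \<Psi> (x - z) \<partial>lborel)"
      by (simp add: riesz_pot_def C_def k_def p_def)
  qed
  then have "(riesz_pot (1 - \<alpha>) \<Psi> has_derivative (\<lambda>e. C *\<^sub>R (\<integral>z. k z *\<^sub>R D (x - z) e \<partial>lborel))) (at x)" for x
    by (simp only:) (intro has_derivative_scaleR_right has_derivative_convolution[OF D supp])
  then have "frechet_derivative (riesz_pot (1 - \<alpha>) \<Psi>) (at x) = (\<lambda>e. C *\<^sub>R (\<integral>z. k z *\<^sub>R D (x - z) e \<partial>lborel))" for x
    by (rule frechet_derivative_at[symmetric])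
  then have eq: "frac_div \<alpha> \<Psi> = (\<lambda>x. \<Sum>i\<in>Basis. (C *\<^sub>R (\<integral>z. k z *\<^sub>R D (x - z) i \<partial>lborel)) \<bullet> i)"
    by (simp add: frac_div_def divergence_def fun_eq_iff)
  show ?thesis unfolding eq
  proof (intro continuous_intros)
    fix i
    show "isCont (\<lambda>x. \<integral>z. k z *\<^sub>R D (x - z) i \<partial>lborel) x"
    proof (rule isCont_convolution[where R = R])
      show "continuous_on UNIV (\<lambda>y. D y i)" using D(2) by (intro continuous_intros)
    qed (auto simp: supp)
  qed
qed

lemma frac_div_measurable [measurable]:
  assumes "C1c \<Psi>" "0 < \<alpha>" "\<alpha> < 1"
  shows "frac_div \<alpha> \<Psi> \<in> borel_measurable borel"
  using isCont_frac_div[OF assms] by (intro borel_measurable_continuous_onI continuous_at_imp_continuous_on) auto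

lemma frac_div_bounded:
  fixes \<Omega> :: "'a::euclidean_space set"
  assumes "C1c \<Psi>" "0 < \<alpha>" "\<alpha> < 1" "bounded \<Omega>"
  obtains C where "\<And>x. x \<in> \<Omega> \<Longrightarrow> \<bar>frac_div \<alpha> \<Psi> x\<bar> \<le> C"
proof -
  have "compact (frac_div \<alpha> \<Psi> ` closure \<Omega>)"
    using isCont_frac_div[OF assms(1-3)] assms(4)
    by (intro compact_continuous_image continuous_at_imp_continuous_on) auto
  then have "bounded (frac_div \<alpha> \<Psi> ` closure \<Omega>)" by (rule compact_imp_bounded)
  then obtain C where "\<And>x. x \<in> closure \<Omega> \<Longrightarrow> norm (frac_div \<alpha> \<Psi> x) \<le> C"
    unfolding bounded_iff by blast
  then show ?thesis using that closure_subset by (metis real_norm_def subsetD)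
qed

section \<open>Curves in L2\<close>

lemma continuous_on_Icc_boundedE:
  fixes b :: "real \<Rightarrow> real"
  assumes "continuous_on {a..c} b"
  obtains B where "\<And>t. t \<in> {a..c} \<Longrightarrow> b t \<le> B"
proof -
  have "bounded (b ` {a..c})"
    by (intro compact_imp_bounded compact_continuous_image assms) auto
  then obtain B where B: "\<forall>y\<in>b ` {a..c}. norm y \<le> B" unfolding bounded_iff by blast
  have "b t \<le> B" if "t \<in> {a..c}" for t
    using B[rule_format, OF imageI[OF that]] by simp
  then show ?thesis using that by blast
qed

definition contL2 :: "'b measure \<Rightarrow> real \<Rightarrow> (real \<Rightarrow> 'b \<Rightarrow> real) \<Rightarrow> bool" where
  "contL2 M T g \<longleftrightarrow> (\<forall>t\<in>{0..T}. L2lim M (at t within {0..T}) g (g t))"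

lemma contL2_sqint: "contL2 M T g \<Longrightarrow> t \<in> {0..T} \<Longrightarrow> sqint M (g t)"
  by (auto simp: contL2_def L2lim_def)

lemma contL2_inner:
  assumes "contL2 M T g" "contL2 M T h"
  shows "continuous_on {0..T} (\<lambda>t. \<integral>x. g t x * h t x \<partial>M)"
  using assms unfolding continuous_on_def contL2_def by (auto intro: L2lim_inner)

lemma contL2_sqn:
  assumes "contL2 M T g"
  shows "continuous_on {0..T} (\<lambda>t. sqn M (g t))"
  using contL2_inner[OF assms assms] by (simp add: sqn_def power2_eq_square)

lemma contL2_const: "sqint M f \<Longrightarrow> contL2 M T (\<lambda>_. f)"
  by (simp add: contL2_def L2lim_const)

lemma contL2_diff: "contL2 M T g \<Longrightarrow> contL2 M T h \<Longrightarrow> contL2 M T (\<lambda>t x. g t x - h t x)"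
  by (auto simp: contL2_def intro: L2lim_diff)

lemma contL2_scale:
  assumes "continuous_on {0..T} c" "contL2 M T g"
  shows "contL2 M T (\<lambda>t x. c t * g t x)"
  using assms by (auto simp: contL2_def continuous_on_def intro: L2lim_scale)

lemma contL2_subset:
  assumes "contL2 M T g" "T' \<le> T"
  shows "contL2 M T' g"
  unfolding contL2_def
proof
  fix t assume "t \<in> {0..T'}"
  then have "L2lim M (at t within {0..T}) g (g t)" using assms by (auto simp: contL2_def)
  moreover have "at t within {0..T'} \<le> at t within {0..T}" using assms(2) by (intro at_le) auto
  ultimately show "L2lim M (at t within {0..T'}) g (g t)"
    unfolding L2lim_def by (blast intro: filter_leD tendsto_mono)
qed

lemma has_L2_derivative_contL2:
  assumes "\<And>t. t \<in> {0..T} \<Longrightarrow> has_L2_derivative M v (w t) t {0..T}"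
  shows "contL2 M T v"
  unfolding contL2_def using has_L2_derivative_continuous[OF assms] by blast

lemma tendsto_zero_nonnegI:
  fixes f :: "'c \<Rightarrow> real"
  assumes "\<And>s. 0 \<le> f s" "\<And>e. 0 < e \<Longrightarrow> \<forall>\<^sub>F s in F. f s < e"
  shows "(f \<longlongrightarrow> 0) F"
  using assms by (intro tendstoI) (simp add: dist_real_def)

lemma integrable_indicator_Ioc: "integrable lborel (indicator {a<..b::real} :: real \<Rightarrow> real)"
  by (cases "a \<le> b") (auto simp: integrable_indicator_iff)

lemma L2lim_uniform:
  assumes "finite_measure M" "sqint M l" and f: "\<forall>\<^sub>F s in F. f s \<in> borel_measurable M"
    and unif: "\<And>e. 0 < e \<Longrightarrow> \<forall>\<^sub>F s in F. \<forall>x\<in>space M. \<bar>f s x - l x\<bar> \<le> e"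
  shows "L2lim M F f l"
proof -
  interpret finite_measure M by fact
  have [measurable]: "l \<in> borel_measurable M" using assms(2) by (rule sqint_measurable)
  have *: "sqint M (\<lambda>x. f s x - l x)" "sqn M (\<lambda>x. f s x - l x) \<le> e\<^sup>2 * measure M (space M)"
    if e: "\<forall>x\<in>space M. \<bar>f s x - l x\<bar> \<le> e" and [measurable]: "f s \<in> borel_measurable M" for s e
  proof -
    have le: "(f s x - l x)\<^sup>2 \<le> e\<^sup>2" if "x \<in> space M" for x
      using e that abs_le_square_iff[of "f s x - l x" e] by (smt (verit))
    have sq: "integrable M (\<lambda>x. (f s x - l x)\<^sup>2)"
      by (rule Bochner_Integration.integrable_bound[of _ "\<lambda>_. e\<^sup>2"]) (use le in auto)
    then show "sqint M (\<lambda>x. f s x - l x)" by (simp add: sqint_def)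
    have "sqn M (\<lambda>x. f s x - l x) \<le> (\<integral>x. e\<^sup>2 \<partial>M)"
      unfolding sqn_def using sq le by (intro integral_mono) auto
    then show "sqn M (\<lambda>x. f s x - l x) \<le> e\<^sup>2 * measure M (space M)" by (simp add: mult.commute)
  qed
  show ?thesis unfolding L2lim_def
  proof (intro conjI assms(2))
    show "\<forall>\<^sub>F s in F. sqint M (f s)"
      using unif[of 1, simplified] f
    proof eventually_elim
      case (elim s)
      from sqint_add[OF *(1)[OF elim] assms(2)] show ?case by simp
    qed
    show "((\<lambda>s. sqn M (\<lambda>x. f s x - l x)) \<longlongrightarrow> 0) F"
    proof (rule tendsto_zero_nonnegI[OF sqn_nonneg])
      fix a :: real assume "0 < a"
      \<comment> \<open>Chosen so that \<open>e\<^sup>2 * (measure M (space M) + 1) = a\<close>; the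
        summand 1 makes the resulting bound strict, even for a space of measure 0.\<close>
      define e where "e = sqrt (a / (measure M (space M) + 1))"
      have pos: "0 < measure M (space M) + 1" by (simp add: add_nonneg_pos)
      have "0 < e" using \<open>0 < a\<close> pos by (simp add: e_def)
      have "e\<^sup>2 = a / (measure M (space M) + 1)" using \<open>0 < a\<close> pos by (simp add: e_def)
      then have "e\<^sup>2 * measure M (space M) + e\<^sup>2 = a" using pos by (simp add: field_simps)
      then have lt: "e\<^sup>2 * measure M (space M) < a"
        using zero_less_power[OF \<open>0 < e\<close>, of 2] by linarith
      show "\<forall>\<^sub>F s in F. sqn M (\<lambda>x. f s x - l x) < a"
        using unif[OF \<open>0 < e\<close>] f
        by eventually_elim (use *(2) lt in fastforce)
    qed
  qed
qed

text \<open>Cauchy-Schwarz against the indicator of the interval, which also yields integrability of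
  \<open>g\<close> from that of its square.\<close>

lemma set_integral_square_le:
  fixes g :: "real \<Rightarrow> real"
  assumes "a < b" and [measurable]: "g \<in> borel_measurable borel"
    and sq: "set_integrable lborel {a<..b} (\<lambda>r. (g r)\<^sup>2)"
  shows "set_integrable lborel {a<..b} g"
    and "(LINT r:{a<..b}|lborel. g r)\<^sup>2 \<le> (b - a) * (LINT r:{a<..b}|lborel. (g r)\<^sup>2)"
proof -
  have sq1: "(\<lambda>r. (indicator {a<..b} r * g r)\<^sup>2) = (\<lambda>r. indicator {a<..b} r *\<^sub>R (g r)\<^sup>2)"
    by (auto simp: indicator_def fun_eq_iff)
  have 1: "sqint lborel (\<lambda>r. indicator {a<..b} r * g r)"
    unfolding sqint_def sq1 using sq by (simp add: set_integrable_def)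
  have sq2: "(\<lambda>r. (indicator {a<..b} r :: real)\<^sup>2) = indicator {a<..b}"
    by (auto simp: indicator_def fun_eq_iff)
  have 2: "sqint lborel (indicator {a<..b})"
    unfolding sqint_def sq2 by (simp add: integrable_indicator_Ioc)
  have eq: "(\<lambda>r. indicator {a<..b} r * g r * indicator {a<..b} r) = (\<lambda>r. indicator {a<..b} r *\<^sub>R g r)"
    by (auto simp: indicator_def fun_eq_iff)
  show "set_integrable lborel {a<..b} g"
    using sqint_integrable_mult[OF 1 2] unfolding set_integrable_def eq .
  have "sqn lborel (indicator {a<..b}) = b - a"
    unfolding sqn_def sq2 using \<open>a < b\<close> by simp
  then show "(LINT r:{a<..b}|lborel. g r)\<^sup>2 \<le> (b - a) * (LINT r:{a<..b}|lborel. (g r)\<^sup>2)"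
    using Cauchy_Schwarz_sqn[OF 1 2] unfolding eq sqn_def sq1 set_lebesgue_integral_def
    by (simp add: mult.commute)
qed

text \<open>A curve of Lebesgue measurable functions need not be jointly measurable; Fubini is applied to
  a Borel function \<open>G\<close> whose slices agree with the curve.\<close>

definition represents :: "'b measure \<Rightarrow> real \<Rightarrow> ('b \<times> real \<Rightarrow> real) \<Rightarrow> (real \<Rightarrow> 'b \<Rightarrow> real) \<Rightarrow> bool" where
  "represents M T G g \<longleftrightarrow> (AE t in lborel. t \<in> {0<..<T} \<longrightarrow> (AE x in M. G (x, t) = g t x))"

section \<open>Time averages and primitives of curves in L2\<close>

lemma AE_lborel_not_endpoint: "AE t::real in lborel. t \<noteq> c"
  by (rule AE_lborel_singleton)

text \<open>Cauchy-Schwarz in time bounds the squared error of the average at \<open>x\<close> by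
  the average of the squared errors, and Tonelli exchanges this average with the integral over
  \<open>x\<close>. The choice \<open>l = f t\<close> makes difference quotients of a primitive
  converge; \<open>l = 0\<close> shows that the primitive is in L2.\<close>

lemma time_average_L2:
  fixes F :: "'b \<times> real \<Rightarrow> real"
  assumes "finite_measure M" and F [measurable]: "F \<in> borel_measurable (M \<Otimes>\<^sub>M lborel)"
    and rep: "represents M T F f" and f: "contL2 M T f"
    and ab: "0 \<le> a" "a < b" "b \<le> T"
    and l: "sqint M l" and le: "\<And>r. r \<in> {a..b} \<Longrightarrow> sqn M (\<lambda>x. f r x - l x) \<le> e"
  shows "AE x in M. set_integrable lborel {a<..b} (\<lambda>r. F (x, r))"
    and "sqint M (\<lambda>x. (LINT r:{a<..b}|lborel. F (x, r)) / (b - a) - l x)"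
    and "sqn M (\<lambda>x. (LINT r:{a<..b}|lborel. F (x, r)) / (b - a) - l x) \<le> e"
proof -
  let ?A = "\<lambda>x. LINT r:{a<..b}|lborel. F (x, r)" and ?I = "\<lambda>x. LINT r:{a<..b}|lborel. (F (x, r) - l x)\<^sup>2"
  interpret M: finite_measure M by fact
  interpret pair_sigma_finite M lborel ..
  have [measurable]: "l \<in> borel_measurable M" using l by (rule sqint_measurable)
  have "0 \<le> e" using order_trans[OF sqn_nonneg le[of a]] ab by simp
  \<comment> \<open>An extended nonnegative integral, so Tonelli applies before any integrability is
    known; integrability for almost every \<open>x\<close> is then read off from its
    finiteness.\<close>
  define J where "J x = (\<integral>\<^sup>+r. indicator {a<..b} r * ennreal ((F (x, r) - l x)\<^sup>2) \<partial>lborel)" for x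
  have [measurable]: "J \<in> borel_measurable M" unfolding J_def by measurable
  have "(\<integral>\<^sup>+x. J x \<partial>M) = (\<integral>\<^sup>+r. \<integral>\<^sup>+x. indicator {a<..b} r * ennreal ((F (x, r) - l x)\<^sup>2) \<partial>M \<partial>lborel)"
    unfolding J_def by (rule Fubini'[symmetric]) measurable
  also have "\<dots> \<le> (\<integral>\<^sup>+r. ennreal e * indicator {a<..b} r \<partial>lborel)"
  proof (rule nn_integral_mono_AE)
    show "AE r in lborel. (\<integral>\<^sup>+x. indicator {a<..b} r * ennreal ((F (x, r) - l x)\<^sup>2) \<partial>M) \<le> ennreal e * indicator {a<..b} r"
      \<comment> \<open>The endpoint \<open>T\<close> may belong to \<open>{a<..b}\<close>, but
        \<open>represents\<close> is silent about it; it is discarded as a null set.\<close>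
      using rep[unfolded represents_def] AE_lborel_not_endpoint[of T]
    proof eventually_elim
      case (elim r)
      show ?case
      proof (cases "r \<in> {a<..b}")
        case True
        then have r: "r \<in> {0<..<T}" "r \<in> {0..T}" "r \<in> {a..b}" using ab elim by auto
        have fr: "sqint M (f r)" using contL2_sqint[OF f r(2)] .
        have "(\<integral>\<^sup>+x. ennreal ((F (x, r) - l x)\<^sup>2) \<partial>M) = (\<integral>\<^sup>+x. ennreal ((f r x - l x)\<^sup>2) \<partial>M)"
          using elim(1) r(1) by (intro nn_integral_cong_AE) auto
        also have "\<dots> = ennreal (sqn M (\<lambda>x. f r x - l x))"
          by (intro nn_integral_sq_eq_sqn sqint_diff fr l)
        also have "\<dots> \<le> ennreal e" using le[OF r(3)] by (rule ennreal_leI)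
        finally show ?thesis using True by simp
      qed simp
    qed
  qed
  also have "\<dots> = ennreal (e * (b - a))"
    using ab \<open>0 \<le> e\<close> by (simp add: nn_integral_cmult_indicator ennreal_mult)
  finally have J_le: "(\<integral>\<^sup>+x. J x \<partial>M) \<le> ennreal (e * (b - a))" .
  then have "AE x in M. J x \<noteq> \<infinity>"
    by (intro nn_integral_PInf_AE) (auto simp: top_unique)
  then have *: "AE x in M. set_integrable lborel {a<..b} (\<lambda>r. F (x, r)) \<and>
      ennreal ((?A x / (b - a) - l x)\<^sup>2) \<le> J x * ennreal (1 / (b - a))"
    using AE_space
  proof eventually_elim
    case (elim x)
    then have [measurable]: "(\<lambda>r. F (x, r)) \<in> borel_measurable borel"
      using measurable_Pair2[OF F, of x] by simp
    have J_eq: "J x = (\<integral>\<^sup>+r. ennreal (indicator {a<..b} r *\<^sub>R (F (x, r) - l x)\<^sup>2) \<partial>lborel)"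
      unfolding J_def by (intro nn_integral_cong) (auto simp: indicator_def)
    have sq: "set_integrable lborel {a<..b} (\<lambda>r. (F (x, r) - l x)\<^sup>2)"
      unfolding set_integrable_def
      using elim(1) by (intro integrableI_bounded) (auto simp: J_eq less_top)
    have J_int: "J x = ennreal (?I x)"
      unfolding J_eq set_lebesgue_integral_def
      using sq by (intro nn_integral_eq_integral) (auto simp: set_integrable_def)
    have const: "set_integrable lborel {a<..b} (\<lambda>r. l x)"
      using integrable_indicator_Ioc[of a b] by (simp add: set_integrable_def)
    have "(\<lambda>r. F (x, r) - l x) \<in> borel_measurable borel" by measurable
    note sqi = set_integral_square_le[OF ab(2) this sq]
    have int: "set_integrable lborel {a<..b} (\<lambda>r. F (x, r))"
      using set_integral_add(1)[OF sqi(1) const] by simp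
    have "?A x / (b - a) - l x = (LINT r:{a<..b}|lborel. F (x, r) - l x) / (b - a)"
      using ab set_integral_diff(2)[OF int const]
      by (simp add: field_simps set_lebesgue_integral_def)
    also have "\<dots>\<^sup>2 \<le> (b - a) * ?I x / (b - a)\<^sup>2"
      unfolding power_divide by (intro divide_right_mono sqi(2)) simp
    also have "\<dots> = ?I x * (1 / (b - a))"
      using ab by (simp add: power2_eq_square)
    finally have "ennreal ((?A x / (b - a) - l x)\<^sup>2)
        \<le> ennreal (?I x * (1 / (b - a)))"
      by (rule ennreal_leI)
    also have "\<dots> = J x * ennreal (1 / (b - a))"
      unfolding J_int using ab by (intro ennreal_mult'') simp
    finally show ?case using int by simp
  qed
  then show "AE x in M. set_integrable lborel {a<..b} (\<lambda>r. F (x, r))" by auto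
  have meas: "(\<lambda>x. ?A x / (b - a) - l x) \<in> borel_measurable M"
    unfolding set_lebesgue_integral_def by measurable
  have "(\<integral>\<^sup>+x. ennreal ((?A x / (b - a) - l x)\<^sup>2) \<partial>M)
      \<le> (\<integral>\<^sup>+x. J x * ennreal (1 / (b - a)) \<partial>M)"
    using * by (intro nn_integral_mono_AE) auto
  also have "\<dots> = (\<integral>\<^sup>+x. J x \<partial>M) * ennreal (1 / (b - a))"
    by (rule nn_integral_multc) measurable
  also have "\<dots> \<le> ennreal (e * (b - a)) * ennreal (1 / (b - a))"
    by (intro mult_right_mono J_le) simp
  also have "\<dots> = ennreal (e * (b - a) * (1 / (b - a)))"
    using ab by (intro ennreal_mult''[symmetric]) simp
  also have "e * (b - a) * (1 / (b - a)) = e" using ab by simp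
  finally have le': "(\<integral>\<^sup>+x. ennreal ((?A x / (b - a) - l x)\<^sup>2) \<partial>M) \<le> ennreal e" .
  show "sqint M (\<lambda>x. ?A x / (b - a) - l x)"
    "sqn M (\<lambda>x. ?A x / (b - a) - l x) \<le> e"
    using sqn_le_of_nn_integral_le[OF meas le' \<open>0 \<le> e\<close>] .
qed

text \<open>A difference quotient of the primitive is a time average of \<open>f\<close> over the
  interval between \<open>s\<close> and \<open>t\<close>, so its distance from \<open>f t\<close> is
  controlled by the oscillation of \<open>f\<close> near \<open>t\<close>.\<close>

lemma has_L2_derivative_primitive:
  fixes F :: "'b \<times> real \<Rightarrow> real"
  assumes M: "finite_measure M" and F [measurable]: "F \<in> borel_measurable (M \<Otimes>\<^sub>M lborel)"
    and rep: "represents M T F f" and f: "contL2 M T f" and "0 < T" and t: "t \<in> {0..T}"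
  shows "has_L2_derivative M (\<lambda>t x. LINT r:{0<..t}|lborel. F (x, r)) (f t) t {0..T}"
proof -
  define P where "P t x = (LINT r:{0<..t}|lborel. F (x, r))" for t x
  have [measurable]: "P t \<in> borel_measurable M" for t
    unfolding P_def set_lebesgue_integral_def by measurable
  obtain B where "\<And>r. r \<in> {0..T} \<Longrightarrow> sqn M (f r) \<le> B"
    using continuous_on_Icc_boundedE[OF contL2_sqn[OF f]] by blast
  then have B: "sqn M (\<lambda>x. f r x - 0) \<le> B" if "r \<in> {0..T}" for r
    using that by simp
  have int: "AE x in M. set_integrable lborel {0<..T} (\<lambda>r. F (x, r))"
    by (rule time_average_L2(1)[OF M F rep f _ _ _ sqint_zero B]) (use \<open>0 < T\<close> in auto)
  have incr: "AE x in M. P b x - P a x = (LINT r:{a<..b}|lborel. F (x, r))"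
    if "0 \<le> a" "a < b" "b \<le> T" for a b
    using int
  proof eventually_elim
    case (elim x)
    have "{0<..b} = {0<..a} \<union> {a<..b}" using that by auto
    moreover have "set_integrable lborel {0<..a} (\<lambda>r. F (x, r))" "set_integrable lborel {a<..b} (\<lambda>r. F (x, r))"
      by (rule set_integrable_subset[OF elim]; use that in auto)+
    ultimately show ?case unfolding P_def by (simp add: set_integral_Un)
  qed
  have sqint_P: "sqint M (P s)" if s: "s \<in> {0..T}" for s
  proof (cases "s = 0")
    case True
    then show ?thesis by (simp add: P_def[abs_def] set_lebesgue_integral_def sqint_zero)
  next
    case False
    have "sqint M (\<lambda>x. (LINT r:{0<..s}|lborel. F (x, r)) / (s - 0) - 0)"
      by (rule time_average_L2(2)[OF M F rep f _ _ _ sqint_zero B]) (use s False in auto)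
    from sqint_cmult[OF this, of s] show ?thesis using False by (simp add: P_def[abs_def])
  qed
  have quot: "sqn M (\<lambda>x. (P s x - P t x) / (s - t) - f t x) \<le> e"
    if s: "s \<in> {0..T}" "s \<noteq> t" and le: "\<And>r. r \<in> {0..T} \<Longrightarrow> \<bar>r - t\<bar> \<le> \<bar>s - t\<bar> \<Longrightarrow> sqn M (\<lambda>x. f r x - f t x) \<le> e" for s e
  proof -
    define a b where "a = min s t" and "b = max s t"
    have ab: "0 \<le> a" "a < b" "b \<le> T" using s t by (auto simp: a_def b_def)
    have le': "sqn M (\<lambda>x. f r x - f t x) \<le> e" if "r \<in> {a..b}" for r
      using that ab by (intro le) (auto simp: a_def b_def)
    note ta = time_average_L2[OF M F rep f ab contL2_sqint[OF f t] le']
    have "sqn M (\<lambda>x. (P s x - P t x) / (s - t) - f t x)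
        = sqn M (\<lambda>x. (LINT r:{a<..b}|lborel. F (x, r)) / (b - a) - f t x)"
    proof (rule sqn_cong_AE)
      show "(\<lambda>x. (P s x - P t x) / (s - t) - f t x) \<in> borel_measurable M"
        using sqint_measurable[OF contL2_sqint[OF f t]] by measurable
      show "AE x in M. (P s x - P t x) / (s - t) - f t x = (LINT r:{a<..b}|lborel. F (x, r)) / (b - a) - f t x"
        using incr[OF ab]
      proof eventually_elim
        case (elim x)
        have "(P b x - P a x) / (b - a) = (P s x - P t x) / (s - t)"
          using s(2) minus_divide_divide[of "P s x - P t x" "s - t"]
          by (cases "s < t") (auto simp: a_def b_def)
        then show ?case by (simp add: elim)
      qed
    qed (rule sqint_measurable[OF ta(2)])
    with ta(3) show ?thesis by simp
  qed
  have lim: "((\<lambda>s. sqn M (\<lambda>x. f s x - f t x)) \<longlongrightarrow> 0) (at t within {0..T})"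
    using f t by (simp add: contL2_def L2lim_def)
  have "L2lim M (at t within {0..T}) (\<lambda>s x. (P s x - P t x) / (s - t)) (f t)"
    unfolding L2lim_def
  proof (intro conjI contL2_sqint[OF f t])
    show "\<forall>\<^sub>F s in at t within {0..T}. sqint M (\<lambda>x. (P s x - P t x) / (s - t))"
      unfolding eventually_at_filter
    proof (intro always_eventually allI impI)
      fix s assume "s \<in> {0..T}"
      from sqint_cmult[OF sqint_diff[OF sqint_P[OF this] sqint_P[OF t]], of "1 / (s - t)"]
      show "sqint M (\<lambda>x. (P s x - P t x) / (s - t))" by simp
    qed
    show "((\<lambda>s. sqn M (\<lambda>x. (P s x - P t x) / (s - t) - f t x)) \<longlongrightarrow> 0) (at t within {0..T})"
    proof (rule tendsto_zero_nonnegI[OF sqn_nonneg])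
      fix e :: real assume "0 < e"
      then have "\<forall>\<^sub>F s in at t within {0..T}. sqn M (\<lambda>x. f s x - f t x) < e / 2"
        by (intro order_tendstoD[OF lim]) simp
      then obtain d where d: "0 < d" "\<And>r. r \<in> {0..T} \<Longrightarrow> r \<noteq> t \<Longrightarrow> \<bar>r - t\<bar> < d \<Longrightarrow> sqn M (\<lambda>x. f r x - f t x) < e / 2"
        unfolding eventually_at by (auto simp: dist_real_def)
      have d': "sqn M (\<lambda>x. f r x - f t x) \<le> e / 2" if "r \<in> {0..T}" "\<bar>r - t\<bar> < d" for r
        using d(2)[OF that(1) _ that(2)] \<open>0 < e\<close> by (cases "r = t") (auto simp: sqn_def)
      show "\<forall>\<^sub>F s in at t within {0..T}. sqn M (\<lambda>x. (P s x - P t x) / (s - t) - f t x) < e"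
        unfolding eventually_at dist_real_def
      proof (intro exI[of _ d] conjI ballI impI)
        fix s assume s: "s \<in> {0..T}" "s \<noteq> t \<and> \<bar>s - t\<bar> < d"
        have "sqn M (\<lambda>x. (P s x - P t x) / (s - t) - f t x) \<le> e / 2"
          using s by (intro quot d') auto
        then show "sqn M (\<lambda>x. (P s x - P t x) / (s - t) - f t x) < e" using \<open>0 < e\<close> by simp
      qed fact
    qed
  qed
  then show ?thesis
    unfolding has_L2_derivative_def P_def[symmetric] using sqint_P[OF t] by simp
qed

section \<open>The space-time cylinder\<close>

lemma open_Int_space_lebesgue: "open \<Omega> \<Longrightarrow> \<Omega> \<inter> space lebesgue \<in> sets lebesgue"
  by simp

lemma set_integral_lebesgue_on:
  fixes f :: "'a::euclidean_space \<Rightarrow> real"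
  assumes "open \<Omega>"
  shows "(LINT x:\<Omega>|lebesgue. f x) = (\<integral>x. f x \<partial>lebesgue_on \<Omega>)"
  unfolding set_lebesgue_integral_def
  by (rule integral_restrict_space[symmetric, OF open_Int_space_lebesgue[OF assms]])

lemma set_integrable_lebesgue_on:
  fixes f :: "'a::euclidean_space \<Rightarrow> real"
  assumes "open \<Omega>"
  shows "set_integrable lebesgue \<Omega> f \<longleftrightarrow> integrable (lebesgue_on \<Omega>) f"
  unfolding set_integrable_def
  by (rule integrable_restrict_space[symmetric, OF open_Int_space_lebesgue[OF assms]])

lemma set_borel_measurable_lebesgue_on:
  fixes f :: "'a::euclidean_space \<Rightarrow> real"
  assumes "open \<Omega>"
  shows "set_borel_measurable lebesgue \<Omega> f \<longleftrightarrow> f \<in> borel_measurable (lebesgue_on \<Omega>)"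
  unfolding set_borel_measurable_def
  by (rule borel_measurable_restrict_space_iff[symmetric, OF open_Int_space_lebesgue[OF assms]])

lemma AE_lebesgue_on_iff:
  assumes "open \<Omega>"
  shows "(AE x in lebesgue_on \<Omega>. P x) \<longleftrightarrow> (AE x in lebesgue. x \<in> \<Omega> \<longrightarrow> P x)"
  by (rule AE_restrict_space_iff[OF open_Int_space_lebesgue[OF assms]])

lemma L2_iff_sqint: "open \<Omega> \<Longrightarrow> L2 \<Omega> f \<longleftrightarrow> sqint (lebesgue_on \<Omega>) f"
  by (simp add: L2_def sqint_def set_borel_measurable_lebesgue_on set_integrable_lebesgue_on)

lemma L2sq_eq_sqn: "open \<Omega> \<Longrightarrow> L2sq \<Omega> f = sqn (lebesgue_on \<Omega>) f"
  by (simp add: L2sq_def sqn_def set_integral_lebesgue_on)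

lemma C0L2_iff_contL2:
  assumes "open \<Omega>"
  shows "C0L2 \<Omega> T v \<longleftrightarrow> contL2 (lebesgue_on \<Omega>) T v"
proof
  assume v: "C0L2 \<Omega> T v"
  show "contL2 (lebesgue_on \<Omega>) T v"
    unfolding contL2_def L2lim_def
  proof (intro ballI conjI)
    fix t assume t: "t \<in> {0..T}"
    show "sqint (lebesgue_on \<Omega>) (v t)" using v t assms by (simp add: C0L2_def L2_iff_sqint)
    show "\<forall>\<^sub>F s in at t within {0..T}. sqint (lebesgue_on \<Omega>) (v s)"
      using v assms unfolding eventually_at_filter by (intro always_eventually) (simp add: C0L2_def L2_iff_sqint)
    show "((\<lambda>s. sqn (lebesgue_on \<Omega>) (\<lambda>x. v s x - v t x)) \<longlongrightarrow> 0) (at t within {0..T})"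
      using v t unfolding C0L2_def L2sq_eq_sqn[OF assms] by blast
  qed
next
  assume v: "contL2 (lebesgue_on \<Omega>) T v"
  show "C0L2 \<Omega> T v"
    unfolding C0L2_def L2sq_eq_sqn[OF assms] L2_iff_sqint[OF assms]
    using v contL2_sqint[OF v] by (auto simp only: contL2_def L2lim_def)
qed

lemma finite_measure_lebesgue_on_bounded_open:
  "open \<Omega> \<Longrightarrow> bounded \<Omega> \<Longrightarrow> finite_measure (lebesgue_on \<Omega>)"
  by (intro finite_measure_lebesgue_on lmeasurable_open)

lemma borel_measurable_lebesgue_on_pair:
  fixes G :: "'a::euclidean_space \<times> real \<Rightarrow> real"
  assumes "G \<in> borel_measurable borel"
  shows "G \<in> borel_measurable (lebesgue_on \<Omega> \<Otimes>\<^sub>M lborel)"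
proof -
  have "(\<lambda>x. x) \<in> lebesgue_on \<Omega> \<rightarrow>\<^sub>M (borel :: 'a measure)"
    using id_borel_measurable_lebesgue_on[of \<Omega>] by (simp add: id_def)
  then have [measurable]: "fst \<in> lebesgue_on \<Omega> \<Otimes>\<^sub>M lborel \<rightarrow>\<^sub>M (borel :: 'a measure)"
    using measurable_compose[OF measurable_fst] by fastforce
  have "(\<lambda>z. (fst z, snd z)) \<in> lebesgue_on \<Omega> \<Otimes>\<^sub>M lborel \<rightarrow>\<^sub>M (borel :: ('a \<times> real) measure)"
    unfolding borel_prod[symmetric] by measurable
  from measurable_compose[OF this assms] show ?thesis by simp
qed

lemma borel_measurable_section:
  fixes G :: "'a::euclidean_space \<times> real \<Rightarrow> real"
  assumes "G \<in> borel_measurable borel"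
  shows "(\<lambda>x. G (x, t)) \<in> borel_measurable borel" "(\<lambda>x. G (x, t)) \<in> borel_measurable (lebesgue_on \<Omega>)"
proof -
  show *: "(\<lambda>x. G (x, t)) \<in> borel_measurable borel"
    by (rule measurable_compose[OF _ assms]) (simp add: borel_measurable_continuous_onI continuous_on_Pair)
  show "(\<lambda>x. G (x, t)) \<in> borel_measurable (lebesgue_on \<Omega>)"
    using measurable_compose[OF id_borel_measurable_lebesgue_on[of \<Omega>] *] by (simp add: id_def)
qed

text \<open>Fubini reduces the cylinder to time slices, on almost all of which the Borel functions
  agree with the curves. The result is a Henstock-Kurzweil integral of a continuous function of
  time, the form to which the fundamental theorem of calculus applies.\<close>

lemma slab_integral_mult:
  fixes \<Omega> :: "'a::euclidean_space set" and G H :: "'a \<times> real \<Rightarrow> real"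
  assumes \<Omega>: "open \<Omega>"
    and G [measurable]: "G \<in> borel_measurable borel" and H [measurable]: "H \<in> borel_measurable borel"
    and rep: "represents (lebesgue_on \<Omega>) T G g" "represents (lebesgue_on \<Omega>) T H h"
    and g: "contL2 (lebesgue_on \<Omega>) T g" and h: "contL2 (lebesgue_on \<Omega>) T h"
  shows "set_integrable lebesgue (\<Omega> \<times> {0<..<T}) (\<lambda>z. G z * H z)"
    and "(LINT z:\<Omega> \<times> {0<..<T}|lebesgue. G z * H z)
      = integral {0..T} (\<lambda>t. \<integral>x. g t x * h t x \<partial>lebesgue_on \<Omega>)"
proof -
  let ?M = "lebesgue_on \<Omega>"
  define I where "I t = (\<integral>x. g t x * h t x \<partial>?M)" for t
  define f where "f z = indicator (\<Omega> \<times> {0<..<T}) z *\<^sub>R (G z * H z)" for z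
  have [measurable]: "\<Omega> \<times> {0<..<T} \<in> sets borel" using \<Omega> by (intro borel_open open_Times) auto
  have f_meas: "f \<in> borel_measurable borel" unfolding f_def by measurable
  then have f_pair [measurable]: "f \<in> borel_measurable (lborel \<Otimes>\<^sub>M lborel)"
    unfolding lborel_prod by simp
  have f_eq: "f (x, t) = indicator {0<..<T} t * (indicator \<Omega> x *\<^sub>R (G (x, t) * H (x, t)))" for x t
    by (simp add: f_def indicator_times mult_ac)
  have cont_b: "continuous_on {0..T} (\<lambda>t. sqn ?M (g t) + sqn ?M (h t))"
    by (intro continuous_intros contL2_sqn g h)
  obtain B where B: "\<And>t. t \<in> {0..T} \<Longrightarrow> sqn ?M (g t) + sqn ?M (h t) \<le> B"
    using continuous_on_Icc_boundedE[OF cont_b] by blast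
  \<comment> \<open>The bound on the absolute integral gives integrability on the product by
    Tonelli; the value of the integral is then what Fubini needs.\<close>
  have slice: "AE t in lborel. (\<integral>\<^sup>+x. ennreal (norm (f (x, t))) \<partial>lborel) \<le> ennreal B * indicator {0<..<T} t
      \<and> (\<integral>x. f (x, t) \<partial>lborel) = indicator {0<..<T} t * I t"
    using rep[unfolded represents_def]
  proof eventually_elim
    case (elim t)
    show ?case
    proof (cases "t \<in> {0<..<T}")
      case False
      then show ?thesis by (simp add: f_eq)
    next
      case True
      then have t: "t \<in> {0..T}" by auto
      have gt: "sqint ?M (g t)" and ht: "sqint ?M (h t)" using contL2_sqint g h t by auto
      have ae: "AE x in ?M. G (x, t) * H (x, t) = g t x * h t x"
        using elim True by auto
      have int: "integrable ?M (\<lambda>x. \<bar>g t x * h t x\<bar>)"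
        using sqint_integrable_mult[OF gt ht] by (rule integrable_abs)
      have [measurable]: "(\<lambda>x. G (x, t)) \<in> borel_measurable borel" "(\<lambda>x. H (x, t)) \<in> borel_measurable borel"
        by (rule borel_measurable_section; fact)+
      have [measurable]: "\<Omega> \<in> sets borel" using \<Omega> by simp
      have "(\<integral>\<^sup>+x. ennreal (norm (f (x, t))) \<partial>lborel) = (\<integral>\<^sup>+x. ennreal (norm (f (x, t))) \<partial>lebesgue)"
        by (rule nn_integral_completion[symmetric])
      also have "\<dots> = (\<integral>\<^sup>+x. ennreal \<bar>G (x, t) * H (x, t)\<bar> * indicator \<Omega> x \<partial>lebesgue)"
        using True by (intro nn_integral_cong) (simp add: f_eq indicator_def)
      also have "\<dots> = (\<integral>\<^sup>+x. ennreal \<bar>G (x, t) * H (x, t)\<bar> \<partial>?M)"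
        by (rule nn_integral_restrict_space[symmetric, OF open_Int_space_lebesgue[OF \<Omega>]])
      also have "\<dots> = (\<integral>\<^sup>+x. ennreal \<bar>g t x * h t x\<bar> \<partial>?M)"
        using ae by (intro nn_integral_cong_AE) auto
      also have "\<dots> = ennreal (\<integral>x. \<bar>g t x * h t x\<bar> \<partial>?M)"
        using int by (intro nn_integral_eq_integral) auto
      also have "(\<integral>x. \<bar>g t x * h t x\<bar> \<partial>?M) \<le> (\<integral>x. (g t x)\<^sup>2 + (h t x)\<^sup>2 \<partial>?M)"
      proof (rule integral_mono[OF int])
        show "integrable ?M (\<lambda>x. (g t x)\<^sup>2 + (h t x)\<^sup>2)" using gt ht by (simp add: sqint_def)
      qed (rule abs_mult_le_squares)
      also have "\<dots> = sqn ?M (g t) + sqn ?M (h t)" using gt ht by (simp add: sqint_def sqn_def)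
      also have "\<dots> \<le> B" by (rule B[OF t])
      finally have 1: "(\<integral>\<^sup>+x. ennreal (norm (f (x, t))) \<partial>lborel) \<le> ennreal B"
        by (simp add: ennreal_leI)
      have "(\<integral>x. f (x, t) \<partial>lborel) = (\<integral>x. indicator \<Omega> x *\<^sub>R (G (x, t) * H (x, t)) \<partial>lborel)"
        using True by (simp add: f_eq)
      also have "\<dots> = (\<integral>x. indicator \<Omega> x *\<^sub>R (G (x, t) * H (x, t)) \<partial>lebesgue)"
        by (rule integral_completion[symmetric]) measurable
      also have "\<dots> = (\<integral>x. G (x, t) * H (x, t) \<partial>?M)"
        by (rule integral_restrict_space[symmetric, OF open_Int_space_lebesgue[OF \<Omega>]])
      also have "\<dots> = I t" unfolding I_def
      proof (rule integral_cong_AE[OF _ _ ae])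
        show "(\<lambda>x. G (x, t) * H (x, t)) \<in> borel_measurable ?M"
          by (intro borel_measurable_times borel_measurable_section G H)
        show "(\<lambda>x. g t x * h t x) \<in> borel_measurable ?M"
          by (intro borel_measurable_times sqint_measurable gt ht)
      qed
      finally show ?thesis using 1 True by simp
    qed
  qed
  have "(\<integral>\<^sup>+z. ennreal (norm (f z)) \<partial>(lborel \<Otimes>\<^sub>M lborel)) = (\<integral>\<^sup>+t. \<integral>\<^sup>+x. ennreal (norm (f (x, t))) \<partial>lborel \<partial>lborel)"
    by (rule lborel_pair.nn_integral_snd[symmetric]) measurable
  also have "\<dots> \<le> (\<integral>\<^sup>+t. ennreal B * indicator {0<..<T} t \<partial>lborel)"
    using slice by (intro nn_integral_mono_AE) auto
  also have "\<dots> < \<infinity>"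
    by (cases "0 \<le> T") (auto simp: nn_integral_cmult_indicator ennreal_mult_less_top)
  finally have int_pair: "integrable (lborel \<Otimes>\<^sub>M lborel) f"
    by (intro integrableI_bounded f_pair)
  then have int: "integrable lborel f" by (simp only: lborel_prod)
  have f_lborel: "f \<in> borel_measurable lborel" using f_meas by simp
  show "set_integrable lebesgue (\<Omega> \<times> {0<..<T}) (\<lambda>z. G z * H z)"
    unfolding set_integrable_def f_def[symmetric] integrable_completion[OF f_lborel] by (rule int)
  have cont_I: "continuous_on {0..T} I" unfolding I_def by (rule contL2_inner[OF g h])
  have I_meas: "(\<lambda>t. indicator {0..T} t *\<^sub>R I t) \<in> borel_measurable borel"
    by (rule borel_measurable_continuous_on_indicator) (use cont_I in auto)
  have "(LINT z:\<Omega> \<times> {0<..<T}|lebesgue. G z * H z) = (\<integral>z. f z \<partial>lborel)"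
    unfolding set_lebesgue_integral_def f_def[symmetric] by (rule integral_completion[OF f_lborel])
  also have "\<dots> = (\<integral>z. f z \<partial>(lborel \<Otimes>\<^sub>M lborel))" by (simp only: lborel_prod)
  also have "\<dots> = (\<integral>t. \<integral>x. f (x, t) \<partial>lborel \<partial>lborel)"
    using lborel_pair.integral_snd[of "\<lambda>x t. f (x, t)"] int_pair by simp
  also have "\<dots> = (\<integral>t. indicator {0..T} t *\<^sub>R I t \<partial>lborel)"
  proof (rule integral_cong_AE)
    show "(\<lambda>t. \<integral>x. f (x, t) \<partial>lborel) \<in> borel_measurable lborel" by measurable
    show "AE t in lborel. (\<integral>x. f (x, t) \<partial>lborel) = indicator {0..T} t *\<^sub>R I t"
      using slice AE_lborel_not_endpoint[of 0] AE_lborel_not_endpoint[of T]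
      by eventually_elim (auto simp: indicator_def)
  qed (use I_meas in simp)
  also have "\<dots> = integral {0..T} I"
  proof -
    have "set_integrable lborel {0..T} I"
      by (rule borel_integrable_atLeastAtMost') (rule cont_I)
    from set_borel_integral_eq_integral(2)[OF this] show ?thesis by (simp add: set_lebesgue_integral_def)
  qed
  finally show "(LINT z:\<Omega> \<times> {0<..<T}|lebesgue. G z * H z) = integral {0..T} (\<lambda>t. \<integral>x. g t x * h t x \<partial>?M)"
    unfolding I_def .
qed

text \<open>A Lebesgue measurable function differs from a Borel one only inside a Borel null set,
  and at almost every time the slice of this null set is null.\<close>

lemma Borel_representative:
  fixes \<Omega> :: "'a::euclidean_space set" and u :: "real \<Rightarrow> 'a \<Rightarrow> real"
  assumes \<Omega>: "open \<Omega>" and u: "set_integrable lebesgue (\<Omega> \<times> {0<..<T}) (\<lambda>z. u (snd z) (fst z))"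
  obtains U where "U \<in> borel_measurable borel" "represents (lebesgue_on \<Omega>) T U u"
    "AE z in lebesgue. z \<in> \<Omega> \<times> {0<..<T} \<longrightarrow> U z = u (snd z) (fst z)"
proof -
  define f where "f z = indicator (\<Omega> \<times> {0<..<T}) z *\<^sub>R u (snd z) (fst z)" for z
  have "f \<in> borel_measurable lebesgue"
    unfolding f_def using u by (intro borel_measurable_integrable) (simp add: set_integrable_def)
  from completion_ex_borel_measurable_real[OF this] obtain U
    where U: "U \<in> borel_measurable lborel" and ae: "AE z in lborel. f z = U z" by blast
  obtain N where N: "N \<in> null_sets lborel" "{z. f z \<noteq> U z} \<subseteq> N"
    using ae unfolding eventually_ae_filter by auto
  have N_sets: "N \<in> sets (lborel \<Otimes>\<^sub>M lborel)" unfolding lborel_prod using N(1) by (rule null_setsD2)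
  have "AE z in lborel \<Otimes>\<^sub>M lborel. z \<notin> N" unfolding lborel_prod by (rule AE_not_in[OF N(1)])
  then have "AE x in lborel. AE t in lborel. (x, t) \<notin> N" by (rule lborel_pair.AE_pair)
  then have "AE t in lborel. AE x in lborel. (x, t) \<notin> N"
  proof (subst lborel_pair.AE_commute[symmetric])
    have "{z \<in> space (lborel \<Otimes>\<^sub>M lborel). (fst z, snd z) \<notin> N} = space (lborel \<Otimes>\<^sub>M lborel) - N" by auto
    also have "\<dots> \<in> sets (lborel \<Otimes>\<^sub>M lborel)" using N_sets by (rule sets.compl_sets)
    finally show "{z \<in> space (lborel \<Otimes>\<^sub>M lborel). (fst z, snd z) \<notin> N} \<in> sets (lborel \<Otimes>\<^sub>M lborel)" .
  qed
  then have rep: "represents (lebesgue_on \<Omega>) T U u"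
    unfolding represents_def
  proof eventually_elim
    case (elim t)
    show ?case
    proof
      assume t: "t \<in> {0<..<T}"
      show "AE x in lebesgue_on \<Omega>. U (x, t) = u t x"
        unfolding AE_lebesgue_on_iff[OF \<Omega>]
        using AE_completion[OF elim]
      proof eventually_elim
        case (elim x)
        then have "f (x, t) = U (x, t)" using N(2) by auto
        then show ?case using t by (cases "x \<in> \<Omega>") (simp_all add: f_def)
      qed
    qed
  qed
  have "AE z in lebesgue. z \<in> \<Omega> \<times> {0<..<T} \<longrightarrow> U z = u (snd z) (fst z)"
    using AE_completion[OF ae] by eventually_elim (auto simp: f_def indicator_def)
  with U rep show ?thesis using that by simp
qed

section \<open>Test functions on the cylinder and weak time derivatives\<close>

lemma continuous_uniform_in_time:
  fixes q :: "'a::euclidean_space \<times> real \<Rightarrow> real"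
  assumes q: "continuous_on UNIV q" and \<Omega>: "bounded \<Omega>" and "0 < e"
  obtains d where "0 < d"
    "\<And>x r t. x \<in> \<Omega> \<Longrightarrow> r \<in> {0..T} \<Longrightarrow> t \<in> {0..T} \<Longrightarrow> \<bar>r - t\<bar> < d \<Longrightarrow> \<bar>q (x, r) - q (x, t)\<bar> < e"
proof -
  have "uniformly_continuous_on (closure \<Omega> \<times> {0..T}) q"
    using \<Omega> by (intro compact_uniformly_continuous continuous_on_subset[OF q] compact_Times) auto
  then obtain d where d: "0 < d" "\<And>z z'. z \<in> closure \<Omega> \<times> {0..T} \<Longrightarrow> z' \<in> closure \<Omega> \<times> {0..T} \<Longrightarrow>
      dist z' z < d \<Longrightarrow> dist (q z') (q z) < e"
    unfolding uniformly_continuous_on_def using \<open>0 < e\<close> by blast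
  have "\<bar>q (x, r) - q (x, t)\<bar> < e" if "x \<in> \<Omega>" "r \<in> {0..T}" "t \<in> {0..T}" "\<bar>r - t\<bar> < d" for x r t
  proof -
    have "x \<in> closure \<Omega>" using that(1) closure_subset by blast
    then have "dist (q (x, r)) (q (x, t)) < e"
      using that by (intro d(2)) (auto simp: dist_Pair_Pair dist_real_def)
    then show ?thesis by (simp add: dist_real_def)
  qed
  with d(1) show ?thesis using that by blast
qed

lemma sqint_continuous_section:
  fixes q :: "'a::euclidean_space \<times> real \<Rightarrow> real"
  assumes q: "continuous_on UNIV q" and \<Omega>: "open \<Omega>" "bounded \<Omega>"
  shows "sqint (lebesgue_on \<Omega>) (\<lambda>x. q (x, t))"
proof -
  interpret finite_measure "lebesgue_on \<Omega>" by (rule finite_measure_lebesgue_on_bounded_open[OF \<Omega>])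
  have "bounded ((\<lambda>x. q (x, t)) ` closure \<Omega>)"
    using \<Omega> by (intro compact_imp_bounded compact_continuous_image continuous_on_compose2[OF q]
        continuous_on_Pair continuous_on_id continuous_on_const) auto
  then obtain B where B: "\<forall>y\<in>(\<lambda>x. q (x, t)) ` closure \<Omega>. norm y \<le> B" unfolding bounded_iff by blast
  have le: "\<bar>q (x, t)\<bar> \<le> B" if "x \<in> space (lebesgue_on \<Omega>)" for x
    using B that closure_subset by fastforce
  have "sqint (lebesgue_on \<Omega>) (\<lambda>_. 1)" by (simp add: sqint_def)
  then have "sqint (lebesgue_on \<Omega>) (\<lambda>x. 1 * q (x, t))"
    by (rule sqint_bounded_mult[OF _ borel_measurable_section(2)[OF borel_measurable_continuous_onI[OF q]] le])
  then show ?thesis by simp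
qed

lemma contL2_continuous:
  fixes q :: "'a::euclidean_space \<times> real \<Rightarrow> real"
  assumes q: "continuous_on UNIV q" and \<Omega>: "open \<Omega>" "bounded \<Omega>"
  shows "contL2 (lebesgue_on \<Omega>) T (\<lambda>t x. q (x, t))"
  unfolding contL2_def
proof
  fix t assume t: "t \<in> {0..T}"
  have meas: "(\<lambda>x. q (x, s)) \<in> borel_measurable (lebesgue_on \<Omega>)" for s
    by (rule borel_measurable_section(2)[OF borel_measurable_continuous_onI[OF q]])
  show "L2lim (lebesgue_on \<Omega>) (at t within {0..T}) (\<lambda>s x. q (x, s)) (\<lambda>x. q (x, t))"
  proof (rule L2lim_uniform[OF finite_measure_lebesgue_on_bounded_open[OF \<Omega>] sqint_continuous_section[OF q \<Omega>]])
    fix e :: real assume "0 < e"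
    then obtain d where d: "0 < d"
      "\<And>x r t. x \<in> \<Omega> \<Longrightarrow> r \<in> {0..T} \<Longrightarrow> t \<in> {0..T} \<Longrightarrow> \<bar>r - t\<bar> < d \<Longrightarrow> \<bar>q (x, r) - q (x, t)\<bar> < e"
      using continuous_uniform_in_time[OF q \<Omega>(2)] by blast
    show "\<forall>\<^sub>F s in at t within {0..T}. \<forall>x\<in>space (lebesgue_on \<Omega>). \<bar>q (x, s) - q (x, t)\<bar> \<le> e"
      unfolding eventually_at dist_real_def
      using d t by (intro exI[of _ d]) (auto intro: less_imp_le)
  qed (use meas in simp)
qed

lemma represents_self: "represents M T G (\<lambda>t x. G (x, t))"
  by (simp add: represents_def)

text \<open>By the mean value theorem in time the difference quotient is a value of the time
  derivative at an intermediate time, so uniform continuity gives uniform convergence. Support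
  inside the open cylinder forces the values at times 0 and \<open>T\<close> to vanish, which
  removes the boundary terms of an integration by parts.\<close>

lemma test_function_L2_derivative:
  fixes \<phi> :: "'a::euclidean_space \<times> real \<Rightarrow> real"
  assumes \<phi>: "C1c \<phi>" and supp: "closure {z. \<phi> z \<noteq> 0} \<subseteq> \<Omega> \<times> {0<..<T}" and \<Omega>: "open \<Omega>" "bounded \<Omega>"
  defines "\<phi>t \<equiv> \<lambda>z. frechet_derivative \<phi> (at z) (0, 1)"
  shows "continuous_on UNIV \<phi>" "continuous_on UNIV \<phi>t"
    and "\<And>t. t \<in> {0..T} \<Longrightarrow> has_L2_derivative (lebesgue_on \<Omega>) (\<lambda>t x. \<phi> (x, t)) (\<lambda>x. \<phi>t (x, t)) t {0..T}"
    and "\<And>x. \<phi> (x, 0) = 0" "\<And>x. \<phi> (x, T) = 0"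
proof -
  obtain D where D: "\<And>z. (\<phi> has_derivative blinfun_apply (D z)) (at z)" "continuous_on UNIV D"
    using \<phi> unfolding C1c_def by blast
  have \<phi>t_eq: "\<phi>t z = D z (0, 1)" for z
    unfolding \<phi>t_def using frechet_derivative_at[OF D(1)[of z]] by simp
  show cont: "continuous_on UNIV \<phi>"
    using D(1) by (intro continuous_at_imp_continuous_on ballI has_derivative_continuous)
  show cont_t: "continuous_on UNIV \<phi>t"
    unfolding \<phi>t_eq using D(2) by (intro continuous_intros)
  have supp': "z \<in> \<Omega> \<times> {0<..<T}" if "\<phi> z \<noteq> 0" for z
    using that supp closure_subset[of "{z. \<phi> z \<noteq> 0}"] by blast
  show "\<phi> (x, 0) = 0" "\<phi> (x, T) = 0" for x
    using supp'[of "(x, 0)"] supp'[of "(x, T)"] by auto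
  have deriv: "((\<lambda>r. \<phi> (x, r)) has_real_derivative \<phi>t (x, r)) (at r)" for x r
  proof -
    have "((\<lambda>r. (x, r)) has_derivative (\<lambda>h. (0, h))) (at r)"
      by (intro has_derivative_Pair has_derivative_const has_derivative_ident)
    from has_derivative_compose[OF this D(1)]
    have "((\<lambda>r. \<phi> (x, r)) has_derivative (\<lambda>h. D (x, r) (0, h))) (at r)" .
    moreover have "D (x, r) (0, h) = \<phi>t (x, r) * h" for h
      using blinfun.scaleR_right[of "D (x, r)" h "(0, 1)"] by (simp add: \<phi>t_eq mult.commute)
    ultimately show ?thesis by (simp add: has_field_derivative_def)
  qed
  fix t assume t: "t \<in> {0..T}"
  have meas: "(\<lambda>x. \<phi> (x, s)) \<in> borel_measurable (lebesgue_on \<Omega>)" for s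
    by (rule borel_measurable_section(2)[OF borel_measurable_continuous_onI[OF cont]])
  have "L2lim (lebesgue_on \<Omega>) (at t within {0..T}) (\<lambda>s x. (\<phi> (x, s) - \<phi> (x, t)) / (s - t)) (\<lambda>x. \<phi>t (x, t))"
  proof (rule L2lim_uniform[OF finite_measure_lebesgue_on_bounded_open[OF \<Omega>] sqint_continuous_section[OF cont_t \<Omega>]])
    fix e :: real assume "0 < e"
    then obtain d where d: "0 < d"
      "\<And>x r t. x \<in> \<Omega> \<Longrightarrow> r \<in> {0..T} \<Longrightarrow> t \<in> {0..T} \<Longrightarrow> \<bar>r - t\<bar> < d \<Longrightarrow> \<bar>\<phi>t (x, r) - \<phi>t (x, t)\<bar> < e"
      using continuous_uniform_in_time[OF cont_t \<Omega>(2)] by blast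
    show "\<forall>\<^sub>F s in at t within {0..T}. \<forall>x\<in>space (lebesgue_on \<Omega>). \<bar>(\<phi> (x, s) - \<phi> (x, t)) / (s - t) - \<phi>t (x, t)\<bar> \<le> e"
      unfolding eventually_at dist_real_def
    proof (intro exI[of _ d] conjI ballI impI)
      fix s x assume s: "s \<in> {0..T}" "s \<noteq> t \<and> \<bar>s - t\<bar> < d" and x: "x \<in> space (lebesgue_on \<Omega>)"
      obtain r where r: "r \<in> {min s t..max s t}" "(\<phi> (x, s) - \<phi> (x, t)) / (s - t) = \<phi>t (x, r)"
      proof (cases "s < t")
        case True
        obtain r where "s < r" "r < t" "\<phi> (x, t) - \<phi> (x, s) = (t - s) * \<phi>t (x, r)"
          using MVT2[OF True, of "\<lambda>r. \<phi> (x, r)" "\<lambda>r. \<phi>t (x, r)"] deriv by blast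
        then show ?thesis using that[of r] True by (simp add: field_simps)
      next
        case False
        then have "t < s" using s by simp
        obtain r where "t < r" "r < s" "\<phi> (x, s) - \<phi> (x, t) = (s - t) * \<phi>t (x, r)"
          using MVT2[OF \<open>t < s\<close>, of "\<lambda>r. \<phi> (x, r)" "\<lambda>r. \<phi>t (x, r)"] deriv by blast
        then show ?thesis using that[of r] \<open>t < s\<close> by simp
      qed
      have "\<bar>\<phi>t (x, r) - \<phi>t (x, t)\<bar> < e"
        using r(1) s t x by (intro d(2)) auto
      then show "\<bar>(\<phi> (x, s) - \<phi> (x, t)) / (s - t) - \<phi>t (x, t)\<bar> \<le> e" by (simp add: r(2))
    qed (rule d(1))
  qed (use meas in simp)
  then show "has_L2_derivative (lebesgue_on \<Omega>) (\<lambda>t x. \<phi> (x, t)) (\<lambda>x. \<phi>t (x, t)) t {0..T}"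
    unfolding has_L2_derivative_def using sqint_continuous_section[OF cont \<Omega>] by simp
qed

text \<open>Integration by parts in time: the inner product of \<open>v t\<close> with the test
  function is differentiable and vanishes at both ends, so its derivative has integral 0.\<close>

lemma weak_dt_L2_of_derivative:
  fixes \<Omega> :: "'a::euclidean_space set"
  assumes \<Omega>: "open \<Omega>" "bounded \<Omega>" and "0 < T"
    and V: "V \<in> borel_measurable borel" "represents (lebesgue_on \<Omega>) T V v"
    and W: "W \<in> borel_measurable borel" "represents (lebesgue_on \<Omega>) T W w" "contL2 (lebesgue_on \<Omega>) T w"
    and deriv: "\<And>t. t \<in> {0..T} \<Longrightarrow> has_L2_derivative (lebesgue_on \<Omega>) v (w t) t {0..T}"
  shows "weak_dt_L2 \<Omega> T (\<lambda>t x. V (x, t)) (\<lambda>t x. W (x, t))"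
  unfolding weak_dt_L2_def prod.collapse
proof (intro conjI allI impI)
  let ?M = "lebesgue_on \<Omega>" and ?S = "\<Omega> \<times> {0<..<T}"
  have [measurable]: "?S \<in> sets borel" using \<Omega> by (intro borel_open open_Times) auto
  have contv: "contL2 ?M T v" using deriv by (rule has_L2_derivative_contL2)
  show "set_borel_measurable lebesgue ?S W"
    unfolding set_borel_measurable_def using W(1) by (intro measurable_completion) measurable
  show "set_integrable lebesgue ?S (\<lambda>z. (W z)\<^sup>2)"
    using slab_integral_mult(1)[OF \<Omega>(1) W(1) W(1) W(2) W(2) W(3) W(3)] by (simp add: power2_eq_square)
  fix \<phi> :: "'a \<times> real \<Rightarrow> real" assume \<phi>: "C1c \<phi> \<and> closure {z. \<phi> z \<noteq> 0} \<subseteq> ?S"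
  define \<phi>t where "\<phi>t z = frechet_derivative \<phi> (at z) (0, 1)" for z
  note tf = test_function_L2_derivative[OF conjunct1[OF \<phi>] conjunct2[OF \<phi>] \<Omega>, folded \<phi>t_def]
  have cont\<phi>: "contL2 ?M T (\<lambda>t x. \<phi> (x, t))" "contL2 ?M T (\<lambda>t x. \<phi>t (x, t))"
    using contL2_continuous[OF tf(1) \<Omega>] contL2_continuous[OF tf(2) \<Omega>] by auto
  have 1: "(LINT z:?S|lebesgue. V z * \<phi>t z) = integral {0..T} (\<lambda>t. \<integral>x. v t x * \<phi>t (x, t) \<partial>?M)"
    by (rule slab_integral_mult(2)[OF \<Omega>(1) V(1) borel_measurable_continuous_onI[OF tf(2)] V(2) represents_self contv cont\<phi>(2)])
  have 2: "(LINT z:?S|lebesgue. W z * \<phi> z) = integral {0..T} (\<lambda>t. \<integral>x. w t x * \<phi> (x, t) \<partial>?M)"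
    by (rule slab_integral_mult(2)[OF \<Omega>(1) W(1) borel_measurable_continuous_onI[OF tf(1)] W(2) represents_self W(3) cont\<phi>(1)])
  have "((\<lambda>t. (\<integral>x. w t x * \<phi> (x, t) \<partial>?M) + (\<integral>x. v t x * \<phi>t (x, t) \<partial>?M)) has_integral
      (\<integral>x. v T x * \<phi> (x, T) \<partial>?M) - (\<integral>x. v 0 x * \<phi> (x, 0) \<partial>?M)) {0..T}"
    using \<open>0 < T\<close> has_L2_derivative_inner[OF deriv tf(3)]
    by (intro fundamental_theorem_of_calculus) (auto simp: has_real_derivative_iff_has_vector_derivative)
  then have "integral {0..T} (\<lambda>t. (\<integral>x. w t x * \<phi> (x, t) \<partial>?M) + (\<integral>x. v t x * \<phi>t (x, t) \<partial>?M)) = 0"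
    by (intro integral_unique) (simp add: tf(4,5))
  moreover have "integral {0..T} (\<lambda>t. (\<integral>x. w t x * \<phi> (x, t) \<partial>?M) + (\<integral>x. v t x * \<phi>t (x, t) \<partial>?M))
      = integral {0..T} (\<lambda>t. \<integral>x. w t x * \<phi> (x, t) \<partial>?M) + integral {0..T} (\<lambda>t. \<integral>x. v t x * \<phi>t (x, t) \<partial>?M)"
    by (intro Henstock_Kurzweil_Integration.integral_add integrable_continuous_real contL2_inner W(3) contv cont\<phi>)
  ultimately show "(LINT z:?S|lebesgue. V z * frechet_derivative \<phi> (at z) (0, 1)) = - (LINT z:?S|lebesgue. W z * \<phi> z)"
    unfolding \<phi>t_def[symmetric] 1 2 by simp
qed

section \<open>The fractional variation\<close>

definition unit_fields :: "('a::euclidean_space \<Rightarrow> 'a) set" where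
  "unit_fields = {\<Psi>. C1c \<Psi> \<and> (\<forall>x. norm (\<Psi> x) \<le> 1)}"

lemma TVR_eq_SUP_lebesgue_on:
  fixes \<Omega> :: "'a::euclidean_space set"
  assumes "open \<Omega>"
  shows "TVR \<Omega> \<alpha> f = (SUP \<Psi>\<in>unit_fields. ennreal (\<integral>x. f x * frac_div \<alpha> \<Psi> x \<partial>lebesgue_on \<Omega>))"
proof -
  have "(\<integral>x. f x * frac_div \<alpha> \<Psi> x \<partial>lebesgue_on \<Omega>) = (\<integral>x. indicator \<Omega> x * f x * frac_div \<alpha> \<Psi> x \<partial>lebesgue)" for \<Psi>
    unfolding set_integral_lebesgue_on[OF assms, symmetric] set_lebesgue_integral_def
    by (simp add: mult.assoc)
  then show ?thesis by (simp add: TVR_def unit_fields_def)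
qed

lemma pairing_le_TVR:
  fixes \<Omega> :: "'a::euclidean_space set"
  assumes "open \<Omega>" "\<Psi> \<in> unit_fields"
  shows "ennreal (\<integral>x. f x * frac_div \<alpha> \<Psi> x \<partial>lebesgue_on \<Omega>) \<le> TVR \<Omega> \<alpha> f"
  unfolding TVR_eq_SUP_lebesgue_on[OF assms(1)] using assms(2) by (rule SUP_upper)

lemma TVR_cong_AE:
  fixes \<Omega> :: "'a::euclidean_space set"
  assumes \<Omega>: "open \<Omega>" and \<alpha>: "0 < \<alpha>" "\<alpha> < 1"
    and "f \<in> borel_measurable (lebesgue_on \<Omega>)" "g \<in> borel_measurable (lebesgue_on \<Omega>)"
    and "AE x in lebesgue_on \<Omega>. f x = g x"
  shows "TVR \<Omega> \<alpha> f = TVR \<Omega> \<alpha> g"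
  unfolding TVR_eq_SUP_lebesgue_on[OF \<Omega>]
proof (rule SUP_cong[OF refl])
  fix \<Psi> :: "'a \<Rightarrow> 'a" assume "\<Psi> \<in> unit_fields"
  then have "frac_div \<alpha> \<Psi> \<in> borel_measurable borel"
    using \<alpha> by (intro frac_div_measurable) (auto simp: unit_fields_def)
  then have "frac_div \<alpha> \<Psi> \<in> borel_measurable (lebesgue_on \<Omega>)"
    using measurable_compose[OF id_borel_measurable_lebesgue_on[of \<Omega>]] by (simp add: id_def)
  then have "(\<integral>x. f x * frac_div \<alpha> \<Psi> x \<partial>lebesgue_on \<Omega>) = (\<integral>x. g x * frac_div \<alpha> \<Psi> x \<partial>lebesgue_on \<Omega>)"
    using assms(4-6) by (intro integral_cong_AE) auto
  then show "ennreal (\<integral>x. f x * frac_div \<alpha> \<Psi> x \<partial>lebesgue_on \<Omega>) = ennreal (\<integral>x. g x * frac_div \<alpha> \<Psi> x \<partial>lebesgue_on \<Omega>)"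
    by simp
qed

text \<open>Boundedness on the bounded set \<Omega> puts the fractional divergence into L2. Hence
  pairing with it is continuous in L2, and the variation, a supremum of such pairings, is lower
  semicontinuous.\<close>

lemma sqint_frac_div:
  fixes \<Omega> :: "'a::euclidean_space set"
  assumes \<Omega>: "open \<Omega>" "bounded \<Omega>" and \<alpha>: "0 < \<alpha>" "\<alpha> < 1" and \<Psi>: "C1c \<Psi>"
  shows "sqint (lebesgue_on \<Omega>) (frac_div \<alpha> \<Psi>)"
proof -
  interpret finite_measure "lebesgue_on \<Omega>" by (rule finite_measure_lebesgue_on_bounded_open[OF \<Omega>])
  obtain C where C: "\<And>x. x \<in> \<Omega> \<Longrightarrow> \<bar>frac_div \<alpha> \<Psi> x\<bar> \<le> C"
    using frac_div_bounded[OF \<Psi> \<alpha> \<Omega>(2)] by blast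
  have "frac_div \<alpha> \<Psi> \<in> borel_measurable (lebesgue_on \<Omega>)"
    using measurable_compose[OF id_borel_measurable_lebesgue_on[of \<Omega>] frac_div_measurable[OF \<Psi> \<alpha>]]
    by (simp add: id_def)
  moreover have "sqint (lebesgue_on \<Omega>) (\<lambda>_. 1)" by (simp add: sqint_def)
  ultimately have "sqint (lebesgue_on \<Omega>) (\<lambda>x. 1 * frac_div \<alpha> \<Psi> x)"
    using C by (intro sqint_bounded_mult[where C = C]) auto
  then show ?thesis by simp
qed

lemma continuous_on_pairing:
  fixes \<Omega> :: "'a::euclidean_space set"
  assumes \<Omega>: "open \<Omega>" "bounded \<Omega>" and \<alpha>: "0 < \<alpha>" "\<alpha> < 1" and \<Psi>: "C1c \<Psi>"
    and v: "contL2 (lebesgue_on \<Omega>) T v"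
  shows "continuous_on {0..T} (\<lambda>t. \<integral>x. v t x * frac_div \<alpha> \<Psi> x \<partial>lebesgue_on \<Omega>)"
  by (rule contL2_inner[OF v contL2_const[OF sqint_frac_div[OF \<Omega> \<alpha> \<Psi>]]])

text \<open>The supremum runs over uncountably many fields, so measurability is not inherited from
  its members. But each pairing is continuous in time, hence the superlevel sets of the supremum are
  unions of relatively open sets.\<close>

lemma TVR_time_measurable:
  fixes \<Omega> :: "'a::euclidean_space set"
  assumes \<Omega>: "open \<Omega>" "bounded \<Omega>" and \<alpha>: "0 < \<alpha>" "\<alpha> < 1"
    and v: "contL2 (lebesgue_on \<Omega>) T v"
  shows "(\<lambda>t. TVR \<Omega> \<alpha> (v t) * indicator {0..T} t) \<in> borel_measurable lborel"
proof -
  have "(\<lambda>t. TVR \<Omega> \<alpha> (v t)) \<in> borel_measurable (restrict_space borel {0..T})"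
  proof (rule borel_measurableI_greater)
    fix y :: ennreal
    define A where "A \<Psi> = {0..T} \<inter> (\<lambda>t. ennreal (\<integral>x. v t x * frac_div \<alpha> \<Psi> x \<partial>lebesgue_on \<Omega>)) -` {y<..}"
      for \<Psi> :: "'a \<Rightarrow> 'a"
    have "openin (top_of_set {0..T}) (A \<Psi>)" if "\<Psi> \<in> unit_fields" for \<Psi>
      unfolding A_def
      using that continuous_on_pairing[OF \<Omega> \<alpha> _ v]
      by (intro continuous_openin_preimage_gen continuous_on_ennreal) (auto simp: unit_fields_def)
    then have "openin (top_of_set {0..T}) (\<Union>\<Psi>\<in>unit_fields. A \<Psi>)" by blast
    then obtain B where B: "open B" "(\<Union>\<Psi>\<in>unit_fields. A \<Psi>) = {0..T} \<inter> B"
      by (auto simp: openin_open)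
    have "{t \<in> space (restrict_space borel {0..T}). y < TVR \<Omega> \<alpha> (v t)} = (\<Union>\<Psi>\<in>unit_fields. A \<Psi>)"
      by (auto simp: TVR_eq_SUP_lebesgue_on[OF \<Omega>(1)] less_SUP_iff A_def space_restrict_space)
    also have "\<dots> \<in> sets (restrict_space borel {0..T})"
      unfolding B(2) using B(1) by (auto simp: sets_restrict_space)
    finally show "{t \<in> space (restrict_space borel {0..T}). y < TVR \<Omega> \<alpha> (v t)} \<in> sets (restrict_space borel {0..T})" .
  qed
  then show ?thesis
    by (subst (asm) borel_measurable_restrict_space_iff_ennreal) auto
qed

section \<open>Exponential averages in time\<close>

lemma nn_integral_exp_Icc:
  fixes h c a b :: real
  assumes "0 < h" "a \<le> b"
  shows "(\<integral>\<^sup>+t. ennreal (exp ((c - t) / h) / h) * indicator {a..b} t \<partial>lborel)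
    = ennreal (exp ((c - a) / h) - exp ((c - b) / h))"
proof -
  have "(\<integral>\<^sup>+t. ennreal (exp ((c - t) / h) / h) * indicator {a..b} t \<partial>lborel)
      = ennreal (- exp ((c - b) / h) - - exp ((c - a) / h))"
  proof (rule nn_integral_FTC_Icc)
    show "((\<lambda>t. - exp ((c - t) / h)) has_real_derivative exp ((c - t) / h) / h) (at t)" for t
      using assms by (auto intro!: derivative_eq_intros)
  qed (use assms in auto)
  then show ?thesis by simp
qed

text \<open>The weighted average \<open>B\<close> solves \<open>h * B' + B = \<tau>\<close>, \<open>B 0 = A\<close>; this is the integrated form.\<close>

lemma nn_integral_exp_average:
  fixes \<tau> :: "real \<Rightarrow> ennreal" and h r :: real and A :: ennreal
  assumes h: "0 < h" and r: "0 \<le> r" and [measurable]: "\<tau> \<in> borel_measurable borel"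
  defines "B \<equiv> \<lambda>t. ennreal (exp (- t / h)) * A
      + (\<integral>\<^sup>+s. ennreal (exp ((s - t) / h) / h) * indicator {0..t} s * \<tau> s \<partial>lborel)"
  shows "(\<integral>\<^sup>+t. B t * indicator {0..r} t \<partial>lborel) + ennreal h * B r
      = ennreal h * A + (\<integral>\<^sup>+s. \<tau> s * indicator {0..r} s \<partial>lborel)"
proof -
  \<comment> \<open>Both \<open>\<tau>\<close> and \<open>A\<close> may be infinite; the identity is
    therefore additive, with no extended term subtracted.\<close>
  define k where "k t s = ennreal (exp ((s - t) / h) / h) * indicator {0..t} s" for s t :: real
  let ?J1 = "\<integral>\<^sup>+s. \<tau> s * indicator {0..r} s * ennreal (1 - exp ((s - r) / h)) \<partial>lborel"
    and ?J2 = "\<integral>\<^sup>+s. k r s * \<tau> s \<partial>lborel"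
    and ?J3 = "\<integral>\<^sup>+t. B t * indicator {0..r} t \<partial>lborel"
    and ?J4 = "\<integral>\<^sup>+s. \<tau> s * indicator {0..r} s \<partial>lborel"
  have k_eq: "k t s = (if 0 \<le> s \<and> s \<le> t then ennreal (exp ((s - t) / h) / h) else 0)" for s t
    by (simp add: k_def indicator_def)
  have k_meas [measurable]: "(\<lambda>(t, s). k t s) \<in> borel_measurable (lborel \<Otimes>\<^sub>M lborel)"
    unfolding k_eq by measurable
  have exp_meas [measurable]: "(\<lambda>t. ennreal (exp (- t / h))) \<in> borel_measurable borel" by measurable
  have "(\<integral>\<^sup>+t. ennreal (exp (- t / h)) * A * indicator {0..r} t \<partial>lborel)
      = (\<integral>\<^sup>+t. (ennreal h * A) * (ennreal (exp ((0 - t) / h) / h) * indicator {0..r} t) \<partial>lborel)"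
  proof (intro nn_integral_cong)
    fix t
    have "ennreal (exp (- t / h)) = ennreal h * ennreal (exp ((0 - t) / h) / h)"
      using h by (simp add: ennreal_mult[symmetric])
    then show "ennreal (exp (- t / h)) * A * indicator {0..r} t
        = (ennreal h * A) * (ennreal (exp ((0 - t) / h) / h) * indicator {0..r} t)"
      by (simp add: mult_ac)
  qed
  also have "\<dots> = (ennreal h * A) * ennreal (1 - exp (- r / h))"
    using nn_integral_exp_Icc[OF h r, of 0] by (subst nn_integral_cmult) auto
  finally have I1: "(\<integral>\<^sup>+t. ennreal (exp (- t / h)) * A * indicator {0..r} t \<partial>lborel)
      = (ennreal h * A) * ennreal (1 - exp (- r / h))" .
  have "(\<integral>\<^sup>+t. (\<integral>\<^sup>+s. k t s * \<tau> s \<partial>lborel) * indicator {0..r} t \<partial>lborel)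
      = (\<integral>\<^sup>+t. \<integral>\<^sup>+s. k t s * \<tau> s * indicator {0..r} t \<partial>lborel \<partial>lborel)"
    by (intro nn_integral_cong nn_integral_multc[symmetric]) measurable
  also have "\<dots> = (\<integral>\<^sup>+s. \<integral>\<^sup>+t. k t s * \<tau> s * indicator {0..r} t \<partial>lborel \<partial>lborel)"
    by (rule lborel_pair.Fubini'[symmetric]) measurable
  \<comment> \<open>After Tonelli the kernel is integrated over \<open>t\<close> from
    \<open>s\<close> to \<open>r\<close>, which yields \<open>1 - exp ((s - r) / h)\<close>; the
    missing exponential is supplied by \<open>h * B r\<close>.\<close>
  also have "\<dots> = ?J1"
  proof (rule nn_integral_cong)
    fix s
    show "(\<integral>\<^sup>+t. k t s * \<tau> s * indicator {0..r} t \<partial>lborel) = \<tau> s * indicator {0..r} s * ennreal (1 - exp ((s - r) / h))"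
    proof (cases "s \<in> {0..r}")
      case True
      have "(\<integral>\<^sup>+t. k t s * \<tau> s * indicator {0..r} t \<partial>lborel)
          = (\<integral>\<^sup>+t. \<tau> s * (ennreal (exp ((s - t) / h) / h) * indicator {s..r} t) \<partial>lborel)"
        using True by (intro nn_integral_cong) (auto simp: k_def indicator_def mult_ac)
      also have "\<dots> = \<tau> s * ennreal (1 - exp ((s - r) / h))"
        using nn_integral_exp_Icc[OF h, of s r s] True by (subst nn_integral_cmult) auto
      finally show ?thesis using True by simp
    next
      case False
      then have "k t s * \<tau> s * indicator {0..r} t = 0" for t by (auto simp: k_def indicator_def)
      then show ?thesis using False by (simp only: nn_integral_const) simp
    qed
  qed
  finally have I2: "(\<integral>\<^sup>+t. (\<integral>\<^sup>+s. k t s * \<tau> s \<partial>lborel) * indicator {0..r} t \<partial>lborel)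
      = ?J1" .
  have "ennreal h * ?J2 = (\<integral>\<^sup>+s. \<tau> s * indicator {0..r} s * ennreal (exp ((s - r) / h)) \<partial>lborel)"
  proof -
    have "ennreal h * (k r s * \<tau> s) = \<tau> s * indicator {0..r} s * ennreal (exp ((s - r) / h))" for s
    proof -
      have "ennreal h * ennreal (exp ((s - r) / h) / h) = ennreal (exp ((s - r) / h))"
        using h by (simp add: ennreal_mult[symmetric])
      then show ?thesis unfolding k_def by (metis mult.assoc mult.commute)
    qed
    then show ?thesis by (subst nn_integral_cmult[symmetric]) (auto simp: k_eq)
  qed
  then have I3: "?J1 + ennreal h * ?J2
      = (\<integral>\<^sup>+s. \<tau> s * indicator {0..r} s * ennreal (1 - exp ((s - r) / h)) + \<tau> s * indicator {0..r} s * ennreal (exp ((s - r) / h)) \<partial>lborel)"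
    by (simp add: nn_integral_add)
  also have "\<dots> = ?J4"
  proof (rule nn_integral_cong)
    fix s
    show "\<tau> s * indicator {0..r} s * ennreal (1 - exp ((s - r) / h)) + \<tau> s * indicator {0..r} s * ennreal (exp ((s - r) / h)) = \<tau> s * indicator {0..r} s"
    proof (cases "s \<in> {0..r}")
      case True
      then have "ennreal (1 - exp ((s - r) / h)) + ennreal (exp ((s - r) / h)) = 1"
        using h by (subst ennreal_plus[symmetric]) (auto simp: divide_nonpos_pos)
      then show ?thesis by (simp add: distrib_left[symmetric])
    qed simp
  qed
  finally have I3: "?J1 + ennreal h * ?J2
      = ?J4" .
  have "ennreal (1 - exp (- r / h)) + ennreal (exp (- r / h)) = 1"
    using h r by (subst ennreal_plus[symmetric]) auto
  then have I4: "(ennreal h * A) * ennreal (1 - exp (- r / h)) + ennreal h * (ennreal (exp (- r / h)) * A) = ennreal h * A"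
    by (metis distrib_left mult.assoc mult.commute mult.right_neutral)
  have "?J3
      = (\<integral>\<^sup>+t. ennreal (exp (- t / h)) * A * indicator {0..r} t + (\<integral>\<^sup>+s. k t s * \<tau> s \<partial>lborel) * indicator {0..r} t \<partial>lborel)"
    unfolding B_def k_def[symmetric] by (simp add: distrib_right)
  also have "\<dots> = (ennreal h * A) * ennreal (1 - exp (- r / h))
      + ?J1"
    unfolding I1[symmetric] I2[symmetric] by (rule nn_integral_add) measurable
  finally have "?J3 + ennreal h * B r
     = ((ennreal h * A) * ennreal (1 - exp (- r / h)) + ennreal h * (ennreal (exp (- r / h)) * A))
      + (?J1 + ennreal h * ?J2)"
    unfolding B_def k_def[symmetric] by (simp add: distrib_left add_ac)
  then show ?thesis unfolding I3 I4 .
qed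

section \<open>Mollification in time\<close>

lemma has_L2_derivative_cong:
  assumes "has_L2_derivative M v d t S" "\<And>x. x \<in> space M \<Longrightarrow> d x = e x"
  shows "has_L2_derivative M v e t S"
proof -
  have ae: "AE x in M. d x = e x" using assms(2) by (rule AE_I2)
  have L: "L2lim M (at t within S) (\<lambda>s x. (v s x - v t x) / (s - t)) d"
    using assms(1) by (simp add: has_L2_derivative_def)
  then have d: "sqint M d" by (simp add: L2lim_def)
  have "e \<in> borel_measurable M"
    using measurable_cong[of M d e borel] assms(2) sqint_measurable[OF d] by simp
  then have e: "sqint M e" by (rule sqint_cong_AE[OF d _ ae])
  have "sqn M (\<lambda>x. f x - d x) = sqn M (\<lambda>x. f x - e x)" for f
    unfolding sqn_def by (intro Bochner_Integration.integral_cong) (auto simp: assms(2))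
  with L e show ?thesis using assms(1) unfolding has_L2_derivative_def L2lim_def by simp
qed

lemma has_L2_derivative_subset:
  assumes "has_L2_derivative M v d t S" "S' \<subseteq> S"
  shows "has_L2_derivative M v d t S'"
proof -
  have "at t within S' \<le> at t within S" using assms(2) by (rule at_le)
  then show ?thesis using assms(1)
    unfolding has_L2_derivative_def L2lim_def by (blast intro: filter_leD tendsto_mono)
qed

lemma represents_subset:
  assumes "represents M T G g" "T' \<le> T"
  shows "represents M T' G g"
  using assms(1) unfolding represents_def
  by eventually_elim (use assms(2) in auto)

text \<open>\<open>U\<close> is a Borel version of the curve \<open>u\<close>, and \<open>U0\<close>
  a Borel initial value. Both vanish off \<Omega> because membership in \<open>BVR\<close> concerns
  functions on the whole space; the mollification inherits this.\<close>

locale time_mollification =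
  fixes \<Omega> :: "'a::euclidean_space set" and S :: real
    and u :: "real \<Rightarrow> 'a \<Rightarrow> real" and U :: "'a \<times> real \<Rightarrow> real" and U0 :: "'a \<Rightarrow> real"
  assumes open_\<Omega>: "open \<Omega>" and bounded_\<Omega>: "bounded \<Omega>" and S_pos: "0 < S"
    and U_borel [measurable]: "U \<in> borel_measurable borel"
    and U_outside: "\<And>x t. x \<notin> \<Omega> \<Longrightarrow> U (x, t) = 0"
    and U_represents: "represents (lebesgue_on \<Omega>) S U u"
    and u_contL2: "contL2 (lebesgue_on \<Omega>) S u"
    and U0_borel [measurable]: "U0 \<in> borel_measurable borel"
    and U0_outside: "\<And>x. x \<notin> \<Omega> \<Longrightarrow> U0 x = 0"
    and U0_sqint: "sqint (lebesgue_on \<Omega>) U0"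
begin

abbreviation M :: "'a measure" where "M \<equiv> lebesgue_on \<Omega>"

text \<open>The solution of \<open>h * \<partial>\<^sub>t V + V = U\<close> with initial value \<open>U0\<close>.\<close>

definition V :: "real \<Rightarrow> 'a \<times> real \<Rightarrow> real" where
  "V h z = exp (- snd z / h) * (U0 (fst z) + 1 / h * (LINT s:{0<..snd z}|lborel. exp (s / h) * U (fst z, s)))"

text \<open>The time derivative of the mollification comes in two versions: this one is formed from
  \<open>u\<close> and is a continuous curve in L2; \<open>W\<close> is formed from \<open>U\<close>
  and is jointly Borel measurable. At almost every time in \<open>{0<..<S}\<close> their slices
  agree almost everywhere.\<close>

definition w :: "real \<Rightarrow> real \<Rightarrow> 'a \<Rightarrow> real" where
  "w h t x = (u t x - V h (x, t)) / h"

definition W :: "real \<Rightarrow> 'a \<times> real \<Rightarrow> real" where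
  "W h z = (U z - V h z) / h"

definition energy :: "real \<Rightarrow> real \<Rightarrow> real" where
  "energy h T = integral {0..T} (\<lambda>t. sqn M (w h t))"

lemma V_borel [measurable]: "V h \<in> borel_measurable borel"
proof -
  have fst_m [measurable]: "fst \<in> borel_measurable (borel :: ('a \<times> real) measure)"
    and snd_m [measurable]: "snd \<in> borel_measurable (borel :: ('a \<times> real) measure)"
    by (intro borel_measurable_continuous_onI continuous_intros)+
  have "(\<lambda>p. (fst (fst p), snd p)) \<in> borel_measurable ((borel :: ('a \<times> real) measure) \<Otimes>\<^sub>M lborel)"
    by (intro borel_measurable_Pair) measurable
  then have [measurable]: "(\<lambda>p. U (fst (fst p), snd p)) \<in> borel_measurable ((borel :: ('a \<times> real) measure) \<Otimes>\<^sub>M lborel)"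
    by (rule measurable_compose[OF _ U_borel])
  have "(\<lambda>p. if 0 < snd p \<and> snd p \<le> snd (fst p) then exp (snd p / h) * U (fst (fst p), snd p) else 0)
      \<in> borel_measurable ((borel :: ('a \<times> real) measure) \<Otimes>\<^sub>M lborel)"
    by measurable
  also have "(\<lambda>p. if 0 < snd p \<and> snd p \<le> snd (fst p) then exp (snd p / h) * U (fst (fst p), snd p) else 0)
      = (\<lambda>(z, s). indicator {0<..snd z} s *\<^sub>R (exp (s / h) * U (fst z, s)))"
    by (auto simp: fun_eq_iff indicator_def)
  finally have [measurable]: "(\<lambda>z. LINT s:{0<..snd z}|lborel. exp (s / h) * U (fst z, s)) \<in> borel_measurable borel"
    unfolding set_lebesgue_integral_def by (rule lborel.borel_measurable_lebesgue_integral)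
  have [measurable]: "(\<lambda>z. U0 (fst z)) \<in> borel_measurable (borel :: ('a \<times> real) measure)"
    by (rule measurable_compose[OF fst_m U0_borel])
  show ?thesis unfolding V_def by measurable
qed

lemma V_outside: "x \<notin> \<Omega> \<Longrightarrow> V h (x, t) = 0"
  by (simp add: V_def U_outside U0_outside)

lemma V_0: "V h (x, 0) = U0 x"
  by (simp add: V_def set_lebesgue_integral_def)

lemma W_borel [measurable]: "W h \<in> borel_measurable borel"
  unfolding W_def by measurable

text \<open>In the product rule for \<open>exp (- t / h)\<close> times a primitive, the factors
  \<open>exp (t / h)\<close> and \<open>exp (- t / h)\<close> cancel in one term, and the other
  reproduces \<open>V\<close> with the factor \<open>- (1 / h)\<close>.\<close>

lemma has_L2_derivative_V:
  assumes h: "0 < h" and t: "t \<in> {0..S}"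
  shows "has_L2_derivative M (\<lambda>t x. V h (x, t)) (w h t) t {0..S}"
proof -
  define P where "P t x = (LINT s:{0<..t}|lborel. exp (s / h) * U (x, s))" for t x
  have snd_m [measurable]: "snd \<in> borel_measurable (borel :: ('a \<times> real) measure)"
    by (intro borel_measurable_continuous_onI continuous_intros)
  have "(\<lambda>z. exp (snd z / h) * U z) \<in> borel_measurable borel" by measurable
  moreover have "represents M S (\<lambda>z. exp (snd z / h) * U z) (\<lambda>t x. exp (t / h) * u t x)"
    using U_represents unfolding represents_def by eventually_elim auto
  moreover have "contL2 M S (\<lambda>t x. exp (t / h) * u t x)"
    by (intro contL2_scale u_contL2 continuous_intros) (use h in auto)
  ultimately have "has_L2_derivative M P (\<lambda>x. exp (t / h) * u t x) t {0..S}"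
    using has_L2_derivative_primitive[OF finite_measure_lebesgue_on_bounded_open[OF open_\<Omega> bounded_\<Omega>]
        borel_measurable_lebesgue_on_pair _ _ S_pos t, of "\<lambda>z. exp (snd z / h) * U z" "\<lambda>t x. exp (t / h) * u t x"]
    by (simp add: P_def[abs_def])
  from has_L2_derivative_scale[OF DERIV_const[of "1 / h"] this]
  have "has_L2_derivative M (\<lambda>t x. 1 / h * P t x) (\<lambda>x. 1 / h * (exp (t / h) * u t x) + 0 * P t x) t {0..S}" .
  from has_L2_derivative_add[OF has_L2_derivative_const[OF U0_sqint] this]
  have Q: "has_L2_derivative M (\<lambda>t x. U0 x + 1 / h * P t x) (\<lambda>x. 1 / h * (exp (t / h) * u t x)) t {0..S}"
    by simp
  have "((\<lambda>t. exp (- t / h)) has_real_derivative - (1 / h) * exp (- t / h)) (at t within {0..S})"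
    using h by (auto intro!: derivative_eq_intros)
  from has_L2_derivative_scale[OF this Q]
  have "has_L2_derivative M (\<lambda>t x. V h (x, t))
     (\<lambda>x. exp (- t / h) * (1 / h * (exp (t / h) * u t x)) + - (1 / h) * exp (- t / h) * (U0 x + 1 / h * P t x)) t {0..S}"
    by (simp add: V_def P_def)
  moreover have "exp (- t / h) * (1 / h * (exp (t / h) * u t x)) + - (1 / h) * exp (- t / h) * (U0 x + 1 / h * P t x) = w h t x" for x
  proof -
    have "exp (- t / h) * (1 / h * (exp (t / h) * u t x)) = (exp (- t / h) * exp (t / h)) * u t x / h"
      by (simp only: times_divide_eq_left times_divide_eq_right mult_1 mult.assoc)
    also have "exp (- t / h) * exp (t / h) = 1" by (simp add: exp_add[symmetric])
    finally have "exp (- t / h) * (1 / h * (exp (t / h) * u t x)) = u t x / h" by simp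
    moreover have "V h (x, t) = exp (- t / h) * (U0 x + 1 / h * P t x)" by (simp add: V_def P_def)
    ultimately show ?thesis by (simp only: w_def diff_divide_distrib) simp
  qed
  ultimately show ?thesis by (rule has_L2_derivative_cong)
qed

lemma contL2_V: "0 < h \<Longrightarrow> contL2 M S (\<lambda>t x. V h (x, t))"
  using has_L2_derivative_V by (rule has_L2_derivative_contL2)

lemma contL2_w: assumes "0 < h" shows "contL2 M S (w h)"
proof -
  have "contL2 M S (\<lambda>t x. (1 / h) * (u t x - V h (x, t)))"
    by (intro contL2_scale contL2_diff u_contL2 contL2_V assms continuous_intros)
  then show ?thesis by (simp add: w_def[abs_def])
qed

lemma W_represents: "represents M S (W h) (w h)"
  using U_represents unfolding represents_def by eventually_elim (auto simp: W_def w_def)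

lemma sqint_V: "0 < h \<Longrightarrow> t \<in> {0..S} \<Longrightarrow> sqint M (\<lambda>x. V h (x, t))"
  using contL2_sqint[OF contL2_V] by simp

lemma sqint_w: "0 < h \<Longrightarrow> t \<in> {0..S} \<Longrightarrow> sqint M (w h t)"
  using contL2_sqint[OF contL2_w] by simp

lemma weak_dt_V:
  assumes h: "0 < h" and T: "0 < T" "T \<le> S"
  shows "weak_dt_L2 \<Omega> T (\<lambda>t x. V h (x, t)) (\<lambda>t x. W h (x, t))"
proof (rule weak_dt_L2_of_derivative[OF open_\<Omega> bounded_\<Omega> T(1) V_borel represents_self W_borel
      represents_subset[OF W_represents T(2)] contL2_subset[OF contL2_w[OF h] T(2)]])
  fix t assume "t \<in> {0..T}"
  then show "has_L2_derivative M (\<lambda>t x. V h (x, t)) (w h t) t {0..T}"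
    using T by (intro has_L2_derivative_subset[OF has_L2_derivative_V[OF h]]) auto
qed

lemma slab_integral_W_square:
  assumes h: "0 < h" and T: "T \<le> S"
  shows "set_integrable lebesgue (\<Omega> \<times> {0<..<T}) (\<lambda>z. (W h z)\<^sup>2)"
    and "(LINT z:\<Omega> \<times> {0<..<T}|lebesgue. (W h z)\<^sup>2) = energy h T"
  using slab_integral_mult[OF open_\<Omega> W_borel W_borel represents_subset[OF W_represents T]
      represents_subset[OF W_represents T] contL2_subset[OF contL2_w[OF h] T] contL2_subset[OF contL2_w[OF h] T]]
  by (simp_all add: power2_eq_square energy_def sqn_def)

text \<open>Only the pairing with a fixed \<open>g\<close> is integrated, so the real fundamental
  theorem of calculus applies; the increment of \<open>V\<close> itself is later inserted for
  \<open>g\<close>.\<close>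

lemma V_diff_integral:
  assumes h: "0 < h" and ab: "0 \<le> a" "a \<le> b" "b \<le> S" and g: "sqint M g"
  shows "((\<lambda>t. \<integral>x. w h t x * g x \<partial>M) has_integral (\<integral>x. (V h (x, b) - V h (x, a)) * g x \<partial>M)) {a..b}"
proof -
  have "((\<lambda>t. \<integral>x. w h t x * g x \<partial>M) has_integral
     (\<integral>x. V h (x, b) * g x \<partial>M) - (\<integral>x. V h (x, a) * g x \<partial>M)) {a..b}"
  proof (rule fundamental_theorem_of_calculus[OF ab(2)])
    fix t assume t: "t \<in> {a..b}"
    have "has_L2_derivative M (\<lambda>t x. V h (x, t)) (w h t) t {a..b}"
      using t ab by (intro has_L2_derivative_subset[OF has_L2_derivative_V[OF h]]) auto
    from has_L2_derivative_inner[OF this has_L2_derivative_const[OF g]]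
    show "((\<lambda>t. \<integral>x. V h (x, t) * g x \<partial>M) has_vector_derivative (\<integral>x. w h t x * g x \<partial>M)) (at t within {a..b})"
      by (simp add: has_real_derivative_iff_has_vector_derivative)
  qed
  moreover have "(\<integral>x. V h (x, b) * g x \<partial>M) - (\<integral>x. V h (x, a) * g x \<partial>M) = (\<integral>x. (V h (x, b) - V h (x, a)) * g x \<partial>M)"
    unfolding left_diff_distrib
    using ab by (intro Bochner_Integration.integral_diff[symmetric] sqint_integrable_mult sqint_V h g) auto
  ultimately show ?thesis by simp
qed

lemma continuous_sqn_w: "0 < h \<Longrightarrow> continuous_on {0..S} (\<lambda>t. sqn M (w h t))"
  by (rule contL2_sqn[OF contL2_w])

lemma energy_nonneg:
  assumes "0 < h" "T \<le> S"
  shows "0 \<le> energy h T"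
  unfolding energy_def
  by (rule Henstock_Kurzweil_Integration.integral_nonneg)
    (use assms in \<open>auto intro!: integrable_continuous_real continuous_on_subset[OF continuous_sqn_w]\<close>)

lemma energy_mono:
  assumes "0 < h" "0 \<le> a" "b \<le> S"
  shows "integral {a..b} (\<lambda>t. sqn M (w h t)) \<le> energy h S"
  unfolding energy_def
  by (rule integral_subset_le)
    (use assms in \<open>auto intro!: integrable_continuous_real continuous_on_subset[OF continuous_sqn_w]\<close>)

text \<open>With \<open>z\<close> the increment and \<open>c = b - a\<close>, Young's inequality
  bounds the pairing of \<open>w h t\<close> and \<open>z\<close> by
  \<open>c / 2 * sqn M (w h t) + 1 / (2 * c) * sqn M z\<close>. The last term integrates to half of
  \<open>sqn M z\<close> and is absorbed on the left. The remaining factor \<open>b - a\<close> is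
  the source of the Hoelder exponent 1/2.\<close>

lemma V_increment_le:
  assumes h: "0 < h" and ab: "0 \<le> a" "a \<le> b" "b \<le> S"
  shows "sqn M (\<lambda>x. V h (x, b) - V h (x, a)) \<le> (b - a) * energy h S"
proof (cases "a = b")
  case True
  then show ?thesis by (simp add: sqn_def)
next
  case False
  define z where "z x = V h (x, b) - V h (x, a)" for x
  define c where "c = b - a"
  have c: "0 < c" using False ab by (simp add: c_def)
  have z: "sqint M z" unfolding z_def using ab by (intro sqint_diff sqint_V h) auto
  have "(\<integral>x. z x * z x \<partial>M) \<le> integral {a..b} (\<lambda>t. c / 2 * sqn M (w h t) + 1 / (2 * c) * sqn M z)"
  proof (rule has_integral_le[OF V_diff_integral[OF h ab z, folded z_def] integrable_integral])
    show "(\<lambda>t. c / 2 * sqn M (w h t) + 1 / (2 * c) * sqn M z) integrable_on {a..b}"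
      using ab by (intro integrable_continuous_real continuous_intros continuous_on_subset[OF continuous_sqn_w[OF h]]) auto
    fix t assume "t \<in> {a..b}"
    then have wt: "sqint M (w h t)" using ab by (intro sqint_w h) auto
    have "0 \<le> sqn M (\<lambda>x. z x + (- c) * w h t x)" by simp
    also have "\<dots> = sqn M z - 2 * c * (\<integral>x. w h t x * z x \<partial>M) + c\<^sup>2 * sqn M (w h t)"
      unfolding sqn_add_scaled[OF z wt] by (simp add: mult.commute[of "z _"])
    finally have "(2 * c) * (\<integral>x. w h t x * z x \<partial>M) \<le> (2 * c) * (c / 2 * sqn M (w h t) + 1 / (2 * c) * sqn M z)"
      using c by (simp add: distrib_left power2_eq_square)
    then show "(\<integral>x. w h t x * z x \<partial>M) \<le> c / 2 * sqn M (w h t) + 1 / (2 * c) * sqn M z"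
      using c by (simp only: mult_le_cancel_left_pos)
  qed
  also have "\<dots> = c / 2 * integral {a..b} (\<lambda>t. sqn M (w h t)) + integral {a..b} (\<lambda>t. 1 / (2 * c) * sqn M z)"
  proof -
    have "(\<lambda>t. sqn M (w h t)) integrable_on {a..b}"
      using ab by (intro integrable_continuous_real continuous_on_subset[OF continuous_sqn_w[OF h]]) auto
    then show ?thesis
      by (subst Henstock_Kurzweil_Integration.integral_add) (auto intro: integrable_on_mult_right)
  qed
  also have "\<dots> = c / 2 * integral {a..b} (\<lambda>t. sqn M (w h t)) + sqn M z / 2"
  proof -
    have "integral {a..b} (\<lambda>t. k) = c * k" for k :: real using ab by (simp add: c_def)
    then have "integral {a..b} (\<lambda>t. 1 / (2 * c) * sqn M z) = c * (1 / (2 * c) * sqn M z)" .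
    also have "\<dots> = sqn M z / 2" using c by simp
    finally show ?thesis by (simp only:)
  qed
  also have "\<dots> \<le> c / 2 * energy h S + sqn M z / 2"
    using c energy_mono[OF h ab(1,3)] by simp
  finally show ?thesis by (simp add: z_def sqn_def power2_eq_square c_def)
qed

text \<open>Monotonicity of the Yosida approximation of the time derivative: \<open>V \<lambda> + \<lambda> * w \<lambda> = V \<mu> + \<mu> * w \<mu>\<close>,
  so the derivative of the squared norm of \<open>V \<lambda> - V \<mu>\<close> is the inner product of \<open>\<mu> * w \<mu> - \<lambda> * w \<lambda>\<close> and \<open>w \<lambda> - w \<mu>\<close>, up to a factor 2.\<close>

lemma energy_diff_le:
  assumes l: "0 < l" and m: "l \<le> m"
  shows "integral {0..S} (\<lambda>t. sqn M (\<lambda>x. w l t x - w m t x)) \<le> energy l S - energy m S"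
proof -
  have m_pos: "0 < m" using l m by simp
  define D where "D t x = V l (x, t) - V m (x, t)" for t x
  have D: "has_L2_derivative M D (\<lambda>x. w l t x - w m t x) t {0..S}" if "t \<in> {0..S}" for t
    unfolding D_def using that by (intro has_L2_derivative_diff has_L2_derivative_V l m_pos)
  define d where "d t = sqn M (\<lambda>x. w l t x - w m t x)" for t
  have "((\<lambda>t. 2 * (\<integral>x. (w l t x - w m t x) * D t x \<partial>M)) has_integral sqn M (D S) - sqn M (D 0)) {0..S}"
    using S_pos has_L2_derivative_sqn[OF D]
    by (intro fundamental_theorem_of_calculus) (auto simp: has_real_derivative_iff_has_vector_derivative)
  \<comment> \<open>\<open>D\<close> equals \<open>m * w m - l * w l\<close>, and the mixed inner
    product is eliminated in favour of \<open>d\<close>, the squared distance of \<open>w l\<close>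
    and \<open>w m\<close>.\<close>
  moreover have eq: "2 * (\<integral>x. (w l t x - w m t x) * D t x \<partial>M)
      = (m - l) * (sqn M (w l t) - sqn M (w m t)) - (m + l) * d t" if t: "t \<in> {0..S}" for t
  proof -
    have a: "sqint M (w l t)" and b: "sqint M (w m t)" using sqint_w l m_pos t by auto
    have D_eq: "D t x = m * w m t x - l * w l t x" for x
      using l m_pos by (simp add: D_def w_def)
    have "(\<integral>x. (w l t x - w m t x) * D t x \<partial>M)
      = (\<integral>x. (m + l) * (w l t x * w m t x) - m * (w m t x)\<^sup>2 - l * (w l t x)\<^sup>2 \<partial>M)"
      unfolding D_eq by (intro Bochner_Integration.integral_cong) (auto simp: power2_eq_square algebra_simps)
    also have "\<dots> = (m + l) * (\<integral>x. w l t x * w m t x \<partial>M) - m * sqn M (w m t) - l * sqn M (w l t)"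
      using sqint_integrable_mult[OF a b] a b by (simp add: sqint_def sqn_def)
    finally have 1: "(\<integral>x. (w l t x - w m t x) * D t x \<partial>M)
        = (m + l) * (\<integral>x. w l t x * w m t x \<partial>M) - m * sqn M (w m t) - l * sqn M (w l t)" .
    show ?thesis unfolding 1 d_def sqn_diff[OF a b] by (simp add: algebra_simps)
  qed
  ultimately have int: "((\<lambda>t. (m - l) * (sqn M (w l t) - sqn M (w m t)) - (m + l) * d t) has_integral sqn M (D S) - sqn M (D 0)) {0..S}"
    by (rule has_integral_eq[rotated])
  have i1: "(\<lambda>t. sqn M (w l t)) integrable_on {0..S}" and i2: "(\<lambda>t. sqn M (w m t)) integrable_on {0..S}"
    and i3: "d integrable_on {0..S}"
    unfolding d_def using l m_pos
    by (intro integrable_continuous_real continuous_sqn_w contL2_sqn contL2_diff contL2_w; simp)+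
  have "((\<lambda>t. (m - l) * (sqn M (w l t) - sqn M (w m t)) - (m + l) * d t) has_integral
      (m - l) * (energy l S - energy m S) - (m + l) * integral {0..S} d) {0..S}"
    unfolding energy_def by (intro has_integral_diff has_integral_mult_right integrable_integral i1 i2 i3)
  from has_integral_unique[OF this int]
  have "(m - l) * (energy l S - energy m S) - (m + l) * integral {0..S} d = sqn M (D S) - sqn M (D 0)" .
  \<comment> \<open>Both mollifications start from \<open>U0\<close>, so no initial term
    survives.\<close>
  moreover have "sqn M (D 0) = 0" by (simp add: D_def V_0 sqn_def)
  ultimately have le: "(m + l) * integral {0..S} d \<le> (m - l) * (energy l S - energy m S)"
    using sqn_nonneg[of M "D S"] by linarith
  have d_nonneg: "0 \<le> integral {0..S} d"
    by (rule Henstock_Kurzweil_Integration.integral_nonneg[OF i3]) (simp add: d_def)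
  have "integral {0..S} d \<le> energy l S - energy m S"
  \<comment> \<open>For \<open>l \<noteq> m\<close> the factor \<open>m + l\<close> is lowered to
    \<open>m - l\<close> and cancelled; for \<open>l = m\<close> this factor would be 0, but then
    both sides vanish.\<close>
  proof (cases "l = m")
    case True
    then have "d = (\<lambda>_. 0)" by (simp add: d_def[abs_def] sqn_def)
    with True show ?thesis by simp
  next
    case False
    have "(m - l) * integral {0..S} d \<le> (m + l) * integral {0..S} d"
      using l d_nonneg by (intro mult_right_mono) auto
    also note le
    finally show ?thesis using False m by simp
  qed
  then show ?thesis unfolding d_def[abs_def] .
qed

end

text \<open>Meant for \<open>K\<close>, whose linearity holds only almost everywhere.\<close>

lemma L2lim_cong_AE:
  assumes "L2lim M F f l"
    and ev: "\<forall>\<^sub>F s in F. g s \<in> borel_measurable M \<and> (AE x in M. f s x = g s x)"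
  shows "L2lim M F g l"
  unfolding L2lim_def
proof (intro conjI)
  show l: "sqint M l" using assms(1) by (simp add: L2lim_def)
  have f: "\<forall>\<^sub>F s in F. sqint M (f s)" using assms(1) by (simp add: L2lim_def)
  then show "\<forall>\<^sub>F s in F. sqint M (g s)"
    using ev by eventually_elim (auto intro: sqint_cong_AE)
  have "\<forall>\<^sub>F s in F. sqn M (\<lambda>x. f s x - l x) = sqn M (\<lambda>x. g s x - l x)"
    using f ev
  proof eventually_elim
    case (elim s)
    then have [measurable]: "f s \<in> borel_measurable M" "g s \<in> borel_measurable M" "l \<in> borel_measurable M"
      using l sqint_measurable by auto
    show ?case by (rule sqn_cong_AE) (use elim in auto)
  qed
  moreover have "((\<lambda>s. sqn M (\<lambda>x. f s x - l x)) \<longlongrightarrow> 0) F" using assms(1) by (simp add: L2lim_def)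
  ultimately show "((\<lambda>s. sqn M (\<lambda>x. g s x - l x)) \<longlongrightarrow> 0) F" by (rule Lim_transform_eventually[rotated])
qed

lemma nn_integral_continuous_Icc:
  fixes f :: "real \<Rightarrow> real"
  assumes "continuous_on {a..b} f" "\<And>t. t \<in> {a..b} \<Longrightarrow> 0 \<le> f t"
  shows "(\<integral>\<^sup>+t. ennreal (f t) * indicator {a..b} t \<partial>lborel) = ennreal (integral {a..b} f)"
proof -
  have int: "set_integrable lborel {a..b} f" by (rule borel_integrable_atLeastAtMost'[OF assms(1)])
  have "(\<integral>\<^sup>+t. ennreal (f t) * indicator {a..b} t \<partial>lborel) = (\<integral>\<^sup>+t. ennreal (indicator {a..b} t *\<^sub>R f t) \<partial>lborel)"
    by (intro nn_integral_cong) (simp add: indicator_def)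
  also have "\<dots> = ennreal (LINT t:{a..b}|lborel. f t)"
    unfolding set_lebesgue_integral_def using int assms(2)
    by (intro nn_integral_eq_integral) (auto simp: set_integrable_def indicator_def)
  also have "(LINT t:{a..b}|lborel. f t) = integral {a..b} f"
    using set_borel_integral_eq_integral(2)[OF int] .
  finally show ?thesis .
qed

section \<open>The operator \<open>K\<close> as a bounded linear map on L2\<close>

lemma sqint_one: "finite_measure M \<Longrightarrow> sqint M (\<lambda>_. 1)"
  by (simp add: sqint_def finite_measure.integrable_const)

lemma sqint_imp_integrable:
  assumes "finite_measure M" "sqint M f"
  shows "integrable M f"
  using sqint_integrable_mult[OF assms(2) sqint_one[OF assms(1)]] by simp

locale deblurring =
  fixes \<Omega> :: "'a::euclidean_space set" and K :: "('a \<Rightarrow> real) \<Rightarrow> ('a \<Rightarrow> real)"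
  assumes domain_open: "open \<Omega>" and domain_bounded: "bounded \<Omega>" and K: "deblur_operator \<Omega> K"
begin

lemma sqint_imp_L1: "sqint (lebesgue_on \<Omega>) f \<Longrightarrow> L1 \<Omega> f"
  unfolding L1_def set_integrable_lebesgue_on[OF domain_open]
  by (rule sqint_imp_integrable[OF finite_measure_lebesgue_on_bounded_open[OF domain_open domain_bounded]])

lemma sqint_K: "sqint (lebesgue_on \<Omega>) f \<Longrightarrow> sqint (lebesgue_on \<Omega>) (K f)"
  using K sqint_imp_L1 unfolding deblur_operator_def L2_iff_sqint[OF domain_open] by blast

lemma K_cong_AE:
  assumes "sqint (lebesgue_on \<Omega>) f" "sqint (lebesgue_on \<Omega>) g" "AE x in lebesgue_on \<Omega>. f x = g x"
  shows "AE x in lebesgue_on \<Omega>. K f x = K g x"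
  using K assms sqint_imp_L1 unfolding deblur_operator_def AE_lebesgue_on_iff[OF domain_open] by blast

lemma K_linear:
  assumes "sqint (lebesgue_on \<Omega>) f" "sqint (lebesgue_on \<Omega>) g"
  shows "AE x in lebesgue_on \<Omega>. K (\<lambda>y. a * f y + b * g y) x = a * K f x + b * K g x"
  using K assms sqint_imp_L1 unfolding deblur_operator_def AE_lebesgue_on_iff[OF domain_open] by blast

text \<open>The bound from L1 to L2 becomes one on L2, since Cauchy-Schwarz against the constant 1
  controls the L1 norm on a set of finite measure.\<close>

lemma K_bounded:
  obtains C where "0 \<le> C" "\<And>f. sqint (lebesgue_on \<Omega>) f \<Longrightarrow> sqn (lebesgue_on \<Omega>) (K f) \<le> C * sqn (lebesgue_on \<Omega>) f"
proof -
  let ?M = "lebesgue_on \<Omega>"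
  obtain C where C: "\<And>f. L1 \<Omega> f \<Longrightarrow> sqrt (L2sq \<Omega> (K f)) \<le> C * (LINT x:\<Omega>|lebesgue. \<bar>f x\<bar>)"
    using K unfolding deblur_operator_def by blast
  note fin = finite_measure_lebesgue_on_bounded_open[OF domain_open domain_bounded]
  have "sqn ?M (K f) \<le> C\<^sup>2 * sqn ?M (\<lambda>_. 1) * sqn ?M f" if f: "sqint ?M f" for f
  proof -
    define I where "I = (\<integral>x. \<bar>f x\<bar> * 1 \<partial>?M)"
    have abs_f: "sqint ?M (\<lambda>x. \<bar>f x\<bar>)" using f by (auto simp: sqint_def)
    have "sqrt (sqn ?M (K f)) \<le> C * I"
      using C[OF sqint_imp_L1[OF f]] by (simp add: L2sq_eq_sqn[OF domain_open] set_integral_lebesgue_on[OF domain_open] I_def)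
    then have "(sqrt (sqn ?M (K f)))\<^sup>2 \<le> (C * I)\<^sup>2" by (intro power_mono) auto
    then have "sqn ?M (K f) \<le> C\<^sup>2 * I\<^sup>2" by (simp add: power_mult_distrib)
    also have "\<dots> \<le> C\<^sup>2 * (sqn ?M (\<lambda>x. \<bar>f x\<bar>) * sqn ?M (\<lambda>_. 1))"
      unfolding I_def by (intro mult_left_mono Cauchy_Schwarz_sqn abs_f sqint_one fin) simp
    finally show ?thesis by (simp add: sqn_def mult_ac)
  qed
  moreover have "0 \<le> C\<^sup>2 * sqn ?M (\<lambda>_. 1)" by (intro mult_nonneg_nonneg) auto
  ultimately show ?thesis using that by blast
qed

lemma L2lim_K:
  assumes "L2lim (lebesgue_on \<Omega>) F f l"
  shows "L2lim (lebesgue_on \<Omega>) F (\<lambda>s. K (f s)) (K l)"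
  unfolding L2lim_def
proof (intro conjI)
  let ?M = "lebesgue_on \<Omega>"
  have l: "sqint ?M l" and ev: "\<forall>\<^sub>F s in F. sqint ?M (f s)"
    and lim: "((\<lambda>s. sqn ?M (\<lambda>x. f s x - l x)) \<longlongrightarrow> 0) F"
    using assms by (auto simp: L2lim_def)
  show "sqint ?M (K l)" by (rule sqint_K[OF l])
  show "\<forall>\<^sub>F s in F. sqint ?M (K (f s))" using ev by eventually_elim (rule sqint_K)
  obtain C where C: "0 \<le> C" "\<And>f. sqint ?M f \<Longrightarrow> sqn ?M (K f) \<le> C * sqn ?M f"
    using K_bounded by blast
  have lim': "((\<lambda>s. C * sqn ?M (\<lambda>x. f s x - l x)) \<longlongrightarrow> 0) F"
    using tendsto_mult_right_zero[OF lim] .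
  show "((\<lambda>s. sqn ?M (\<lambda>x. K (f s) x - K l x)) \<longlongrightarrow> 0) F"
  proof (rule tendsto_sandwich[OF _ _ tendsto_const lim'])
    show "\<forall>\<^sub>F s in F. sqn ?M (\<lambda>x. K (f s) x - K l x) \<le> C * sqn ?M (\<lambda>x. f s x - l x)"
      using ev
    proof eventually_elim
      case (elim s)
      have d: "sqint ?M (\<lambda>x. 1 * f s x + (-1) * l x)" using sqint_diff[OF elim l] by simp
      have "sqn ?M (\<lambda>x. K (f s) x - K l x) = sqn ?M (K (\<lambda>x. 1 * f s x + (-1) * l x))"
      proof (rule sqn_cong_AE)
        show "AE x in ?M. K (f s) x - K l x = K (\<lambda>x. 1 * f s x + (-1) * l x) x"
          using K_linear[OF elim l, of 1 "-1"] by eventually_elim simp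
        show "(\<lambda>x. K (f s) x - K l x) \<in> borel_measurable ?M"
          by (intro sqint_measurable sqint_diff sqint_K elim l)
        show "K (\<lambda>x. 1 * f s x + (-1) * l x) \<in> borel_measurable ?M"
          by (intro sqint_measurable sqint_K d)
      qed
      also have "\<dots> \<le> C * sqn ?M (\<lambda>x. f s x - l x)"
        using C(2)[OF d] by simp
      finally show ?case .
    qed
  qed simp
qed

lemma contL2_K: "contL2 (lebesgue_on \<Omega>) T v \<Longrightarrow> contL2 (lebesgue_on \<Omega>) T (\<lambda>t. K (v t))"
  by (auto simp: contL2_def intro: L2lim_K)

lemma has_L2_derivative_K:
  assumes "has_L2_derivative (lebesgue_on \<Omega>) v d t S"
  shows "has_L2_derivative (lebesgue_on \<Omega>) (\<lambda>s. K (v s)) (K d) t S"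
  unfolding has_L2_derivative_def
proof
  let ?M = "lebesgue_on \<Omega>"
  have vt: "sqint ?M (v t)" using assms by (simp add: has_L2_derivative_def)
  then show "sqint ?M (K (v t))" by (rule sqint_K)
  have "L2lim ?M (at t within S) (\<lambda>s. K (\<lambda>x. (v s x - v t x) / (s - t))) (K d)"
    using assms by (intro L2lim_K) (simp add: has_L2_derivative_def)
  then show "L2lim ?M (at t within S) (\<lambda>s x. (K (v s) x - K (v t) x) / (s - t)) (K d)"
  proof (rule L2lim_cong_AE)
    have "\<forall>\<^sub>F s in at t within S. sqint ?M (v s)"
      using has_L2_derivative_continuous[OF assms] by (simp add: L2lim_def)
    then show "\<forall>\<^sub>F s in at t within S. (\<lambda>x. (K (v s) x - K (v t) x) / (s - t)) \<in> borel_measurable ?M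
        \<and> (AE x in ?M. K (\<lambda>x. (v s x - v t x) / (s - t)) x = (K (v s) x - K (v t) x) / (s - t))"
    proof eventually_elim
      case (elim s)
      have "(\<lambda>x. (K (v s) x - K (v t) x) / (s - t)) \<in> borel_measurable ?M"
        using sqint_measurable[OF sqint_K[OF elim]] sqint_measurable[OF sqint_K[OF vt]] by measurable
      moreover have "AE x in ?M. K (\<lambda>x. (v s x - v t x) / (s - t)) x = (K (v s) x - K (v t) x) / (s - t)"
      proof -
        have eq: "(\<lambda>x. (v s x - v t x) / (s - t)) = (\<lambda>x. 1 / (s - t) * v s x + - (1 / (s - t)) * v t x)"
          by (simp add: diff_divide_distrib)
        show ?thesis
          unfolding eq using K_linear[OF elim vt, of "1 / (s - t)" "- (1 / (s - t))"]
          by eventually_elim (simp add: diff_divide_distrib)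
      qed
      ultimately show ?case by blast
    qed
  qed
qed

end

section \<open>Convexity of the functional along the mollification\<close>

context time_mollification
begin

text \<open>Let \<open>X\<close> and \<open>Y\<close> be the residuals of \<open>u t\<close> and of
  the mollification. Since \<open>h * K (w h t)\<close> is \<open>X - Y\<close> almost everywhere,
  \<open>h\<close> times the time derivative of \<open>sqn M Y\<close> is twice the inner product of
  \<open>X - Y\<close> and \<open>Y\<close>, hence at most \<open>sqn M X - sqn M Y\<close>.
  Integrated in time, this is the convexity of the fidelity in differential form.\<close>

lemma fidelity_V_le:
  assumes K: "deblur_operator \<Omega> K" and h: "0 < h" and T: "0 < T" "T \<le> S" and f: "sqint M f"
  shows "h * (sqn M (\<lambda>x. K (\<lambda>x. V h (x, T)) x - f x) - sqn M (\<lambda>x. K U0 x - f x))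
      + integral {0..T} (\<lambda>t. sqn M (\<lambda>x. K (\<lambda>x. V h (x, t)) x - f x))
    \<le> integral {0..T} (\<lambda>t. sqn M (\<lambda>x. K (u t) x - f x))"
proof -
  interpret deblurring \<Omega> K by unfold_locales (rule open_\<Omega> bounded_\<Omega> K)+
  define a where "a t = sqn M (\<lambda>x. K (\<lambda>x. V h (x, t)) x - f x)" for t
  define G where "G t = sqn M (\<lambda>x. K (u t) x - f x)" for t
  define a' where "a' t = 2 * (\<integral>x. K (w h t) x * (K (\<lambda>x. V h (x, t)) x - f x) \<partial>M)" for t
  have deriv: "(a has_real_derivative a' t) (at t within {0..T})" if t: "t \<in> {0..T}" for t
  proof -
    have "has_L2_derivative M (\<lambda>t x. V h (x, t)) (w h t) t {0..T}"
      using t T by (intro has_L2_derivative_subset[OF has_L2_derivative_V[OF h]]) auto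
    from has_L2_derivative_diff[OF has_L2_derivative_K[OF this] has_L2_derivative_const[OF f]]
    have "has_L2_derivative M (\<lambda>t x. K (\<lambda>x. V h (x, t)) x - f x) (K (w h t)) t {0..T}" by simp
    from has_L2_derivative_sqn[OF this] show ?thesis by (simp add: a_def[abs_def] a'_def)
  qed
  have "(a' has_integral a T - a 0) {0..T}"
    using T deriv by (intro fundamental_theorem_of_calculus) (auto simp: has_real_derivative_iff_has_vector_derivative)
  then have int1: "((\<lambda>t. h * a' t) has_integral h * (a T - a 0)) {0..T}" by (rule has_integral_mult_right)
  have cont: "continuous_on {0..T} a" "continuous_on {0..T} G"
    unfolding a_def G_def
    by (intro contL2_sqn contL2_diff contL2_K contL2_const f contL2_subset[OF contL2_V[OF h] T(2)]
        contL2_subset[OF u_contL2 T(2)])+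
  then have int2: "((\<lambda>t. G t - a t) has_integral integral {0..T} G - integral {0..T} a) {0..T}"
    by (intro has_integral_diff integrable_integral integrable_continuous_real)
  have "h * (a T - a 0) \<le> integral {0..T} G - integral {0..T} a"
  proof (rule has_integral_le[OF int1 int2])
    fix t assume t: "t \<in> {0..T}"
    then have tS: "t \<in> {0..S}" using T by auto
    have ut: "sqint M (u t)" using contL2_sqint[OF u_contL2 tS] .
    have vt: "sqint M (\<lambda>x. V h (x, t))" using sqint_V[OF h tS] .
    define X where "X x = K (u t) x - f x" for x
    define Y where "Y x = K (\<lambda>x. V h (x, t)) x - f x" for x
    have X: "sqint M X" and Y: "sqint M Y"
      unfolding X_def Y_def by (intro sqint_diff sqint_K ut vt f)+
    have "AE x in M. K (w h t) x * Y x = (1 / h) * (X x * Y x - Y x * Y x)"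
    proof -
      have eq: "w h t = (\<lambda>x. 1 / h * u t x + - (1 / h) * V h (x, t))"
        by (simp add: w_def fun_eq_iff diff_divide_distrib)
      show ?thesis
        unfolding eq using K_linear[OF ut vt, of "1 / h" "- (1 / h)"]
      proof eventually_elim
        case (elim x)
        show ?case unfolding elim X_def Y_def by (simp add: algebra_simps)
      qed
    qed
    moreover note [measurable] = sqint_measurable[OF X] sqint_measurable[OF Y]
      sqint_measurable[OF sqint_K[OF sqint_w[OF h tS]]]
    ultimately have "(\<integral>x. K (w h t) x * Y x \<partial>M) = (\<integral>x. (1 / h) * (X x * Y x - Y x * Y x) \<partial>M)"
      by (intro integral_cong_AE) measurable
    also have "\<dots> = (1 / h) * ((\<integral>x. X x * Y x \<partial>M) - sqn M Y)"
      using sqint_integrable_mult[OF X Y] sqint_integrable_mult[OF Y Y] by (simp add: sqn_def power2_eq_square)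
    finally have "h * a' t = 2 * ((\<integral>x. X x * Y x \<partial>M) - sqn M Y)"
      using h by (simp add: a'_def Y_def[symmetric])
    moreover have "0 \<le> sqn M (\<lambda>x. X x - Y x)" by simp
    then have "2 * (\<integral>x. X x * Y x \<partial>M) \<le> sqn M X + sqn M Y" unfolding sqn_diff[OF X Y] by simp
    ultimately show "h * a' t \<le> G t - a t"
      by (simp add: G_def a_def X_def[abs_def, symmetric] Y_def[abs_def, symmetric])
  qed
  then show ?thesis by (simp add: a_def[abs_def] G_def[abs_def] V_0)
qed

text \<open>The weights are those of the mollification, with total mass 1 for
  \<open>0 \<le> t\<close>, so this is the mollified variation. The indicator of
  \<open>{0..S}\<close> restricts to times where the variation of \<open>u\<close> is known to be
  measurable.\<close>

definition TV_average :: "real \<Rightarrow> real \<Rightarrow> real \<Rightarrow> ennreal" where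
  "TV_average \<alpha> h t = ennreal (exp (- t / h)) * TVR \<Omega> \<alpha> U0
     + (\<integral>\<^sup>+s. ennreal (exp ((s - t) / h) / h) * indicator {0..t} s * (TVR \<Omega> \<alpha> (u s) * indicator {0..S} s) \<partial>lborel)"

text \<open>For a single field \<open>\<Psi>\<close> the pairing \<open>l\<close> solves
  \<open>h * l' + l = L\<close>, so \<open>l t\<close> is the same exponential average of the
  pairings with \<open>u\<close>, each at most the variation; the supremum over
  \<open>\<Psi>\<close> is taken last. This is Jensen's inequality for a supremum of linear
  functionals.\<close>

lemma TVR_V_le:
  assumes \<alpha>: "0 < \<alpha>" "\<alpha> < 1" and h: "0 < h" and t: "t \<in> {0..S}"
  shows "TVR \<Omega> \<alpha> (\<lambda>x. V h (x, t)) \<le> TV_average \<alpha> h t"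
  unfolding TVR_eq_SUP_lebesgue_on[OF open_\<Omega>, of _ "\<lambda>x. V h (x, t)"]
proof (rule SUP_least)
  fix \<Psi> :: "'a \<Rightarrow> 'a" assume \<Psi>: "\<Psi> \<in> unit_fields"
  then have fd: "sqint M (frac_div \<alpha> \<Psi>)"
    by (intro sqint_frac_div[OF open_\<Omega> bounded_\<Omega> \<alpha>]) (simp add: unit_fields_def)
  define l where "l s = (\<integral>x. V h (x, s) * frac_div \<alpha> \<Psi> x \<partial>M)" for s
  define L where "L s = (\<integral>x. u s x * frac_div \<alpha> \<Psi> x \<partial>M)" for s
  have cont_L: "continuous_on {0..S} L"
    unfolding L_def by (rule contL2_inner[OF u_contL2 contL2_const[OF fd]])
  \<comment> \<open>The integrating factor \<open>exp (s / h)\<close> turns the equation for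
    \<open>l\<close> into an exact derivative.\<close>
  have "((\<lambda>s. exp (s / h) * (L s / h)) has_integral exp (t / h) * l t - exp (0 / h) * l 0) {0..t}"
  proof (rule fundamental_theorem_of_calculus)
    fix s assume "s \<in> {0..t}"
    then have s: "s \<in> {0..S}" using t by auto
    have "has_L2_derivative M (\<lambda>t x. V h (x, t)) (w h s) s {0..t}"
      using t by (intro has_L2_derivative_subset[OF has_L2_derivative_V[OF h s]]) auto
    from has_L2_derivative_inner[OF this has_L2_derivative_const[OF fd]]
    have "(l has_real_derivative (\<integral>x. w h s x * frac_div \<alpha> \<Psi> x \<partial>M)) (at s within {0..t})"
      by (simp add: l_def[abs_def])
    moreover have "(\<integral>x. w h s x * frac_div \<alpha> \<Psi> x \<partial>M) = (L s - l s) / h"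
      using sqint_integrable_mult[OF contL2_sqint[OF u_contL2 s] fd] sqint_integrable_mult[OF sqint_V[OF h s] fd]
      by (simp add: w_def L_def l_def diff_divide_distrib left_diff_distrib)
    ultimately have l': "(l has_real_derivative (L s - l s) / h) (at s within {0..t})" by simp
    have "((\<lambda>s. exp (s / h)) has_real_derivative exp (s / h) * (1 / h)) (at s within {0..t})"
      using h by (auto intro!: derivative_eq_intros)
    note DERIV_mult[OF this l']
    moreover have "exp (s / h) * (1 / h) * l s + (L s - l s) / h * exp (s / h) = exp (s / h) * (L s / h)"
      using h by (simp add: field_simps)
    ultimately show "((\<lambda>s. exp (s / h) * l s) has_vector_derivative exp (s / h) * (L s / h)) (at s within {0..t})"
      by (simp add: has_real_derivative_iff_has_vector_derivative)
  qed (use t in simp)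
  from has_integral_mult_right[OF this, of "exp (- t / h)"]
  have int: "((\<lambda>s. exp (- t / h) * (exp (s / h) * (L s / h))) has_integral l t - exp (- t / h) * l 0) {0..t}"
    by (simp add: right_diff_distrib mult.assoc[symmetric] exp_add[symmetric])
  \<comment> \<open>Positive parts lose nothing, because \<open>ennreal\<close> truncates at 0; they
    make the integrand nonnegative, as the passage to extended integrals requires.\<close>
  define m where "m s = exp ((s - t) / h) / h * max 0 (L s)" for s
  have cont_m: "continuous_on {0..t} m"
    unfolding m_def using t h by (intro continuous_intros continuous_on_subset[OF cont_L]) auto
  have "l t - exp (- t / h) * l 0 \<le> integral {0..t} m"
  proof (rule has_integral_le[OF int integrable_integral[OF integrable_continuous_real[OF cont_m]]])
    fix s
    have "exp (- t / h) * (exp (s / h) * (L s / h)) = exp ((s - t) / h) / h * L s"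
      by (simp add: exp_add[symmetric] diff_divide_distrib mult.assoc[symmetric])
    also have "\<dots> \<le> m s" unfolding m_def using h by (intro mult_left_mono) auto
    finally show "exp (- t / h) * (exp (s / h) * (L s / h)) \<le> m s" .
  qed
  moreover have "exp (- t / h) * l 0 \<le> exp (- t / h) * max 0 (l 0)" by (intro mult_left_mono) auto
  ultimately have "l t \<le> exp (- t / h) * max 0 (l 0) + integral {0..t} m" by linarith
  then have "ennreal (l t) \<le> ennreal (exp (- t / h) * max 0 (l 0) + integral {0..t} m)"
    by (rule ennreal_leI)
  also have "\<dots> = ennreal (exp (- t / h)) * ennreal (l 0) + ennreal (integral {0..t} m)"
  proof -
    have "0 \<le> integral {0..t} m"
      using h by (intro Henstock_Kurzweil_Integration.integral_nonneg integrable_continuous_real cont_m) (simp add: m_def)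
    moreover have "ennreal (max 0 (l 0)) = ennreal (l 0)" by (simp add: max_def ennreal_neg)
    ultimately show ?thesis by (simp add: ennreal_mult)
  qed
  also have "ennreal (integral {0..t} m) = (\<integral>\<^sup>+s. ennreal (m s) * indicator {0..t} s \<partial>lborel)"
    using h by (intro nn_integral_continuous_Icc[symmetric] cont_m) (simp add: m_def)
  also have "\<dots> \<le> (\<integral>\<^sup>+s. ennreal (exp ((s - t) / h) / h) * indicator {0..t} s * (TVR \<Omega> \<alpha> (u s) * indicator {0..S} s) \<partial>lborel)"
  proof (rule nn_integral_mono)
    fix s
    have "ennreal (m s) = ennreal (exp ((s - t) / h) / h) * ennreal (L s)"
    proof -
      have "ennreal (max 0 (L s)) = ennreal (L s)" by (simp add: max_def ennreal_neg)
      moreover have "ennreal (m s) = ennreal (exp ((s - t) / h) / h) * ennreal (max 0 (L s))"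
        unfolding m_def using h by (intro ennreal_mult) auto
      ultimately show ?thesis by simp
    qed
    also have "\<dots> \<le> ennreal (exp ((s - t) / h) / h) * TVR \<Omega> \<alpha> (u s)"
      unfolding L_def by (intro mult_left_mono pairing_le_TVR open_\<Omega> \<Psi>) simp
    finally show "ennreal (m s) * indicator {0..t} s
        \<le> ennreal (exp ((s - t) / h) / h) * indicator {0..t} s * (TVR \<Omega> \<alpha> (u s) * indicator {0..S} s)"
      using t by (auto simp: indicator_def)
  qed
  also have "ennreal (l 0) \<le> TVR \<Omega> \<alpha> U0"
    unfolding l_def V_0 by (rule pairing_le_TVR[OF open_\<Omega> \<Psi>])
  finally show "ennreal (\<integral>x. V h (x, t) * frac_div \<alpha> \<Psi> x \<partial>M) \<le> TV_average \<alpha> h t"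
    unfolding TV_average_def l_def by (simp add: mult_left_mono)
qed

lemma nn_integral_TV_average:
  assumes \<alpha>: "0 < \<alpha>" "\<alpha> < 1" and h: "0 < h" and r: "0 \<le> r" "r \<le> S"
  shows "(\<integral>\<^sup>+t. TV_average \<alpha> h t * indicator {0..r} t \<partial>lborel) + ennreal h * TV_average \<alpha> h r
      = ennreal h * TVR \<Omega> \<alpha> U0 + (\<integral>\<^sup>+s. TVR \<Omega> \<alpha> (u s) * indicator {0..r} s \<partial>lborel)"
proof -
  have "(\<lambda>s. TVR \<Omega> \<alpha> (u s) * indicator {0..S} s) \<in> borel_measurable borel"
    using TVR_time_measurable[OF open_\<Omega> bounded_\<Omega> \<alpha> u_contL2] by simp
  from nn_integral_exp_average[OF h r(1) this, of "TVR \<Omega> \<alpha> U0"]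
  have "(\<integral>\<^sup>+t. TV_average \<alpha> h t * indicator {0..r} t \<partial>lborel) + ennreal h * TV_average \<alpha> h r
      = ennreal h * TVR \<Omega> \<alpha> U0 + (\<integral>\<^sup>+s. TVR \<Omega> \<alpha> (u s) * indicator {0..S} s * indicator {0..r} s \<partial>lborel)"
    unfolding TV_average_def .
  also have "(\<integral>\<^sup>+s. TVR \<Omega> \<alpha> (u s) * indicator {0..S} s * indicator {0..r} s \<partial>lborel)
      = (\<integral>\<^sup>+s. TVR \<Omega> \<alpha> (u s) * indicator {0..r} s \<partial>lborel)"
    using r by (intro nn_integral_cong) (auto simp: indicator_def)
  finally show ?thesis .
qed

text \<open>The identity for the averages has a finite right-hand side, so at every time both the
  accumulated average and \<open>h\<close> times the current one are finite. This makes the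
  mollification an admissible competitor, with finite variation at each time and not just at almost
  every time.\<close>

lemma L1w_V:
  assumes \<alpha>: "0 < \<alpha>" "\<alpha> < 1" and h: "0 < h" and T: "0 < T" "T \<le> S"
    and fin0: "TVR \<Omega> \<alpha> U0 < \<infinity>" and finT: "(\<integral>\<^sup>+s. TVR \<Omega> \<alpha> (u s) * indicator {0..T} s \<partial>lborel) < \<infinity>"
  shows "(\<integral>\<^sup>+t. TV_average \<alpha> h t * indicator {0..T} t \<partial>lborel) < \<infinity>" "TV_average \<alpha> h T < \<infinity>"
    and "\<And>t. t \<in> {0..T} \<Longrightarrow> TV_average \<alpha> h t < \<infinity>"
    and "L1w \<Omega> \<alpha> T (\<lambda>t x. V h (x, t))"
proof -
  have fin: "(\<integral>\<^sup>+t. TV_average \<alpha> h t * indicator {0..r} t \<partial>lborel) + ennreal h * TV_average \<alpha> h r < \<infinity>"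
    if r: "r \<in> {0..T}" for r
  proof -
    have "(\<integral>\<^sup>+s. TVR \<Omega> \<alpha> (u s) * indicator {0..r} s \<partial>lborel) \<le> (\<integral>\<^sup>+s. TVR \<Omega> \<alpha> (u s) * indicator {0..T} s \<partial>lborel)"
      using r by (intro nn_integral_mono) (auto simp: indicator_def)
    then have "(\<integral>\<^sup>+s. TVR \<Omega> \<alpha> (u s) * indicator {0..r} s \<partial>lborel) < \<infinity>" using finT by (rule order_le_less_trans)
    then show ?thesis
      using r T fin0 by (subst nn_integral_TV_average[OF \<alpha> h]) (auto simp: ennreal_mult_less_top)
  qed
  show int: "(\<integral>\<^sup>+t. TV_average \<alpha> h t * indicator {0..T} t \<partial>lborel) < \<infinity>"
    using fin[of T] T by simp
  show fin_t: "TV_average \<alpha> h t < \<infinity>" if "t \<in> {0..T}" for t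
    using fin[OF that] h by (auto simp: ennreal_mult_less_top)
  then show "TV_average \<alpha> h T < \<infinity>" using T by simp
  show "L1w \<Omega> \<alpha> T (\<lambda>t x. V h (x, t))"
    unfolding L1w_def prod.collapse
  proof (intro conjI ballI allI impI)
    fix t assume t: "t \<in> {0..T}"
    then have tS: "t \<in> {0..S}" using T by simp
    have "integrable M (\<lambda>x. V h (x, t))"
      by (rule sqint_imp_integrable[OF finite_measure_lebesgue_on_bounded_open[OF open_\<Omega> bounded_\<Omega>] sqint_V[OF h tS]])
    then have "set_integrable lebesgue \<Omega> (\<lambda>x. V h (x, t))"
      by (simp add: set_integrable_lebesgue_on[OF open_\<Omega>])
    moreover have "(\<lambda>x. indicator \<Omega> x *\<^sub>R V h (x, t)) = (\<lambda>x. V h (x, t))"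
      by (auto simp: fun_eq_iff indicator_def V_outside)
    ultimately have "integrable lebesgue (\<lambda>x. V h (x, t))" by (simp add: set_integrable_def)
    moreover have "TVR \<Omega> \<alpha> (\<lambda>x. V h (x, t)) < \<infinity>"
      using TVR_V_le[OF \<alpha> h tS] fin_t[OF t] by (rule order_le_less_trans)
    ultimately show "(\<lambda>x. V h (x, t)) \<in> BVR \<Omega> \<alpha>" by (simp add: BVR_def V_outside)
  next
    \<comment> \<open>With the constant 1 as second factor, integrability of products on the
      cylinder becomes that of \<open>V h\<close>.\<close>
    have "contL2 M T (\<lambda>t x. (\<lambda>_. 1) (x, t))"
      by (intro contL2_const sqint_one finite_measure_lebesgue_on_bounded_open open_\<Omega> bounded_\<Omega>)
    from slab_integral_mult(1)[OF open_\<Omega> V_borel _ represents_self represents_self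
        contL2_subset[OF contL2_V[OF h] T(2)] this]
    show "set_integrable lebesgue (\<Omega> \<times> {0<..<T}) (V h)" by simp
  next
    fix \<Psi> :: "'a \<Rightarrow> 'a" assume "C1c \<Psi>"
    from continuous_on_pairing[OF open_\<Omega> bounded_\<Omega> \<alpha> this contL2_subset[OF contL2_V[OF h] T(2)]]
    have "(\<lambda>t. \<integral>x. V h (x, t) * frac_div \<alpha> \<Psi> x \<partial>M) \<in> borel_measurable (restrict_space borel {0..T})"
      by (rule borel_measurable_continuous_on_restrict)
    moreover have "sets (restrict_space lborel {0..T}) = sets (restrict_space borel {0..T})"
      by (intro sets_restrict_space_cong) simp
    ultimately show "(\<lambda>t. LINT x:\<Omega>|lebesgue. V h (x, t) * frac_div \<alpha> \<Psi> x) \<in> borel_measurable (restrict_space lborel {0..T})"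
      unfolding set_integral_lebesgue_on[OF open_\<Omega>] by (simp cong: measurable_cong_sets)
  next
    have "(\<integral>\<^sup>+t\<in>{0..T}. TVR \<Omega> \<alpha> (\<lambda>x. V h (x, t)) \<partial>lborel) \<le> (\<integral>\<^sup>+t. TV_average \<alpha> h t * indicator {0..T} t \<partial>lborel)"
      using T by (intro nn_integral_mono) (auto simp: indicator_def intro!: TVR_V_le \<alpha> h)
    then show "(\<integral>\<^sup>+t\<in>{0..T}. TVR \<Omega> \<alpha> (\<lambda>x. V h (x, t)) \<partial>lborel) < \<infinity>"
      using int by (rule order_le_less_trans)
  qed
qed

end

section \<open>The energy inequality and its consequences\<close>

text \<open>The variational inequality is assumed on every horizon \<open>T \<le> S\<close>, while
  the mollification is the same for all of them; this yields bounds at each time \<open>T\<close>,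
  not only at \<open>S\<close>.\<close>

locale mollified_flow = time_mollification \<Omega> S u U U0
  for \<Omega> :: "'a::euclidean_space set" and S u U U0 +
  fixes \<alpha> \<kappa> :: real and K :: "('a \<Rightarrow> real) \<Rightarrow> ('a \<Rightarrow> real)" and u0 :: "'a \<Rightarrow> real"
  assumes \<alpha>: "0 < \<alpha>" "\<alpha> < 1" and K: "deblur_operator \<Omega> K" and \<kappa>: "0 \<le> \<kappa>"
    and u0_sqint: "sqint (lebesgue_on \<Omega>) u0" and u0_TVR: "TVR \<Omega> \<alpha> u0 < \<infinity>"
    and U0_eq: "AE x in lebesgue_on \<Omega>. U0 x = u0 x"
    and U_eq: "AE z in lebesgue. z \<in> \<Omega> \<times> {0<..<S} \<longrightarrow> U z = u (snd z) (fst z)"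
    and sol: "\<And>T. 0 < T \<Longrightarrow> T \<le> S \<Longrightarrow> var_sol \<Omega> \<alpha> \<kappa> K u0 T u"
begin

sublocale deblurring \<Omega> K
  by unfold_locales (rule open_\<Omega> bounded_\<Omega> K)+

abbreviation fidelity :: "('a \<Rightarrow> real) \<Rightarrow> real" where
  "fidelity f \<equiv> sqn M (\<lambda>x. K f x - u0 x)"

definition F0 :: real where
  "F0 = enn2real (TVR \<Omega> \<alpha> u0) + \<kappa> / 2 * fidelity u0"

lemma FR_u0: "FR \<Omega> \<alpha> \<kappa> K u0 u0 = ennreal F0"
proof -
  have "TVR \<Omega> \<alpha> u0 = ennreal (enn2real (TVR \<Omega> \<alpha> u0))" using u0_TVR by simp
  then show ?thesis unfolding FR_def F0_def L2sq_eq_sqn[OF open_\<Omega>]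
    using \<kappa> by (subst ennreal_plus) auto
qed

lemma F0_nonneg: "0 \<le> F0"
  using \<kappa> by (simp add: F0_def)

lemma TVR_U0: "TVR \<Omega> \<alpha> U0 = TVR \<Omega> \<alpha> u0"
  by (rule TVR_cong_AE[OF open_\<Omega> \<alpha> sqint_measurable[OF U0_sqint] sqint_measurable[OF u0_sqint] U0_eq])

lemma fidelity_U0: "fidelity U0 = fidelity u0"
proof (rule sqn_cong_AE)
  show "AE x in M. K U0 x - u0 x = K u0 x - u0 x"
    using K_cong_AE[OF U0_sqint u0_sqint U0_eq] by eventually_elim simp
qed (intro sqint_measurable sqint_diff sqint_K U0_sqint u0_sqint)+

lemma C0L2_V: "0 < h \<Longrightarrow> T \<le> S \<Longrightarrow> C0L2 \<Omega> T (\<lambda>t x. V h (x, t))"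
  unfolding C0L2_iff_contL2[OF open_\<Omega>] by (rule contL2_subset[OF contL2_V])

text \<open>By construction \<open>V - u\<close> is \<open>- h * W\<close> almost everywhere on the
  cylinder, so the term with the time derivative has a sign: it is a dissipation.\<close>

lemma slab_integral_test:
  assumes h: "0 < h" and T: "T \<le> S" and u: "set_integrable lebesgue (\<Omega> \<times> {0<..<T}) (\<lambda>z. u (snd z) (fst z))"
  shows "(LINT z:\<Omega> \<times> {0<..<T}|lebesgue. W h z * (V h z - u (snd z) (fst z))) = - h * energy h T"
proof -
  let ?S = "\<Omega> \<times> {0<..<T}"
  have open_S: "open ?S" by (intro open_Times open_\<Omega>) auto
  have ae: "AE z in lebesgue_on ?S. W h z * (V h z - u (snd z) (fst z)) = - h * (W h z)\<^sup>2"
    unfolding AE_lebesgue_on_iff[OF open_S] using U_eq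
  proof eventually_elim
    case (elim z)
    show ?case
    proof
      assume z: "z \<in> ?S"
      then have "z \<in> \<Omega> \<times> {0<..<S}" using T by auto
      then have "V h z - u (snd z) (fst z) = - h * W h z" using elim h by (simp add: W_def)
      then show "W h z * (V h z - u (snd z) (fst z)) = - h * (W h z)\<^sup>2" by (simp add: power2_eq_square)
    qed
  qed
  have meas: "W h \<in> borel_measurable (lebesgue_on ?S)" "V h \<in> borel_measurable (lebesgue_on ?S)"
    using measurable_compose[OF id_borel_measurable_lebesgue_on[of ?S] W_borel]
      measurable_compose[OF id_borel_measurable_lebesgue_on[of ?S] V_borel] by (simp_all add: id_def)
  have u_meas: "(\<lambda>z. u (snd z) (fst z)) \<in> borel_measurable (lebesgue_on ?S)"
    using u unfolding set_integrable_lebesgue_on[OF open_S] by (rule borel_measurable_integrable)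
  have "(LINT z:?S|lebesgue. W h z * (V h z - u (snd z) (fst z)))
      = (\<integral>z. W h z * (V h z - u (snd z) (fst z)) \<partial>lebesgue_on ?S)"
    by (rule set_integral_lebesgue_on[OF open_S])
  also have "\<dots> = (\<integral>z. - h * (W h z)\<^sup>2 \<partial>lebesgue_on ?S)"
    using meas u_meas by (intro integral_cong_AE ae) auto
  also have "\<dots> = - h * (LINT z:?S|lebesgue. (W h z)\<^sup>2)"
    unfolding set_integral_lebesgue_on[OF open_S] by (rule integral_mult_right_zero)
  finally show ?thesis by (simp add: slab_integral_W_square[OF h T])
qed

text \<open>Three relations are combined: \<open>E1\<close> for the variation, \<open>E2\<close> for
  the fidelity and \<open>E3\<close> from the variational inequality. The integrals
  \<open>tu\<close> and \<open>IG\<close> along \<open>u\<close> cancel, \<open>b\<close> and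
  \<open>IA\<close> are eliminated, and the rest is divided by \<open>h\<close>.\<close>

lemma energy_inequality:
  assumes h: "0 < h" and T: "0 < T" "T \<le> S"
  shows "TVR \<Omega> \<alpha> (\<lambda>x. V h (x, T)) + ennreal (\<kappa> / 2 * fidelity (\<lambda>x. V h (x, T))
      + energy h T + sqn M (\<lambda>x. V h (x, T) - u T x) / (2 * h)) \<le> ennreal F0"
proof -
  have L1w_u: "L1w \<Omega> \<alpha> T u" and
    var: "\<And>v w. L1w \<Omega> \<alpha> T v \<Longrightarrow> C0L2 \<Omega> T v \<Longrightarrow> weak_dt_L2 \<Omega> T v w \<Longrightarrow>
        enn2ereal (\<integral>\<^sup>+ t\<in>{0..T}. FR \<Omega> \<alpha> \<kappa> K u0 (u t) \<partial>lborel)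
        \<le> ereal (LINT z:\<Omega> \<times> {0<..<T}|lebesgue. w (snd z) (fst z) * (v (snd z) (fst z) - u (snd z) (fst z)))
          + enn2ereal (\<integral>\<^sup>+ t\<in>{0..T}. FR \<Omega> \<alpha> \<kappa> K u0 (v t) \<partial>lborel)
          - ereal (1/2 * L2sq \<Omega> (\<lambda>x. v T x - u T x))
          + ereal (1/2 * L2sq \<Omega> (\<lambda>x. v 0 x - u0 x))"
    using sol[OF T] unfolding var_sol_def by blast+
  have Tu_fin: "(\<integral>\<^sup>+s. TVR \<Omega> \<alpha> (u s) * indicator {0..T} s \<partial>lborel) < \<infinity>"
    and u_int: "set_integrable lebesgue (\<Omega> \<times> {0<..<T}) (\<lambda>z. u (snd z) (fst z))"
    using L1w_u by (auto simp: L1w_def)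
  note fin0 = u0_TVR[folded TVR_U0]
  note L1w = L1w_V[OF \<alpha> h T fin0 Tu_fin]
  define a where "a t = fidelity (\<lambda>x. V h (x, t))" for t
  define G where "G t = fidelity (u t)" for t
  have cont: "continuous_on {0..T} a" "continuous_on {0..T} G"
    unfolding a_def G_def
    by (intro contL2_sqn contL2_diff contL2_K contL2_const u0_sqint contL2_subset[OF contL2_V[OF h] T(2)]
        contL2_subset[OF u_contL2 T(2)])+
  define IA where "IA = integral {0..T} a"
  define IG where "IG = integral {0..T} G"
  have IA_nonneg: "0 \<le> IA"
    unfolding IA_def
    by (rule Henstock_Kurzweil_Integration.integral_nonneg[OF integrable_continuous_real[OF cont(1)]]) (simp add: a_def)
  have IG_nonneg: "0 \<le> IG"
    unfolding IG_def
    by (rule Henstock_Kurzweil_Integration.integral_nonneg[OF integrable_continuous_real[OF cont(2)]]) (simp add: G_def)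
  have fidelity_eq: "(\<integral>\<^sup>+t. FR \<Omega> \<alpha> \<kappa> K u0 (v t) * indicator {0..T} t \<partial>lborel)
      = (\<integral>\<^sup>+t. TVR \<Omega> \<alpha> (v t) * indicator {0..T} t \<partial>lborel) + ennreal (\<kappa> / 2 * integral {0..T} (\<lambda>t. fidelity (v t)))"
    if v: "contL2 M T v" for v
  proof -
    have c: "continuous_on {0..T} (\<lambda>t. \<kappa> / 2 * fidelity (v t))"
      by (intro continuous_intros contL2_sqn contL2_diff contL2_K contL2_const u0_sqint v)
    have cm: "(\<lambda>t. ennreal (\<kappa> / 2 * fidelity (v t)) * indicator {0..T} t) \<in> borel_measurable lborel"
    proof -
      have "(\<lambda>t. indicator {0..T} t *\<^sub>R (\<kappa> / 2 * fidelity (v t))) \<in> borel_measurable borel"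
        by (rule borel_measurable_continuous_on_indicator) (use c in auto)
      then have "(\<lambda>t. ennreal (indicator {0..T} t *\<^sub>R (\<kappa> / 2 * fidelity (v t)))) \<in> borel_measurable borel"
        by measurable
      also have "(\<lambda>t. ennreal (indicator {0..T} t *\<^sub>R (\<kappa> / 2 * fidelity (v t))))
          = (\<lambda>t. ennreal (\<kappa> / 2 * fidelity (v t)) * indicator {0..T} t)"
        by (auto simp: fun_eq_iff indicator_def)
      finally show ?thesis by simp
    qed
    have "(\<integral>\<^sup>+t. FR \<Omega> \<alpha> \<kappa> K u0 (v t) * indicator {0..T} t \<partial>lborel)
        = (\<integral>\<^sup>+t. TVR \<Omega> \<alpha> (v t) * indicator {0..T} t + ennreal (\<kappa> / 2 * fidelity (v t)) * indicator {0..T} t \<partial>lborel)"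
      by (simp add: FR_def L2sq_eq_sqn[OF open_\<Omega>] distrib_right)
    also have "\<dots> = (\<integral>\<^sup>+t. TVR \<Omega> \<alpha> (v t) * indicator {0..T} t \<partial>lborel)
        + (\<integral>\<^sup>+t. ennreal (\<kappa> / 2 * fidelity (v t)) * indicator {0..T} t \<partial>lborel)"
      by (rule nn_integral_add[OF TVR_time_measurable[OF open_\<Omega> bounded_\<Omega> \<alpha> v] cm])
    also have "(\<integral>\<^sup>+t. ennreal (\<kappa> / 2 * fidelity (v t)) * indicator {0..T} t \<partial>lborel)
        = ennreal (integral {0..T} (\<lambda>t. \<kappa> / 2 * fidelity (v t)))"
      by (rule nn_integral_continuous_Icc[OF c]) (use \<kappa> in simp)
    also have "integral {0..T} (\<lambda>t. \<kappa> / 2 * fidelity (v t)) = \<kappa> / 2 * integral {0..T} (\<lambda>t. fidelity (v t))"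
      by (rule integral_mult_right)
    finally show ?thesis .
  qed
  \<comment> \<open>Cancellation needs real numbers, so the finite extended integrals are replaced
    by their real values.\<close>
  obtain tu where tu: "0 \<le> tu" "(\<integral>\<^sup>+s. TVR \<Omega> \<alpha> (u s) * indicator {0..T} s \<partial>lborel) = ennreal tu"
    using Tu_fin by (auto simp: less_top_ennreal)
  obtain b where b: "0 \<le> b" "(\<integral>\<^sup>+t. TV_average \<alpha> h t * indicator {0..T} t \<partial>lborel) = ennreal b"
    using L1w(1) by (auto simp: less_top_ennreal)
  obtain BT where BT: "0 \<le> BT" "TV_average \<alpha> h T = ennreal BT"
    using L1w(2) by (auto simp: less_top_ennreal)
  define tv0 where "tv0 = enn2real (TVR \<Omega> \<alpha> u0)"
  have tv0: "0 \<le> tv0" "TVR \<Omega> \<alpha> U0 = ennreal tv0" using u0_TVR by (simp_all add: tv0_def TVR_U0)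
  have "ennreal b + ennreal h * ennreal BT = ennreal h * ennreal tv0 + ennreal tu"
    using nn_integral_TV_average[OF \<alpha> h, of T] T unfolding tu(2) b(2) BT(2) tv0(2) by simp
  then have "ennreal (b + h * BT) = ennreal (h * tv0 + tu)"
    using tu(1) b(1) BT(1) tv0(1) h by (simp add: ennreal_mult ennreal_plus)
  then have E1: "b + h * BT = h * tv0 + tu"
    using tu(1) b(1) BT(1) tv0(1) h by (subst (asm) ennreal_inj) auto
  have E2: "h * (a T - fidelity u0) + IA \<le> IG"
    using fidelity_V_le[OF K h T u0_sqint] unfolding fidelity_U0 by (simp add: a_def[abs_def] G_def[abs_def] IA_def IG_def)
  define D where "D = sqn M (\<lambda>x. V h (x, T) - u T x)"
  have X: "(\<integral>\<^sup>+ t\<in>{0..T}. FR \<Omega> \<alpha> \<kappa> K u0 (u t) \<partial>lborel) = ennreal (tu + \<kappa> / 2 * IG)"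
    unfolding fidelity_eq[OF contL2_subset[OF u_contL2 T(2)]] tu(2)
    using tu(1) IG_nonneg \<kappa> by (simp add: IG_def G_def[abs_def])
  have Y: "(\<integral>\<^sup>+ t\<in>{0..T}. FR \<Omega> \<alpha> \<kappa> K u0 (\<lambda>x. V h (x, t)) \<partial>lborel) \<le> ennreal (b + \<kappa> / 2 * IA)"
  proof -
    have "(\<integral>\<^sup>+t. TVR \<Omega> \<alpha> (\<lambda>x. V h (x, t)) * indicator {0..T} t \<partial>lborel) \<le> ennreal b"
      unfolding b(2)[symmetric] using T
      by (intro nn_integral_mono) (auto simp: indicator_def intro!: TVR_V_le \<alpha> h)
    then show ?thesis
      unfolding fidelity_eq[OF contL2_subset[OF contL2_V[OF h] T(2)]]
      using b(1) IA_nonneg \<kappa> by (simp add: IA_def a_def[abs_def] add_right_mono)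
  qed
  \<comment> \<open>The competitor starts from a version of \<open>u0\<close>, which removes the
    last term of the variational inequality.\<close>
  have init: "L2sq \<Omega> (\<lambda>x. V h (x, 0) - u0 x) = 0"
  proof -
    have "sqn M (\<lambda>x. U0 x - u0 x) = sqn M (\<lambda>_. 0)"
      by (rule sqn_cong_AE)
        (use U0_eq sqint_measurable[OF U0_sqint] sqint_measurable[OF u0_sqint] in auto)
    then show ?thesis by (simp add: L2sq_eq_sqn[OF open_\<Omega>] V_0 sqn_def)
  qed
  have "enn2ereal (ennreal (tu + \<kappa> / 2 * IG))
      \<le> ereal (- h * energy h T) + enn2ereal (\<integral>\<^sup>+ t\<in>{0..T}. FR \<Omega> \<alpha> \<kappa> K u0 (\<lambda>x. V h (x, t)) \<partial>lborel) - ereal (1/2 * D) + ereal 0"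
    using var[OF L1w(4) C0L2_V[OF h T(2)] weak_dt_V[OF h T]]
    unfolding X prod.collapse slab_integral_test[OF h T(2) u_int] init
    by (simp add: L2sq_eq_sqn[OF open_\<Omega>] D_def)
  also have "\<dots> \<le> ereal (- h * energy h T) + enn2ereal (ennreal (b + \<kappa> / 2 * IA)) - ereal (1/2 * D) + ereal 0"
    using Y by (intro add_mono ereal_minus_mono order_refl) (simp add: less_eq_ennreal.rep_eq)
  finally have E3': "enn2ereal (ennreal (tu + \<kappa> / 2 * IG))
      \<le> ereal (- h * energy h T) + enn2ereal (ennreal (b + \<kappa> / 2 * IA)) - ereal (1/2 * D) + ereal 0" .
  have "0 \<le> tu + \<kappa> / 2 * IG" "0 \<le> b + \<kappa> / 2 * IA"
    using tu(1) b(1) IG_nonneg IA_nonneg \<kappa> by simp_all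
  with E3' have E3: "tu + \<kappa> / 2 * IG \<le> - h * energy h T + (b + \<kappa> / 2 * IA) - D / 2"
    by (simp only: enn2ereal_ennreal) simp
  have "\<kappa> / 2 * (h * (a T - fidelity u0) + IA) \<le> \<kappa> / 2 * IG"
    using E2 \<kappa> by (intro mult_left_mono) auto
  with E1 E3 have "h * BT + h * energy h T + D / 2 + \<kappa> / 2 * (h * a T) \<le> h * tv0 + \<kappa> / 2 * (h * fidelity u0)"
    by (simp add: algebra_simps)
  then have "h * (BT + (\<kappa> / 2 * a T + energy h T + D / (2 * h))) \<le> h * F0"
    using h by (simp add: F0_def tv0_def[symmetric] algebra_simps)
  then have le: "BT + (\<kappa> / 2 * a T + energy h T + D / (2 * h)) \<le> F0" using h by simp
  have nonneg: "0 \<le> \<kappa> / 2 * a T + energy h T + D / (2 * h)"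
    using \<kappa> h energy_nonneg[OF h T(2)] by (simp add: a_def D_def)
  have "TVR \<Omega> \<alpha> (\<lambda>x. V h (x, T)) \<le> ennreal BT"
    using TVR_V_le[OF \<alpha> h, of T] T unfolding BT(2) by simp
  then have "TVR \<Omega> \<alpha> (\<lambda>x. V h (x, T)) + ennreal (\<kappa> / 2 * a T + energy h T + D / (2 * h))
     \<le> ennreal BT + ennreal (\<kappa> / 2 * a T + energy h T + D / (2 * h))" by (rule add_right_mono)
  also have "\<dots> = ennreal (BT + (\<kappa> / 2 * a T + energy h T + D / (2 * h)))"
    using BT(1) nonneg by (rule ennreal_plus[symmetric])
  also have "\<dots> \<le> ennreal F0" using le by (rule ennreal_leI)
  finally show ?thesis unfolding a_def D_def .
qed

text \<open>A single field in place of the supremum leaves a pairing that is continuous in L2, so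
  that the limit can be taken. The positive part reflects the truncation in
  \<open>ennreal\<close>.\<close>

lemma energy_inequality_real:
  assumes h: "0 < h" and T: "0 < T" "T \<le> S" and \<Psi>: "\<Psi> \<in> unit_fields"
  shows "max 0 (\<integral>x. V h (x, T) * frac_div \<alpha> \<Psi> x \<partial>M) + \<kappa> / 2 * fidelity (\<lambda>x. V h (x, T))
      + energy h T + sqn M (\<lambda>x. V h (x, T) - u T x) / (2 * h) \<le> F0"
proof -
  define p where "p = (\<integral>x. V h (x, T) * frac_div \<alpha> \<Psi> x \<partial>M)"
  define r where "r = \<kappa> / 2 * fidelity (\<lambda>x. V h (x, T))
      + energy h T + sqn M (\<lambda>x. V h (x, T) - u T x) / (2 * h)"
  have "0 \<le> r" unfolding r_def using \<kappa> h energy_nonneg[OF h T(2)] by simp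
  then have "ennreal (max 0 p + r) = ennreal p + ennreal r"
    by (simp add: max_def ennreal_neg)
  also have "\<dots> \<le> TVR \<Omega> \<alpha> (\<lambda>x. V h (x, T)) + ennreal r"
    unfolding p_def by (intro add_right_mono pairing_le_TVR open_\<Omega> \<Psi>)
  also have "\<dots> \<le> ennreal F0" unfolding r_def by (rule energy_inequality[OF h T])
  finally have "max 0 p + r \<le> F0" using F0_nonneg by (simp add: ennreal_le_iff)
  then show ?thesis by (simp add: p_def r_def)
qed

lemma zero_unit_field: "(\<lambda>_::'a. 0::'a) \<in> unit_fields"
proof -
  have "C1c (\<lambda>_::'a. 0::'a)"
    unfolding C1c_def by (intro conjI exI[of _ "\<lambda>_. 0"]) (auto simp: zero_blinfun.rep_eq)
  then show ?thesis by (simp add: unit_fields_def)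
qed

lemma energy_le: "0 < h \<Longrightarrow> 0 < T \<Longrightarrow> T \<le> S \<Longrightarrow> energy h T \<le> F0"
  and V_dist_le: "0 < h \<Longrightarrow> 0 < T \<Longrightarrow> T \<le> S \<Longrightarrow> sqn M (\<lambda>x. V h (x, T) - u T x) \<le> 2 * h * F0"
proof -
  assume A: "0 < h" "0 < T" "T \<le> S"
  define p where "p = (\<integral>x. V h (x, T) * frac_div \<alpha> (\<lambda>_. 0) x \<partial>M)"
  define c where "c = \<kappa> / 2 * fidelity (\<lambda>x. V h (x, T))"
  define d where "d = sqn M (\<lambda>x. V h (x, T) - u T x)"
  have nonneg: "0 \<le> max 0 p" "0 \<le> c" "0 \<le> d / (2 * h)" "0 \<le> energy h T"
    using \<kappa> A energy_nonneg[OF A(1,3)] by (simp_all add: c_def d_def)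
  have "max 0 p + c + energy h T + d / (2 * h) \<le> F0"
    using energy_inequality_real[OF A zero_unit_field] by (simp add: p_def c_def d_def)
  then have "energy h T \<le> F0" "d / (2 * h) \<le> F0" using nonneg by linarith+
  then show "energy h T \<le> F0" "sqn M (\<lambda>x. V h (x, T) - u T x) \<le> 2 * h * F0"
    using A by (simp_all add: d_def field_simps)
qed

section \<open>The limit of vanishing mollification parameter\<close>

definition hs :: "nat \<Rightarrow> real" where "hs n = 1 / real (Suc n)"

lemma hs_pos: "0 < hs n" by (simp add: hs_def)

lemma hs_antimono: "m \<le> n \<Longrightarrow> hs n \<le> hs m"
  by (simp add: hs_def frac_le)

lemma hs_tendsto: "hs \<longlonglongrightarrow> 0"
  unfolding hs_def using LIMSEQ_inverse_real_of_nat by (simp add: inverse_eq_divide)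

lemma L2lim_V:
  assumes T: "0 < T" "T \<le> S"
  shows "L2lim M sequentially (\<lambda>n x. V (hs n) (x, T)) (u T)"
  unfolding L2lim_def
proof (intro conjI always_eventually allI)
  show "sqint M (u T)" using contL2_sqint[OF u_contL2] T by simp
  show "sqint M (\<lambda>x. V (hs n) (x, T))" for n using sqint_V[OF hs_pos] T by simp
  have "(\<lambda>n. 2 * hs n * F0) \<longlonglongrightarrow> 2 * 0 * F0" by (intro tendsto_intros hs_tendsto)
  then have lim: "(\<lambda>n. 2 * hs n * F0) \<longlonglongrightarrow> 0" by simp
  show "(\<lambda>n. sqn M (\<lambda>x. V (hs n) (x, T) - u T x)) \<longlonglongrightarrow> 0"
    by (rule tendsto_sandwich[OF _ _ tendsto_const lim]) (auto intro!: always_eventually V_dist_le[OF hs_pos T])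
qed

text \<open>Lower semicontinuity by hand: the limit is taken for one field at a time together with
  the fidelity, and the supremum over fields afterwards.\<close>

lemma FR_le:
  assumes T: "0 < T" "T \<le> S"
  shows "FR \<Omega> \<alpha> \<kappa> K u0 (u T) \<le> ennreal F0"
proof -
  define c where "c = \<kappa> / 2 * fidelity (u T)"
  have c: "0 \<le> c" using \<kappa> by (simp add: c_def)
  have p_le: "max 0 (\<integral>x. u T x * frac_div \<alpha> \<Psi> x \<partial>M) + c \<le> F0" if \<Psi>: "\<Psi> \<in> unit_fields" for \<Psi>
  proof (rule LIMSEQ_le_const2)
    have fd: "sqint M (frac_div \<alpha> \<Psi>)"
      using \<Psi> by (intro sqint_frac_div[OF open_\<Omega> bounded_\<Omega> \<alpha>]) (simp add: unit_fields_def)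
    show "(\<lambda>n. max 0 (\<integral>x. V (hs n) (x, T) * frac_div \<alpha> \<Psi> x \<partial>M) + \<kappa> / 2 * fidelity (\<lambda>x. V (hs n) (x, T)))
        \<longlonglongrightarrow> max 0 (\<integral>x. u T x * frac_div \<alpha> \<Psi> x \<partial>M) + c"
      unfolding c_def
      by (intro tendsto_intros tendsto_max L2lim_inner L2lim_sqn L2lim_diff L2lim_K L2lim_const L2lim_V T fd u0_sqint)
    show "\<exists>N. \<forall>n\<ge>N. max 0 (\<integral>x. V (hs n) (x, T) * frac_div \<alpha> \<Psi> x \<partial>M) + \<kappa> / 2 * fidelity (\<lambda>x. V (hs n) (x, T)) \<le> F0"
    proof (intro exI allI impI)
      fix n :: nat
      have "0 \<le> energy (hs n) T" "0 \<le> sqn M (\<lambda>x. V (hs n) (x, T) - u T x) / (2 * hs n)"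
        using energy_nonneg[OF hs_pos T(2)] hs_pos[of n] by simp_all
      with energy_inequality_real[OF hs_pos[of n] T \<Psi>]
      show "max 0 (\<integral>x. V (hs n) (x, T) * frac_div \<alpha> \<Psi> x \<partial>M) + \<kappa> / 2 * fidelity (\<lambda>x. V (hs n) (x, T)) \<le> F0"
        by linarith
    qed
  qed
  have "TVR \<Omega> \<alpha> (u T) \<le> ennreal (F0 - c)"
    unfolding TVR_eq_SUP_lebesgue_on[OF open_\<Omega>]
  proof (rule SUP_least)
    fix \<Psi> :: "'a \<Rightarrow> 'a" assume "\<Psi> \<in> unit_fields"
    from p_le[OF this] show "ennreal (\<integral>x. u T x * frac_div \<alpha> \<Psi> x \<partial>M) \<le> ennreal (F0 - c)"
      by (intro ennreal_leI) simp
  qed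
  then have "FR \<Omega> \<alpha> \<kappa> K u0 (u T) \<le> ennreal (F0 - c) + ennreal c"
    unfolding FR_def L2sq_eq_sqn[OF open_\<Omega>] c_def by (rule add_right_mono)
  \<comment> \<open>If this were negative, \<open>ennreal (F0 - c)\<close> would be truncated and
    the sum would not be \<open>F0\<close>. The zero field supplies the sign, since the positive
    part is nonnegative.\<close>
  also have "0 \<le> F0 - c" using p_le[OF zero_unit_field] by simp
  then have "ennreal (F0 - c) + ennreal c = ennreal F0" using c by (simp add: ennreal_plus[symmetric])
  finally show ?thesis .
qed

text \<open>For positive times the increment bound of the mollification passes to the limit. At time
  0 the mollification equals \<open>U0\<close>, whose agreement with \<open>u 0\<close> is not at
  hand, so that case follows from continuity of \<open>u\<close> from the right.\<close>

lemma increment_le: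
  assumes t: "0 \<le> t" "t \<le> r" "r \<le> S"
  shows "sqn M (\<lambda>x. u r x - u t x) \<le> (r - t) * F0"
proof -
  have pos: "sqn M (\<lambda>x. u r x - u t x) \<le> (r - t) * F0" if t: "0 < t" "t \<le> r" for t
  proof (rule LIMSEQ_le_const2)
    show "(\<lambda>n. sqn M (\<lambda>x. V (hs n) (x, r) - V (hs n) (x, t))) \<longlonglongrightarrow> sqn M (\<lambda>x. u r x - u t x)"
      using t \<open>r \<le> S\<close> by (intro L2lim_sqn L2lim_diff L2lim_V) auto
    show "\<exists>N. \<forall>n\<ge>N. sqn M (\<lambda>x. V (hs n) (x, r) - V (hs n) (x, t)) \<le> (r - t) * F0"
    proof (intro exI allI impI)
      fix n :: nat
      have "sqn M (\<lambda>x. V (hs n) (x, r) - V (hs n) (x, t)) \<le> (r - t) * energy (hs n) S"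
        using t \<open>r \<le> S\<close> by (intro V_increment_le hs_pos) auto
      also have "\<dots> \<le> (r - t) * F0"
        using t energy_le[OF hs_pos S_pos] by (intro mult_left_mono) auto
      finally show "sqn M (\<lambda>x. V (hs n) (x, r) - V (hs n) (x, t)) \<le> (r - t) * F0" .
    qed
  qed
  consider "0 < t" | "t = 0" "r = 0" | "t = 0" "0 < r" using t by fastforce
  then show ?thesis
  proof cases
    case 1
    then show ?thesis using pos t by simp
  next
    case 2
    then show ?thesis by (simp add: sqn_def)
  next
    case 3
    have "L2lim M (at_right 0) u (u 0)"
      using u_contL2 S_pos at_within_Icc_at_right[OF S_pos] by (force simp: contL2_def)
    then have lim: "((\<lambda>s. sqn M (\<lambda>x. u r x - u s x)) \<longlongrightarrow> sqn M (\<lambda>x. u r x - u 0 x)) (at_right 0)"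
      using contL2_sqint[OF u_contL2, of r] 3 t by (intro L2lim_sqn L2lim_diff L2lim_const) auto
    have lim': "((\<lambda>s. (r - s) * F0) \<longlongrightarrow> (r - 0) * F0) (at_right 0)"
      by (intro tendsto_intros)
    have "sqn M (\<lambda>x. u r x - u 0 x) \<le> (r - 0) * F0"
    proof (rule tendsto_le[OF trivial_limit_at_right_real lim' lim])
      show "\<forall>\<^sub>F s in at_right 0. sqn M (\<lambda>x. u r x - u s x) \<le> (r - s) * F0"
        unfolding eventually_at_right_field using 3 pos by (intro exI[of _ r]) auto
    qed
    then show ?thesis using 3 by simp
  qed
qed

lemma C0halfL2: "C0halfL2 \<Omega> S u"
  unfolding C0halfL2_def L2_iff_sqint[OF open_\<Omega>] L2sq_eq_sqn[OF open_\<Omega>]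
proof (intro conjI exI ballI)
  show "sqint M (u t)" if "t \<in> {0..S}" for t by (rule contL2_sqint[OF u_contL2 that])
  fix s t assume st: "s \<in> {0..S}" "t \<in> {0..S}"
  have "sqn M (\<lambda>x. u t x - u s x) \<le> \<bar>t - s\<bar> * F0"
  proof (cases "s \<le> t")
    case True
    then show ?thesis using increment_le[of s t] st by simp
  next
    case False
    then show ?thesis using increment_le[of t s] st by (simp add: sqn_minus_commute[of M "u t"])
  qed
  then have "sqrt (sqn M (\<lambda>x. u t x - u s x)) \<le> sqrt (\<bar>t - s\<bar> * F0)" by simp
  also have "\<dots> = sqrt F0 * \<bar>t - s\<bar> powr (1 / 2)"
    by (simp add: real_sqrt_mult powr_half_sqrt)
  finally show "sqrt (sqn M (\<lambda>x. u t x - u s x)) \<le> sqrt F0 * \<bar>t - s\<bar> powr (1 / 2)" .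
qed

section \<open>Strong convergence of the time derivatives on the cylinder\<close>

abbreviation slab :: "('a \<times> real) set" where "slab \<equiv> \<Omega> \<times> {0<..<S}"

abbreviation N :: "('a \<times> real) measure" where "N \<equiv> lebesgue_on slab"

lemma open_slab: "open slab"
  by (intro open_Times open_\<Omega>) auto

lemma borel_measurable_slab:
  "G \<in> borel_measurable borel \<Longrightarrow> (G :: 'a \<times> real \<Rightarrow> real) \<in> borel_measurable N"
  using measurable_compose[OF id_borel_measurable_lebesgue_on[of slab]] by (simp add: id_def)

lemma slab_sqn:
  assumes "G \<in> borel_measurable borel" "represents M S G g" "contL2 M S g"
  shows "sqint N G" "sqn N G = integral {0..S} (\<lambda>t. sqn M (g t))"
proof -
  note si = slab_integral_mult[OF open_\<Omega> assms(1) assms(1) assms(2) assms(2) assms(3) assms(3)]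
  show "sqint N G"
    unfolding sqint_def
    using borel_measurable_slab[OF assms(1)] si(1)
    by (simp add: set_integrable_lebesgue_on[OF open_slab] power2_eq_square)
  show "sqn N G = integral {0..S} (\<lambda>t. sqn M (g t))"
    using si(2) by (simp add: sqn_def set_integral_lebesgue_on[OF open_slab] power2_eq_square)
qed

text \<open>The energies increase along \<open>hs\<close> and are bounded by \<open>F0\<close>, and
  their increments dominate the squared distances of the functions \<open>W (hs n)\<close>. Hence
  the sequence is Cauchy, and weak compactness is avoided.\<close>

lemma W_converges: "\<exists>w. L2lim N sequentially (\<lambda>n. W (hs n)) w"
proof (rule L2lim_sequence_complete)
  show "sqint N (W (hs n))" for n
    by (rule slab_sqn(1)[OF W_borel W_represents contL2_w[OF hs_pos]])
  show "energy (hs n) S \<le> F0" for n by (rule energy_le[OF hs_pos S_pos order_refl])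
  fix m n :: nat assume "m \<le> n"
  have "sqn N (\<lambda>z. W (hs n) z - W (hs m) z)
      = integral {0..S} (\<lambda>t. sqn M (\<lambda>x. w (hs n) t x - w (hs m) t x))"
  proof (rule slab_sqn(2))
    show "(\<lambda>z. W (hs n) z - W (hs m) z) \<in> borel_measurable borel" by measurable
    show "represents M S (\<lambda>z. W (hs n) z - W (hs m) z) (\<lambda>t x. w (hs n) t x - w (hs m) t x)"
      using W_represents[of "hs n"] W_represents[of "hs m"] unfolding represents_def
      by eventually_elim auto
    show "contL2 M S (\<lambda>t x. w (hs n) t x - w (hs m) t x)"
      by (intro contL2_diff contL2_w hs_pos)
  qed
  also have "\<dots> \<le> energy (hs n) S - energy (hs m) S"
    by (rule energy_diff_le[OF hs_pos hs_antimono[OF \<open>m \<le> n\<close>]])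
  finally show "sqn N (\<lambda>z. W (hs n) z - W (hs m) z) \<le> energy (hs n) S - energy (hs m) S" .
qed

text \<open>The difference of \<open>V\<close> and \<open>U\<close> is \<open>- h * W\<close>, whose
  norm tends to 0 because the energy stays bounded.\<close>

lemma V_converges: "L2lim N sequentially (\<lambda>n. V (hs n)) U"
  unfolding L2lim_def
proof (intro conjI always_eventually allI)
  show "sqint N U"
    by (rule slab_sqn(1)[OF U_borel U_represents u_contL2])
  show "sqint N (V (hs n))" for n
    by (rule slab_sqn(1)[OF V_borel represents_self contL2_V[OF hs_pos]])
  have "(\<lambda>n. (hs n)\<^sup>2 * F0) \<longlonglongrightarrow> 0\<^sup>2 * F0" by (intro tendsto_intros hs_tendsto)
  then have lim: "(\<lambda>n. (hs n)\<^sup>2 * F0) \<longlonglongrightarrow> 0" by simp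
  have le: "sqn N (\<lambda>z. V (hs n) z - U z) \<le> (hs n)\<^sup>2 * F0" for n
  proof -
    have "(\<lambda>z. V (hs n) z - U z) = (\<lambda>z. - hs n * W (hs n) z)"
      using hs_pos[of n] by (simp add: W_def fun_eq_iff)
    then have "sqn N (\<lambda>z. V (hs n) z - U z) = (hs n)\<^sup>2 * sqn N (W (hs n))"
      by (simp only: sqn_cmult power2_minus)
    also have "sqn N (W (hs n)) = energy (hs n) S"
      unfolding energy_def by (rule slab_sqn(2)[OF W_borel W_represents contL2_w[OF hs_pos]])
    also have "(hs n)\<^sup>2 * energy (hs n) S \<le> (hs n)\<^sup>2 * F0"
      by (intro mult_left_mono energy_le hs_pos S_pos) auto
    finally show ?thesis .
  qed
  show "(\<lambda>n. sqn N (\<lambda>z. V (hs n) z - U z)) \<longlonglongrightarrow> 0"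
    by (rule tendsto_sandwich[OF _ _ tendsto_const lim]) (auto intro!: always_eventually le)
qed

text \<open>Strong convergence of \<open>V (hs n)\<close> and \<open>W (hs n)\<close> carries the
  weak formulation and the energy bound to the limit. The Borel function \<open>U\<close> is
  exchanged for \<open>u\<close> only in the last integral, where equality almost everywhere
  suffices.\<close>

lemma weak_time_derivative:
  "\<exists>w. weak_dt_L2 \<Omega> S u w \<and> ennreal (LINT z:slab|lebesgue. (w (snd z) (fst z))\<^sup>2) \<le> ennreal F0"
proof -
  obtain wl where wl: "L2lim N sequentially (\<lambda>n. W (hs n)) wl" using W_converges by blast
  then have wl_sqint: "sqint N wl" by (simp add: L2lim_def)
  have "sqn N wl \<le> F0"
  proof (rule LIMSEQ_le_const2[OF L2lim_sqn[OF wl]])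
    have "sqn N (W (hs n)) \<le> F0" for n
      using slab_sqn(2)[OF W_borel W_represents contL2_w[OF hs_pos]] energy_le[OF hs_pos S_pos order_refl]
      by (simp add: energy_def)
    then show "\<exists>k. \<forall>n\<ge>k. sqn N (W (hs n)) \<le> F0" by blast
  qed
  then have bound: "(LINT z:slab|lebesgue. (wl z)\<^sup>2) \<le> F0"
    by (simp add: sqn_def set_integral_lebesgue_on[OF open_slab])
  have "L1w \<Omega> \<alpha> S u" using sol[OF S_pos order_refl] by (simp add: var_sol_def)
  then have "integrable N (\<lambda>z. u (snd z) (fst z))"
    by (simp add: L1w_def set_integrable_lebesgue_on[OF open_slab])
  then have u_meas: "(\<lambda>z. u (snd z) (fst z)) \<in> borel_measurable N" by (rule borel_measurable_integrable)
  have "weak_dt_L2 \<Omega> S u (\<lambda>t x. wl (x, t))"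
    unfolding weak_dt_L2_def prod.collapse
  proof (intro conjI allI impI)
    show "set_borel_measurable lebesgue slab wl"
      unfolding set_borel_measurable_lebesgue_on[OF open_slab] by (rule sqint_measurable[OF wl_sqint])
    show "set_integrable lebesgue slab (\<lambda>z. (wl z)\<^sup>2)"
      unfolding set_integrable_lebesgue_on[OF open_slab] by (rule sqint_integrable_sq[OF wl_sqint])
    fix \<phi> :: "'a \<times> real \<Rightarrow> real" assume \<phi>: "C1c \<phi> \<and> closure {z. \<phi> z \<noteq> 0} \<subseteq> slab"
    define \<phi>t where "\<phi>t z = frechet_derivative \<phi> (at z) (0, 1)" for z
    note tf = test_function_L2_derivative[OF conjunct1[OF \<phi>] conjunct2[OF \<phi>] open_\<Omega> bounded_\<Omega>, folded \<phi>t_def]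
    have \<phi>_sqint: "sqint N \<phi>"
      by (rule slab_sqn(1)[OF borel_measurable_continuous_onI[OF tf(1)] represents_self
            contL2_continuous[OF tf(1) open_\<Omega> bounded_\<Omega>]])
    have \<phi>t_sqint: "sqint N \<phi>t"
      by (rule slab_sqn(1)[OF borel_measurable_continuous_onI[OF tf(2)] represents_self
            contL2_continuous[OF tf(2) open_\<Omega> bounded_\<Omega>]])
    have "(\<integral>z. V (hs n) z * \<phi>t z \<partial>N) = - (\<integral>z. W (hs n) z * \<phi> z \<partial>N)" for n
      using weak_dt_V[OF hs_pos S_pos order_refl, of n] \<phi>
      unfolding weak_dt_L2_def prod.collapse set_integral_lebesgue_on[OF open_slab] \<phi>t_def by blast
    moreover have "(\<lambda>n. \<integral>z. V (hs n) z * \<phi>t z \<partial>N) \<longlonglongrightarrow> (\<integral>z. U z * \<phi>t z \<partial>N)"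
      by (intro L2lim_inner V_converges L2lim_const \<phi>t_sqint)
    moreover have "(\<lambda>n. - (\<integral>z. W (hs n) z * \<phi> z \<partial>N)) \<longlonglongrightarrow> - (\<integral>z. wl z * \<phi> z \<partial>N)"
      by (intro tendsto_minus L2lim_inner wl L2lim_const \<phi>_sqint)
    ultimately have lim: "(\<integral>z. U z * \<phi>t z \<partial>N) = - (\<integral>z. wl z * \<phi> z \<partial>N)"
      by (simp add: LIMSEQ_unique)
    have "(\<integral>z. u (snd z) (fst z) * \<phi>t z \<partial>N) = (\<integral>z. U z * \<phi>t z \<partial>N)"
    proof (rule integral_cong_AE)
      have "AE z in N. U z = u (snd z) (fst z)"
        unfolding AE_lebesgue_on_iff[OF open_slab] by (rule U_eq)
      then show "AE z in N. u (snd z) (fst z) * \<phi>t z = U z * \<phi>t z" by eventually_elim simp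
    qed (intro borel_measurable_times u_meas sqint_measurable[OF \<phi>t_sqint] borel_measurable_slab U_borel)+
    with lim show "(LINT z:slab|lebesgue. u (snd z) (fst z) * frechet_derivative \<phi> (at z) (0, 1))
        = - (LINT z:slab|lebesgue. wl z * \<phi> z)"
      unfolding set_integral_lebesgue_on[OF open_slab] \<phi>t_def[symmetric] by simp
  qed
  moreover have "ennreal (LINT z:slab|lebesgue. (wl (fst z, snd z))\<^sup>2) \<le> ennreal F0"
    using bound by (simp add: ennreal_leI)
  ultimately show ?thesis by (intro exI[of _ "\<lambda>t x. wl (x, t)"]) simp
qed

end

text \<open>Borel versions of \<open>u\<close> and \<open>u0\<close>, cut off outside \<Omega>, meet
  the assumptions of the locale. For \<open>u0\<close> such a version exists because membership in
  \<open>BVR\<close> makes it Lebesgue measurable on the whole space.\<close>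

lemma ex_mollified_flow:
  fixes \<Omega> :: "'a::euclidean_space set"
  assumes \<Omega>: "open \<Omega>" "bounded \<Omega>" and \<alpha>: "0 < \<alpha>" "\<alpha> < 1" and K: "deblur_operator \<Omega> K" and \<kappa>: "\<kappa> \<ge> 1"
    and u0: "L2 \<Omega> u0" "u0 \<in> BVR \<Omega> \<alpha>" and u: "global_var_sol \<Omega> \<alpha> \<kappa> K u0 u" and S: "0 < S"
  obtains U U0 where "mollified_flow \<Omega> S u U U0 \<alpha> \<kappa> K u0"
proof -
  have sol: "var_sol \<Omega> \<alpha> \<kappa> K u0 T u" if "0 < T" for T
    using u that by (simp add: global_var_sol_def)
  have u_int: "set_integrable lebesgue (\<Omega> \<times> {0<..<S}) (\<lambda>z. u (snd z) (fst z))" and u_cont: "C0L2 \<Omega> S u"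
    using sol[OF S] by (auto simp: var_sol_def L1w_def)
  obtain V where V: "V \<in> borel_measurable borel" "represents (lebesgue_on \<Omega>) S V u"
    "AE z in lebesgue. z \<in> \<Omega> \<times> {0<..<S} \<longrightarrow> V z = u (snd z) (fst z)"
    using Borel_representative[OF \<Omega>(1) u_int] by blast
  define U where "U z = indicator (\<Omega> \<times> UNIV) z * V z" for z
  have [measurable]: "\<Omega> \<times> (UNIV :: real set) \<in> sets borel" "\<Omega> \<in> sets borel"
    using \<Omega> by (auto intro!: borel_open open_Times)
  have U_rep: "represents (lebesgue_on \<Omega>) S U u"
    using V(2) unfolding represents_def
  proof eventually_elim
    case (elim t)
    show ?case
    proof
      assume "t \<in> {0<..<S}"
      with elim have "AE x in lebesgue_on \<Omega>. V (x, t) = u t x" by blast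
      with AE_space show "AE x in lebesgue_on \<Omega>. U (x, t) = u t x"
        by eventually_elim (simp add: U_def)
    qed
  qed
  have "u0 \<in> borel_measurable (completion lborel)"
    using u0(2) by (auto simp: BVR_def)
  from completion_ex_borel_measurable_real[OF this] obtain V0
    where V0: "V0 \<in> borel_measurable lborel" "AE x in lborel. u0 x = V0 x" by blast
  define U0 where "U0 x = indicator \<Omega> x * V0 x" for x
  have U0_borel: "U0 \<in> borel_measurable borel" using V0(1) unfolding U0_def by measurable
  have "AE x in lebesgue_on \<Omega>. U0 x = u0 x"
    unfolding AE_lebesgue_on_iff[OF \<Omega>(1)] using AE_completion[OF V0(2)] by eventually_elim (simp add: U0_def)
  moreover have u0_sqint: "sqint (lebesgue_on \<Omega>) u0" using u0(1) by (simp add: L2_iff_sqint[OF \<Omega>(1)])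
  moreover have "U0 \<in> borel_measurable (lebesgue_on \<Omega>)"
    using measurable_compose[OF id_borel_measurable_lebesgue_on[of \<Omega>] U0_borel] by (simp add: id_def)
  ultimately have "sqint (lebesgue_on \<Omega>) U0"
    by (intro sqint_cong_AE[OF u0_sqint]) auto
  have "mollified_flow \<Omega> S u U U0 \<alpha> \<kappa> K u0"
  proof
    show "U \<in> borel_measurable borel" unfolding U_def using V(1) by measurable
    show "AE z in lebesgue. z \<in> \<Omega> \<times> {0<..<S} \<longrightarrow> U z = u (snd z) (fst z)"
      using V(3) by eventually_elim (auto simp: U_def)
    show "contL2 (lebesgue_on \<Omega>) S u" using u_cont by (simp add: C0L2_iff_contL2[OF \<Omega>(1)])
    show "TVR \<Omega> \<alpha> u0 < \<infinity>" using u0(2) by (simp add: BVR_def)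
    show "\<And>x t. x \<notin> \<Omega> \<Longrightarrow> U (x, t) = 0" "\<And>x. x \<notin> \<Omega> \<Longrightarrow> U0 x = 0" by (simp_all add: U_def U0_def)
    show "0 \<le> \<kappa>" using \<kappa> by simp
  qed (fact | (rule sol, assumption))+
  then show ?thesis by (rule that)
qed

theorem theorem2p4:
  fixes \<Omega> :: "'a::euclidean_space set"
    and \<alpha> \<kappa> :: real
    and K :: "('a \<Rightarrow> real) \<Rightarrow> ('a \<Rightarrow> real)"
    and u0 :: "'a \<Rightarrow> real"
    and u :: "real \<Rightarrow> 'a \<Rightarrow> real"
  assumes "open \<Omega>" and "bounded \<Omega>"
    and "0 < \<alpha>" and "\<alpha> < 1"
    and "deblur_operator \<Omega> K"
    and "\<kappa> \<ge> 1"
    and "L2 \<Omega> u0" and "u0 \<in> BVR \<Omega> \<alpha>"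
    and "global_var_sol \<Omega> \<alpha> \<kappa> K u0 u"
  shows "(\<forall>T>0. C0halfL2 \<Omega> T u)
       \<and> (\<forall>T>0. \<exists>w. weak_dt_L2 \<Omega> T u w \<and>
              ennreal (LINT z:\<Omega> \<times> {0<..<T}|lebesgue. (w (snd z) (fst z))\<^sup>2) \<le> FR \<Omega> \<alpha> \<kappa> K u0 u0)
       \<and> (\<forall>t1 t2. 0 \<le> t1 \<and> t1 < t2 \<longrightarrow>
              ennreal (1 / (t2 - t1)) * (\<integral>\<^sup>+ t\<in>{t1..t2}. FR \<Omega> \<alpha> \<kappa> K u0 (u t) \<partial>lborel)
              \<le> FR \<Omega> \<alpha> \<kappa> K u0 u0)"
proof (intro conjI allI impI)
  fix T :: real assume T: "0 < T"
  obtain U U0 where "mollified_flow \<Omega> T u U U0 \<alpha> \<kappa> K u0"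
    using ex_mollified_flow[OF assms T] by blast
  then interpret mollified_flow \<Omega> T u U U0 \<alpha> \<kappa> K u0 .
  show "C0halfL2 \<Omega> T u" by (rule C0halfL2)
  show "\<exists>w. weak_dt_L2 \<Omega> T u w \<and>
      ennreal (LINT z:\<Omega> \<times> {0<..<T}|lebesgue. (w (snd z) (fst z))\<^sup>2) \<le> FR \<Omega> \<alpha> \<kappa> K u0 u0"
    unfolding FR_u0 by (rule weak_time_derivative)
next
  \<comment> \<open>A bound at each positive time, stronger than the bound on averages; time 0 is a
    null set and is discarded below.\<close>
  have FR_mono: "FR \<Omega> \<alpha> \<kappa> K u0 (u t) \<le> FR \<Omega> \<alpha> \<kappa> K u0 u0" if t: "0 < t" for t
  proof -
    obtain U U0 where "mollified_flow \<Omega> t u U U0 \<alpha> \<kappa> K u0"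
      using ex_mollified_flow[OF assms t] by blast
    then interpret mollified_flow \<Omega> t u U U0 \<alpha> \<kappa> K u0 .
    show ?thesis unfolding FR_u0 using t by (rule FR_le) simp
  qed
  fix t1 t2 :: real assume t: "0 \<le> t1 \<and> t1 < t2"
  have "(\<integral>\<^sup>+ t\<in>{t1..t2}. FR \<Omega> \<alpha> \<kappa> K u0 (u t) \<partial>lborel)
      \<le> (\<integral>\<^sup>+ t. FR \<Omega> \<alpha> \<kappa> K u0 u0 * indicator {t1..t2} t \<partial>lborel)"
  proof (rule nn_integral_mono_AE)
    show "AE s in lborel. FR \<Omega> \<alpha> \<kappa> K u0 (u s) * indicator {t1..t2} s \<le> FR \<Omega> \<alpha> \<kappa> K u0 u0 * indicator {t1..t2} s"
      using AE_lborel_not_endpoint[of 0]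
      by eventually_elim (use t in \<open>auto simp: indicator_def intro!: FR_mono\<close>)
  qed
  also have "\<dots> = FR \<Omega> \<alpha> \<kappa> K u0 u0 * ennreal (t2 - t1)"
    using t by (simp add: nn_integral_cmult_indicator)
  finally have "ennreal (1 / (t2 - t1)) * (\<integral>\<^sup>+ t\<in>{t1..t2}. FR \<Omega> \<alpha> \<kappa> K u0 (u t) \<partial>lborel)
      \<le> ennreal (1 / (t2 - t1)) * (FR \<Omega> \<alpha> \<kappa> K u0 u0 * ennreal (t2 - t1))"
    by (rule mult_left_mono) simp
  also have "\<dots> = FR \<Omega> \<alpha> \<kappa> K u0 u0 * (ennreal (1 / (t2 - t1)) * ennreal (t2 - t1))"
    by (simp only: mult_ac)
  also have "ennreal (1 / (t2 - t1)) * ennreal (t2 - t1) = 1"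
    using t by (simp add: ennreal_mult[symmetric])
  finally show "ennreal (1 / (t2 - t1)) * (\<integral>\<^sup>+ t\<in>{t1..t2}. FR \<Omega> \<alpha> \<kappa> K u0 (u t) \<partial>lborel) \<le> FR \<Omega> \<alpha> \<kappa> K u0 u0"
    by simp
qed

end
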